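(* Every nice graph $G=(V,E)$ is total weight $(1,5)$-choosable: for every assignment $L$ that assigns to each vertex $v\in V$ a set $L(v)$ of exactly $1$ real number and to each edge $e\in E$ a set $L(e)$ of exactly $5$ real numbers, there is a map $\phi:V\cup E\to\mathbb{R}$ with $\phi(z)\in L(z)$ for all $z\in V\cup E$ such that for every edge $\{u,v\}\in E$, $$\sum_{e\in E(u)}\phi(e)+\phi(u)\neq\sum_{e\in E(v)}\phi(e)+\phi(v).$$
   Context: All graphs are finite and simple; an edge is a $2$-element subset $\{i,j\}$ of the vertex set. For a vertex $i$, $E(i)$ denotes the set of edges incident to $i$. An edge $\{i,j\}$ is isolated if both $i$ and $j$ have degree $1$. A graph is nice if it has no isolated edges. *)

theory Defs
  imports Complex_Main
begin

definition simple_graph :: "'a set \<Rightarrow> 'a set set \<Rightarrow> bool" where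
  "simple_graph V E \<longleftrightarrow> finite V \<and> (\<forall>e\<in>E. e \<subseteq> V \<and> card e = 2)"

definition incident_edges :: "'a set set \<Rightarrow> 'a \<Rightarrow> 'a set set" where
  "incident_edges E i = {e \<in> E. i \<in> e}"

definition degree :: "'a set set \<Rightarrow> 'a \<Rightarrow> nat" where
  "degree E i = card (incident_edges E i)"

definition isolated_edge :: "'a set set \<Rightarrow> 'a set \<Rightarrow> bool" where
  "isolated_edge E e \<longleftrightarrow> e \<in> E \<and> (\<forall>i\<in>e. degree E i = 1)"

definition nice :: "'a set \<Rightarrow> 'a set set \<Rightarrow> bool" where
  "nice V E \<longleftrightarrow> simple_graph V E \<and> (\<forall>e\<in>E. \<not> isolated_edge E e)"

definition total_weight_choosable :: "'a set \<Rightarrow> 'a set set \<Rightarrow> nat \<Rightarrow> nat \<Rightarrow> bool" where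
  "total_weight_choosable V E k l \<longleftrightarrow>
    (\<forall>LV :: 'a \<Rightarrow> real set. \<forall>LE :: 'a set \<Rightarrow> real set.
      (\<forall>v\<in>V. finite (LV v) \<and> card (LV v) = k) \<longrightarrow>
      (\<forall>e\<in>E. finite (LE e) \<and> card (LE e) = l) \<longrightarrow>
      (\<exists>phiV :: 'a \<Rightarrow> real. \<exists>phiE :: 'a set \<Rightarrow> real.
         (\<forall>v\<in>V. phiV v \<in> LV v) \<and> (\<forall>e\<in>E. phiE e \<in> LE e) \<and>
         (\<forall>u v. {u, v} \<in> E \<longrightarrow>
            (\<Sum>e\<in>incident_edges E u. phiE e) + phiV u \<noteq>
            (\<Sum>e\<in>incident_edges E v. phiE e) + phiV v)))"

end

theory Submission
  imports Defs "HOL-Library.FuncSet"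
begin

text \<open>
  By the Combinatorial Nullstellensatz it suffices to find a monomial in which every edge variable
  has exponent at most 4 and whose coefficient in
  $P_G = \prod_{uv \in E} (\sum_{e \ni u} x_e - \sum_{e \ni v} x_e)$ does not vanish (a ``good'' edge set).
  Such a monomial exists as soon as $P_G(z) \neq 0$ for some elements $z_e$ with $z_e^5 = 0$ of some
  commutative ring. We use the algebra generated by square-zero elements $\epsilon_i$, in which
  nonvanishing can be tested after multiplication by any further element.

  The edges avoiding a suitable vertex set $C$ (the cell) form, apart from isolated edges, a smaller
  nice graph, whose nonzero value is by induction a multiple of a monomial that annihilates all of
  its variables. Multiplying by it makes the vertex sums outside $C$ vanish, so that only
  the sums at the vertices of $C$ matter; edges that become isolated are paid for by a private
  square-zero variable (a token) on an edge joining them to $C$. Three kinds of cells suffice: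
  an edge whose degree sum is at most 6; two adjacent vertices with many common neighbours;
  and an independent set. For the last one, each outside vertex with at least two neighbours in $C$
  carries a fixed-point-free permutation of these neighbours, and the product of the resulting
  linear forms has a coefficient that is a positive sum of squares up to sign.
\<close>

section \<open>The algebra of square-zero elements\<close>

text \<open>The list size 5 enters in two ways. A sum of four variables has vanishing fifth power,
  which suits an edge whose ends have at most four further edges. So has a sum of two cube-zero
  values, which lets an edge of an independent cell serve both as an arc and as the image of an arc.
  The obstacle is the isolated edges left outside a cell: each needs a token edge that is not an
  arc. For a maximum independent set \<open>S\<close>, an end with a single neighbour in
  \<open>S\<close> offers such an edge for free. If both ends have several, an arc has to be
  dropped, which costs one unit at its tail and one at its head; a vertex of \<open>S\<close> can
  afford one unit if fewer than half of its neighbours are private to it. Otherwise its private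
  neighbours form a clique and supply the adjacent pair. When the dropped arcs cannot be kept
  disjoint, the ends concerned contain, together with some leaves, an independent cell that isolates
  no edge at all.\<close>

typedef 'i sq = "{f :: 'i set \<Rightarrow> int. \<forall>A. infinite A \<longrightarrow> f A = 0}"
  morphisms cf Abs_sq
  by (rule exI[of _ "\<lambda>_. 0"]) simp

setup_lifting type_definition_sq

lemma cf_infinite [simp]: "infinite A \<Longrightarrow> cf x A = 0"
  using cf[of x] by auto

text \<open>Coefficients are indexed by sets of variables, one for each square-free monomial, with 0
  forced at infinite sets. So only finite sets have to be compared, and there the sum over
  \<open>Pow A\<close> in the product is finite, whatever the type of variables.\<close>

lemma sq_eqI: "(\<And>A. finite A \<Longrightarrow> cf x A = cf y A) \<Longrightarrow> x = y"
  by (metis cf_infinite cf_inject ext)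

instantiation sq :: (type) comm_ring_1
begin

lift_definition zero_sq :: "'a sq" is "\<lambda>_. 0" by simp
lift_definition one_sq :: "'a sq" is "\<lambda>A. if A = {} then 1 else 0" by auto
lift_definition plus_sq :: "'a sq \<Rightarrow> 'a sq \<Rightarrow> 'a sq" is "\<lambda>f g A. f A + g A" by simp
lift_definition minus_sq :: "'a sq \<Rightarrow> 'a sq \<Rightarrow> 'a sq" is "\<lambda>f g A. f A - g A" by simp
lift_definition uminus_sq :: "'a sq \<Rightarrow> 'a sq" is "\<lambda>f A. - f A" by simp
text \<open>Convolution over the splittings of \<open>A\<close> into two disjoint parts: monomials
  that share a variable contribute nothing, so every variable squares to zero.\<close>

lift_definition times_sq :: "'a sq \<Rightarrow> 'a sq \<Rightarrow> 'a sq" is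
  "\<lambda>f g A. \<Sum>B\<in>Pow A. f B * g (A - B)" by (simp add: finite_Pow_iff)

instance
proof
  fix a b c :: "'a sq"
  show "a * b * c = a * (b * c)"
  proof (rule sq_eqI)
    fix A :: "'a set" assume fin: "finite A"
    have sub: "finite B" if "B \<subseteq> A" for B using fin that by (rule rev_finite_subset)
    have "cf (a * b * c) A = (\<Sum>(B, C)\<in>Sigma (Pow A) Pow. cf a C * cf b (B - C) * cf c (A - B))"
      using fin sub by (simp add: times_sq.rep_eq sum_distrib_right sum.Sigma)
    also have "\<dots> = (\<Sum>(C, D)\<in>Sigma (Pow A) (\<lambda>C. Pow (A - C)). cf a C * (cf b D * cf c (A - C - D)))"
      \<comment> \<open>Chains \<open>C\<close> within \<open>B\<close> within \<open>A\<close>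
        correspond to disjoint pairs \<open>C\<close>, \<open>D\<close> through
        \<open>D = B - C\<close>.\<close>
      by (rule sum.reindex_bij_witness[of _ "\<lambda>(C, D). (C \<union> D, C)" "\<lambda>(B, C). (C, B - C)"])
         (auto simp: Un_absorb1 Diff_Diff_Int set_eq_iff subset_iff mult.assoc
            intro!: arg_cong2[of _ _ _ _ "(*)"] arg_cong[of _ _ "cf c"] arg_cong[of _ _ "cf b"])
    also have "\<dots> = cf (a * (b * c)) A"
      using fin by (simp add: times_sq.rep_eq sum_distrib_left sum.Sigma)
    finally show "cf (a * b * c) A = cf (a * (b * c)) A" .
  qed
  show "a * b = b * a"
  proof (rule sq_eqI)
    fix A :: "'a set" assume fin: "finite A"
    show "cf (a * b) A = cf (b * a) A" unfolding times_sq.rep_eq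
      by (rule sum.reindex_bij_witness[of _ "\<lambda>B. A - B" "\<lambda>B. A - B"])
         (auto simp: double_diff)
  qed
  show "1 * a = a"
  proof (rule sq_eqI)
    fix A :: "'a set" assume fin: "finite A"
    have "cf (1 * a) A = (\<Sum>B\<in>Pow A. if B = {} then cf a A else 0)"
      unfolding times_sq.rep_eq by (rule sum.cong) (auto simp: one_sq.rep_eq)
    also have "\<dots> = cf a A" using fin by (subst sum.delta) auto
    finally show "cf (1 * a) A = cf a A" .
  qed
  show "(a + b) * c = a * c + b * c"
    by (rule sq_eqI) (simp add: times_sq.rep_eq plus_sq.rep_eq distrib_right sum.distrib)
  show "(0::'a sq) \<noteq> 1"
  proof
    assume "(0::'a sq) = 1"
    then have "cf (0::'a sq) {} = cf 1 {}" by simp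
    then show False by (simp add: zero_sq.rep_eq one_sq.rep_eq)
  qed
qed (rule sq_eqI; simp add: plus_sq.rep_eq minus_sq.rep_eq uminus_sq.rep_eq zero_sq.rep_eq)+
end

text \<open>The product of the variables in \<open>U\<close> if \<open>U\<close> is finite; the
  default for infinite \<open>U\<close> is 0.\<close>

lift_definition mon :: "'i set \<Rightarrow> 'i sq" is "\<lambda>U A. if A = U \<and> finite U then 1 else 0" by auto

abbreviation eps :: "'i \<Rightarrow> 'i sq" where "eps i \<equiv> mon {i}"

lemma mon_empty [simp]: "mon {} = 1"
  by (rule sq_eqI) (simp add: mon.rep_eq one_sq.rep_eq)

lemma mon_mult:
  assumes "finite A" "finite B"
  shows "mon A * mon B = (if A \<inter> B = {} then mon (A \<union> B) else 0)"
proof (rule sq_eqI)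
  fix C :: "'a set" assume fin: "finite C"
  have "cf (mon A * mon B) C = (\<Sum>D\<in>Pow C. if D = A then (if C - A = B then 1 else 0) else 0)"
    unfolding times_sq.rep_eq by (rule sum.cong) (auto simp: mon.rep_eq assms)
  also have "\<dots> = (if A \<subseteq> C \<and> C - A = B then 1 else 0)"
    using fin by (subst sum.delta) auto
  also have "\<dots> = cf (if A \<inter> B = {} then mon (A \<union> B) else 0) C"
    using assms by (auto simp: mon.rep_eq zero_sq.rep_eq)
  finally show "cf (mon A * mon B) C = cf (if A \<inter> B = {} then mon (A \<union> B) else 0) C" .
qed

lemma cf_of_nat: "cf (of_nat n) A = (if A = {} then int n else 0)"
  by (induction n) (auto simp: zero_sq.rep_eq one_sq.rep_eq plus_sq.rep_eq)

lemma cf_of_int: "cf (of_int n) A = (if A = {} then n else 0)"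
  by (cases n rule: int_diff_cases) (auto simp: minus_sq.rep_eq cf_of_nat)

lemma cf_of_int_mult: "cf (of_int n * x) A = n * cf x A"
proof (cases "finite A")
  case True
  have "cf (of_int n * x) A = (\<Sum>D\<in>Pow A. if D = {} then n * cf x A else 0)"
    unfolding times_sq.rep_eq by (rule sum.cong) (auto simp: cf_of_int)
  then show ?thesis using True by (simp add: sum.delta)
qed simp

text \<open>Integer coefficients ensure that the factorials and binomial coefficients picked up
  later never destroy a monomial.\<close>

lemma of_int_mon_neq_0: "c \<noteq> 0 \<Longrightarrow> finite A \<Longrightarrow> of_int c * mon A \<noteq> 0"
  using cf_of_int_mult[of c "mon A" A] by (auto simp: mon.rep_eq zero_sq.rep_eq)

lemma eps_square [simp]: "eps i * eps i = 0"
  by (simp add: mon_mult)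

lemma eps_mult_mon: "finite A \<Longrightarrow> eps i * mon A = (if i \<in> A then 0 else mon (insert i A))"
  by (simp add: mon_mult)

lemma prod_eps: "finite A \<Longrightarrow> (\<Prod>i\<in>A. eps i) = mon A"
  by (induction A rule: finite_induct) (auto simp: eps_mult_mon)

text \<open>The binomial expansion stops after the linear term. For \<open>n = 0\<close> the
  truncated exponent \<open>n - 1\<close> is harmless because of the factor
  \<open>of_nat n\<close>.\<close>

lemma square_zero_power:
  fixes a b :: "'r::comm_ring_1"
  assumes "b * b = 0"
  shows "(a + b) ^ n = a ^ n + of_nat n * a ^ (n - 1) * b"
proof (induction n)
  case (Suc n)
  have "(a + b) ^ Suc n = (a ^ n + of_nat n * a ^ (n - 1) * b) * (a + b)"
    by (simp add: Suc mult.commute)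
  also have "\<dots> = a ^ n * a + a ^ n * b + of_nat n * (a ^ (n - 1) * a) * b + of_nat n * a ^ (n - 1) * (b * b)"
    by (simp add: algebra_simps)
  also have "of_nat n * (a ^ (n - 1) * a) = of_nat n * a ^ n"
    by (cases n) (auto simp: mult.commute)
  finally show ?case by (simp add: assms algebra_simps)
qed simp

text \<open>Only products of distinct variables survive, and every ordering of \<open>A\<close>
  yields the same monomial, hence the factorial. A sum of \<open>k\<close> variables thus realizes
  an element that is nilpotent of index exactly \<open>k + 1\<close>.\<close>

lemma sum_eps_power:
  assumes "finite A"
  shows "(\<Sum>i\<in>A. eps i) ^ card A = of_nat (fact (card A)) * mon A"
    and "n > card A \<Longrightarrow> (\<Sum>i\<in>A. eps i) ^ n = 0"
  using assms
proof (induction A arbitrary: n rule: finite_induct)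
  case empty
  { case 1 show ?case by simp next case 2 then show ?case by (simp add: power_0_left) }
next
  case (insert x A)
  have eq: "(\<Sum>i\<in>insert x A. eps i) = (\<Sum>i\<in>A. eps i) + eps x"
    using insert by (simp add: add.commute)
  { case 1
    have "(\<Sum>i\<in>insert x A. eps i) ^ card (insert x A)
        = of_nat (Suc (card A)) * (of_nat (fact (card A)) * mon A) * eps x"
      using insert.hyps insert.IH(2)[of "Suc (card A)"]
      by (simp only: eq square_zero_power[OF eps_square] card_insert_disjoint diff_Suc_1) (simp add: insert.IH(1))
    also have "\<dots> = of_nat (Suc (card A)) * of_nat (fact (card A)) * (mon A * eps x)"
      by (simp only: mult.assoc)
    also have "\<dots> = of_nat (fact (card (insert x A))) * mon (insert x A)"
      using insert.hyps by (simp add: mon_mult distrib_right)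
    finally show ?case .
  next
    case 2
    show ?case using 2 insert.hyps insert.IH(2)[of n] insert.IH(2)[of "n - 1"]
      by (simp only: eq) (simp add: square_zero_power)
  }
qed

section \<open>Coefficients of the edge polynomial\<close>

text \<open>An arbitrary orientation of each edge; reversing it changes one factor of
  \<open>edge_product\<close> by a sign.\<close>

definition end1 :: "'a set \<Rightarrow> 'a" where "end1 e = (SOME x. x \<in> e)"
definition end2 :: "'a set \<Rightarrow> 'a" where "end2 e = (SOME x. x \<in> e \<and> x \<noteq> end1 e)"

lemma end1_end2_mem:
  assumes "card e = 2"
  shows "end1 e \<in> e" "end2 e \<in> e" "end1 e \<noteq> end2 e"
proof -
  obtain x y where xy: "e = {x, y}" "x \<noteq> y" using card_2_iff[THEN iffD1, OF assms] by metis
  have "\<exists>z. z \<in> e" using xy(1) by blast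
  then show "end1 e \<in> e" unfolding end1_def by (rule someI_ex)
  have "\<exists>z. z \<in> e \<and> z \<noteq> c" for c using xy by (cases "c = x") auto
  then have "end2 e \<in> e \<and> end2 e \<noteq> end1 e" unfolding end2_def by (rule someI_ex)
  then show "end2 e \<in> e" "end1 e \<noteq> end2 e" by auto
qed

lemma end1_end2:
  assumes "card e = 2"
  shows "e = {end1 e, end2 e}"
proof -
  have "{end1 e, end2 e} \<subseteq> e" "card {end1 e, end2 e} = 2" using end1_end2_mem[OF assms] by auto
  then show ?thesis using assms by (metis card_subset_eq card.infinite zero_neq_numeral)
qed

definition vertex_sum :: "'a set set \<Rightarrow> ('a set \<Rightarrow> 'r::comm_monoid_add) \<Rightarrow> 'a \<Rightarrow> 'r" where
  "vertex_sum E z v = (\<Sum>e | e \<in> E \<and> v \<in> e. z e)"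

definition edge_product :: "'a set set \<Rightarrow> ('a set \<Rightarrow> 'r::comm_ring_1) \<Rightarrow> 'r" where
  "edge_product E z = (\<Prod>e\<in>E. vertex_sum E z (end1 e) - vertex_sum E z (end2 e))"

text \<open>The coefficient of the variable of \<open>e'\<close> in the factor of \<open>e\<close>.
  It is 0 if \<open>e'\<close> contains both ends, in particular for \<open>e' = e\<close>.\<close>

definition inc :: "'a set \<Rightarrow> 'a set \<Rightarrow> int" where
  "inc e e' = of_bool (end1 e \<in> e') - of_bool (end2 e \<in> e')"

text \<open>The coefficient of the monomial with exponents \<open>K\<close> in the product over
  \<open>I\<close> of the linear forms with rows \<open>a i\<close>: \<open>\<tau>\<close> picks a
  variable from each factor. The index sets of factors and variables are separate because the
  Nullstellensatz argument needs subproducts.\<close>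

definition coef :: "'i set \<Rightarrow> 'j set \<Rightarrow> ('i \<Rightarrow> 'j \<Rightarrow> int) \<Rightarrow> ('j \<Rightarrow> nat) \<Rightarrow> int" where
  "coef I J a K = (\<Sum>\<tau> | \<tau> \<in> PiE I (\<lambda>_. J) \<and> (\<forall>j\<in>J. card {i\<in>I. \<tau> i = j} = K j). \<Prod>i\<in>I. a i (\<tau> i))"

lemma coef_degree:
  assumes "finite I" "finite J" "coef I J a K \<noteq> 0"
  shows "sum K J = card I"
proof -
  let ?T = "{\<tau> \<in> PiE I (\<lambda>_. J). \<forall>j\<in>J. card {i\<in>I. \<tau> i = j} = K j}"
  have "?T \<noteq> {}" using assms(3) unfolding coef_def by (rule contrapos_nn) (simp only: sum.empty)
  then obtain \<tau> where t: "\<tau> \<in> PiE I (\<lambda>_. J)" "\<And>j. j \<in> J \<Longrightarrow> card {i\<in>I. \<tau> i = j} = K j"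
    by blast
  have "sum K J = (\<Sum>j\<in>J. card {i\<in>I. \<tau> i = j})" by (rule sum.cong) (simp_all add: t)
  also have "\<dots> = (\<Sum>j\<in>J. \<Sum>i | i \<in> I \<and> \<tau> i = j. 1)" by (simp only: card_eq_sum)
  also have "\<dots> = (\<Sum>i\<in>I. 1)" using t(1) by (intro sum.group assms) auto
  finally show ?thesis by simp
qed

text \<open>The choices \<open>\<tau>\<close> are grouped by how often they pick each variable. The
  ring is arbitrary because the expansion is evaluated both in the square-zero algebra and in the
  reals.\<close>

lemma prod_linear_expand:
  fixes x :: "'j \<Rightarrow> 'r::comm_ring_1"
  and I :: "'i set"
  assumes I: "finite I" and J: "finite J"
  shows "(\<Prod>i\<in>I. \<Sum>j\<in>J. of_int (a i j) * x j)
    = (\<Sum>K\<in>PiE J (\<lambda>_. {..card I}). of_int (coef I J a K) * (\<Prod>j\<in>J. x j ^ K j))"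
proof -
  define head_count where "head_count \<tau> = restrict (\<lambda>j. card {i\<in>I. \<tau> i = j}) J" for \<tau> :: "'i \<Rightarrow> 'j"
  have "(\<Prod>i\<in>I. \<Sum>j\<in>J. of_int (a i j) * x j)
      = (\<Sum>\<tau>\<in>PiE I (\<lambda>_. J). \<Prod>i\<in>I. of_int (a i (\<tau> i)) * x (\<tau> i))"
    using I J by (subst prod_sum_PiE) auto
  also have "\<dots> = (\<Sum>\<tau>\<in>PiE I (\<lambda>_. J). of_int (\<Prod>i\<in>I. a i (\<tau> i)) * (\<Prod>j\<in>J. x j ^ head_count \<tau> j))"
  proof (rule sum.cong[OF refl])
    fix \<tau> assume t: "\<tau> \<in> PiE I (\<lambda>_. J)"
    have "(\<Prod>i\<in>I. x (\<tau> i)) = (\<Prod>j\<in>J. \<Prod>i | i \<in> I \<and> \<tau> i = j. x (\<tau> i))"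
      using t I J by (intro prod.group[symmetric]) auto
    also have "\<dots> = (\<Prod>j\<in>J. x j ^ head_count \<tau> j)" by (rule prod.cong) (auto simp: head_count_def)
    finally show "(\<Prod>i\<in>I. of_int (a i (\<tau> i)) * x (\<tau> i)) = of_int (\<Prod>i\<in>I. a i (\<tau> i)) * (\<Prod>j\<in>J. x j ^ head_count \<tau> j)"
      by (simp add: prod.distrib)
  qed
  also have "\<dots> = (\<Sum>K\<in>PiE J (\<lambda>_. {..card I}). \<Sum>\<tau> | \<tau> \<in> PiE I (\<lambda>_. J) \<and> head_count \<tau> = K.
      of_int (\<Prod>i\<in>I. a i (\<tau> i)) * (\<Prod>j\<in>J. x j ^ head_count \<tau> j))"
    using I J by (intro sum.group[symmetric]) (auto simp: head_count_def finite_PiE intro!: card_mono)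
  also have "\<dots> = (\<Sum>K\<in>PiE J (\<lambda>_. {..card I}). of_int (coef I J a K) * (\<Prod>j\<in>J. x j ^ K j))"
  proof (rule sum.cong[OF refl])
    fix K assume K: "K \<in> PiE J (\<lambda>_. {..card I})"
    have eq: "{\<tau> \<in> PiE I (\<lambda>_. J). head_count \<tau> = K} = {\<tau> \<in> PiE I (\<lambda>_. J). \<forall>j\<in>J. card {i\<in>I. \<tau> i = j} = K j}"
      using K unfolding head_count_def by (auto simp: fun_eq_iff PiE_def extensional_def restrict_def)
    have "(\<Sum>\<tau> | \<tau> \<in> PiE I (\<lambda>_. J) \<and> head_count \<tau> = K. of_int (\<Prod>i\<in>I. a i (\<tau> i)) * (\<Prod>j\<in>J. x j ^ head_count \<tau> j))
      = (\<Sum>\<tau> | \<tau> \<in> PiE I (\<lambda>_. J) \<and> head_count \<tau> = K. of_int (\<Prod>i\<in>I. a i (\<tau> i)) * (\<Prod>j\<in>J. x j ^ K j))"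
      by (rule sum.cong) auto
    then show "(\<Sum>\<tau> | \<tau> \<in> PiE I (\<lambda>_. J) \<and> head_count \<tau> = K. of_int (\<Prod>i\<in>I. a i (\<tau> i)) * (\<Prod>j\<in>J. x j ^ head_count \<tau> j))
      = of_int (coef I J a K) * (\<Prod>j\<in>J. x j ^ K j)"
      unfolding coef_def eq by (simp only: sum_distrib_right of_int_sum)
  qed
  finally show ?thesis .
qed

text \<open>The bound 4 is the list size minus one, as the Combinatorial Nullstellensatz
  demands.\<close>

definition good :: "'a set set \<Rightarrow> bool" where
  "good E \<longleftrightarrow> (\<exists>K. (\<forall>e\<in>E. K e \<le> 4) \<and> coef E E inc K \<noteq> 0)"

lemma vertex_sum_linear:
  fixes z :: "'a set \<Rightarrow> 'r::comm_ring_1"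
  assumes "finite E"
  shows "vertex_sum E z (end1 e) - vertex_sum E z (end2 e) = (\<Sum>e'\<in>E. of_int (inc e e') * z e')"
proof -
  have "vertex_sum E z v = (\<Sum>e'\<in>E. of_int (of_bool (v \<in> e')) * z e')" for v
    using assms unfolding vertex_sum_def by (simp add: sum.If_cases of_bool_def Int_def if_distrib[of "\<lambda>x. of_int x * _"] cong: if_cong)
  then show ?thesis by (simp add: inc_def left_diff_distrib sum_subtractf)
qed

lemma edge_product_expand:
  fixes z :: "'a set \<Rightarrow> 'r::comm_ring_1"
  assumes "finite E"
  shows "edge_product E z = (\<Sum>K\<in>PiE E (\<lambda>_. {..card E}). of_int (coef E E inc K) * (\<Prod>e\<in>E. z e ^ K e))"
  unfolding edge_product_def using assms by (simp add: vertex_sum_linear prod_linear_expand)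

text \<open>Some term of the expansion survives the evaluation; its coefficient is nonzero, and an
  exponent above 4 would have killed it.\<close>

lemma good_if_edge_product:
  fixes z :: "'a set \<Rightarrow> 'r::comm_ring_1"
  assumes "finite E" "edge_product E z \<noteq> 0" "\<And>e. e \<in> E \<Longrightarrow> z e ^ 5 = 0"
  shows "good E"
proof -
  obtain K where K: "of_int (coef E E inc K) * (\<Prod>e\<in>E. z e ^ K e) \<noteq> 0"
    using assms(1,2) unfolding edge_product_expand[OF assms(1)] by (meson sum.neutral)
  have "K e \<le> 4" if "e \<in> E" for e
  proof (rule ccontr)
    assume "\<not> K e \<le> 4"
    then have "z e ^ K e = z e ^ 5 * z e ^ (K e - 5)" by (simp flip: power_add)
    then have "(\<Prod>e\<in>E. z e ^ K e) = 0"
      using that assms(1,3) by (auto simp: prod.remove)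
    then show False using K by simp
  qed
  moreover have "coef E E inc K \<noteq> 0" using K by auto
  ultimately show ?thesis unfolding good_def by auto
qed

lemma mon_Sigma:
  assumes "finite A" "\<And>a. a \<in> A \<Longrightarrow> finite (B a)"
  shows "(\<Prod>a\<in>A. mon ({a} \<times> B a)) = mon (Sigma A B)"
  using assms
proof (induction A rule: finite_induct)
  case (insert a A)
  have "Sigma (insert a A) B = ({a} \<times> B a) \<union> Sigma A B" by auto
  then show ?case using insert by (auto simp: mon_mult finite_SigmaI)
qed simp

lemma sum_less_exists:
  fixes K K' :: "'j \<Rightarrow> nat"
  assumes "finite J" "sum K J \<le> sum K' J" "\<exists>j\<in>J. K' j \<noteq> K j"
  shows "\<exists>j\<in>J. K j < K' j"
proof (rule ccontr)
  assume "\<not> ?thesis"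
  then have le: "\<And>j. j \<in> J \<Longrightarrow> K' j \<le> K j" by force
  obtain j where "j \<in> J" "K' j \<noteq> K j" using assms(3) by auto
  then have "sum K' J < sum K J" using assms(1) le by (intro sum_strict_mono_ex1) (auto simp: order_less_le)
  then show False using assms(2) by simp
qed

text \<open>A converse of \<open>good_if_edge_product\<close> with a tailored evaluation:
  \<open>z e\<close> is the sum of \<open>K e\<close> private variables. All monomials have the same
  degree, so any other one exceeds \<open>K\<close> at some edge and vanishes. The surviving
  monomial uses up all private variables and is therefore annihilated by every
  \<open>z e\<close>.\<close>

lemma good_monomial:
  fixes E :: "'a set set"
  assumes "finite E" "good E"
  obtains z :: "'a set \<Rightarrow> ('a set \<times> nat) sq" and c U where
    "edge_product E z = of_int c * mon U" "c \<noteq> 0" "finite U" "U \<subseteq> E \<times> UNIV"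
    "\<And>e. e \<in> E \<Longrightarrow> z e ^ 5 = 0" "\<And>e. e \<in> E \<Longrightarrow> edge_product E z * z e = 0"
proof -
  obtain K0 where K0: "\<And>e. e \<in> E \<Longrightarrow> K0 e \<le> 4" "coef E E inc K0 \<noteq> 0"
    using assms(2) unfolding good_def by blast
  define K where "K = restrict K0 E"
  have cK: "coef E E inc K = coef E E inc K0" unfolding coef_def K_def
    by (rule sum.cong) auto
  have K4: "\<And>e. e \<in> E \<Longrightarrow> K e \<le> 4" and Kne: "coef E E inc K \<noteq> 0" using K0 cK by (auto simp: K_def)
  have Ksum: "sum K E = card E" by (rule coef_degree[OF assms(1,1) Kne])
  have KP: "K \<in> PiE E (\<lambda>_. {..card E})"
    using Ksum assms(1) by (auto simp: K_def member_le_sum simp flip: Ksum intro!: member_le_sum)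
  define z :: "'a set \<Rightarrow> ('a set \<times> nat) sq" where "z e = (\<Sum>i\<in>{e} \<times> {..<K e}. eps i)" for e
  have card: "card ({e} \<times> {..<K e}) = K e" for e by simp
  have zpow: "z e ^ K e = of_nat (fact (K e)) * mon ({e} \<times> {..<K e})" for e
    using sum_eps_power(1)[of "{e} \<times> {..<K e}"] unfolding z_def card by simp
  have zero: "z e ^ n = 0" if "n > K e" for e n
    using sum_eps_power(2)[of "{e} \<times> {..<K e}" n] that unfolding z_def card by simp
  define U where "U = Sigma E (\<lambda>e. {..<K e})"
  define c where "c = coef E E inc K * int (\<Prod>e\<in>E. fact (K e))"
  have "edge_product E z = (\<Sum>K'\<in>PiE E (\<lambda>_. {..card E}). if K' = K then of_int (coef E E inc K) * (\<Prod>e\<in>E. z e ^ K e) else 0)"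
    unfolding edge_product_expand[OF assms(1)]
  proof (rule sum.cong[OF refl])
    fix K' assume K': "K' \<in> PiE E (\<lambda>_. {..card E})"
    have "of_int (coef E E inc K') * (\<Prod>e\<in>E. z e ^ K' e) = 0" if "K' \<noteq> K"
    proof (cases "coef E E inc K' = 0")
      case False
      have "\<exists>e\<in>E. K' e \<noteq> K e" using that K' KP by (meson PiE_ext)
      moreover have "sum K' E = sum K E" using coef_degree[OF assms(1,1) False] Ksum by simp
      ultimately obtain e where "e \<in> E" "K e < K' e"
        using sum_less_exists[of E K K'] assms(1) by auto
      then have "(\<Prod>e\<in>E. z e ^ K' e) = 0" using assms(1) zero by (auto simp: prod.remove)
      then show ?thesis by simp
    qed simp
    then show "of_int (coef E E inc K') * (\<Prod>e\<in>E. z e ^ K' e)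
      = (if K' = K then of_int (coef E E inc K) * (\<Prod>e\<in>E. z e ^ K e) else 0)" by simp
  qed
  also have "\<dots> = of_int (coef E E inc K) * (\<Prod>e\<in>E. z e ^ K e)"
    using KP assms(1) by (simp add: sum.delta finite_PiE)
  also have "(\<Prod>e\<in>E. z e ^ K e) = of_nat (\<Prod>e\<in>E. fact (K e)) * mon U"
    unfolding zpow prod.distrib U_def using assms(1) by (simp add: mon_Sigma)
  finally have edge_product: "edge_product E z = of_int c * mon U" by (simp only: c_def of_int_mult of_int_of_nat_eq mult.assoc)
  have finU: "finite U" unfolding U_def using assms(1) by auto
  show ?thesis
  proof (rule that[OF edge_product _ finU])
    show "c \<noteq> 0" using Kne assms(1) by (simp add: c_def)
    show "U \<subseteq> E \<times> UNIV" by (auto simp: U_def)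
    show "z e ^ 5 = 0" if "e \<in> E" for e using K4[OF that] by (intro zero) simp
    show "edge_product E z * z e = 0" if "e \<in> E" for e
    proof -
      have "mon U * z e = (\<Sum>i\<in>{e} \<times> {..<K e}. mon U * eps i)" by (simp add: z_def sum_distrib_left)
      also have "\<dots> = 0" using that finU by (intro sum.neutral) (auto simp: mon_mult U_def)
      finally show ?thesis by (simp add: edge_product mult.assoc)
    qed
  qed
qed

section \<open>The Combinatorial Nullstellensatz by divided differences\<close>

text \<open>The weights are those of the divided difference of order \<open>k\<close> on the points
  of \<open>L\<close>, which kills all lower powers and sends the power \<open>k\<close> to
  1.\<close>

lemma power_sum_weights:
  fixes L :: "real set"
  assumes "card L = Suc k"
  shows "\<exists>w. \<forall>j\<le>k. (\<Sum>t\<in>L. w t * t ^ j) = (if j = k then 1 else 0)"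
  using assms
proof (induction k arbitrary: L)
  case 0
  then obtain t where "L = {t}" by (auto simp: card_1_singleton_iff)
  then show ?case by (intro exI[of _ "\<lambda>_. 1"]) simp
next
  case (Suc k)
  obtain s M where L: "L = insert s M" "s \<notin> M" "card M = Suc k"
    using card_Suc_eq[THEN iffD1, OF Suc.prems] by metis
  then have finM: "finite M" by (metis card.infinite nat.distinct(1))
  obtain w where w: "\<And>j. j \<le> k \<Longrightarrow> (\<Sum>t\<in>M. w t * t ^ j) = (if j = k then 1 else 0)"
    using Suc.IH[OF L(3)] by auto
  \<comment> \<open>Dividing by \<open>t - s\<close> makes \<open>m (Suc j) - s * m j\<close> the
    old moment of order \<open>j\<close>; the weight at \<open>s\<close> is chosen so that the
    zeroth moment vanishes.\<close>
  define w' where "w' t = (if t = s then - (\<Sum>t\<in>M. w t / (t - s)) else w t / (t - s))" for t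
  define m where "m j = (\<Sum>t\<in>L. w' t * t ^ j)" for j
  have eqM: "(\<Sum>t\<in>M. w' t * f t) = (\<Sum>t\<in>M. w t / (t - s) * f t)" for f
    using L(2) by (intro sum.cong) (auto simp: w'_def)
  have m0: "m 0 = 0" using L(2) finM eqM[of "\<lambda>_. 1"] unfolding m_def L(1) by (simp add: w'_def)
  have step: "m (Suc j) - s * m j = (\<Sum>t\<in>M. w t * t ^ j)" for j
  proof -
    have "m (Suc j) - s * m j = (\<Sum>t\<in>L. w' t * (t - s) * t ^ j)"
      by (simp add: m_def sum_distrib_left algebra_simps flip: sum_subtractf)
    also have "\<dots> = (\<Sum>t\<in>M. w' t * (t - s) * t ^ j)" using L finM by simp
    also have "\<dots> = (\<Sum>t\<in>M. w t * t ^ j)" using L(2) by (intro sum.cong) (auto simp: w'_def)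
    finally show ?thesis .
  qed
  have mj: "m j = 0" if "j \<le> k" for j using that
  proof (induction j)
    case (Suc j) then show ?case using step[of j] w[of j] by simp
  qed (simp add: m0)
  have "m (Suc k) = 1" using step[of k] w[of k] mj[of k] by simp
  then show ?case using mj by (intro exI[of _ w']) (auto simp: m_def le_Suc_eq)
qed

lemma power_sum_weights':
  fixes L :: "real set"
  assumes "finite L" "k < card L"
  obtains w where "\<And>j. j \<le> k \<Longrightarrow> (\<Sum>t\<in>L. w t * t ^ j) = (if j = k then 1 else 0)"
proof -
  obtain M where M: "M \<subseteq> L" "card M = Suc k"
    using obtain_subset_with_card_n[of "Suc k" L] assms by (metis Suc_leI)
  obtain w where w: "\<forall>j\<le>k. (\<Sum>t\<in>M. w t * t ^ j) = (if j = k then 1 else 0)"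
    using power_sum_weights[OF M(2)] by auto
  have "(\<Sum>t\<in>L. (if t \<in> M then w t else 0) * t ^ j) = (\<Sum>t\<in>M. w t * t ^ j)" for j
    using assms(1) M(1) by (intro sum.mono_neutral_cong_right) auto
  then show ?thesis using w by (intro that[of "\<lambda>t. if t \<in> M then w t else 0"]) simp
qed

text \<open>The Nullstellensatz with arbitrary constants \<open>b\<close> added to the factors. A
  weighted sum over the grid of lists kills every monomial having some exponent below
  \<open>K\<close> and sends the monomial \<open>K\<close> to 1. As the degree of \<open>K\<close>
  equals the number of factors, the weighted sum of the product is \<open>coef E E inc K\<close>, so
  the product is nonzero at some grid point.\<close>

lemma good_imp_nonzero:
  fixes L :: "'a set \<Rightarrow> real set" and b :: "'a set \<Rightarrow> real"
  assumes fin: "finite E" and "good E" and L: "\<And>e. e \<in> E \<Longrightarrow> card (L e) = 5"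
  obtains y where "\<And>e. e \<in> E \<Longrightarrow> y e \<in> L e" "\<And>e. e \<in> E \<Longrightarrow> vertex_sum E y (end1 e) - vertex_sum E y (end2 e) + b e \<noteq> 0"
proof -
  obtain K where K4: "\<And>e. e \<in> E \<Longrightarrow> K e \<le> 4" and Kne: "coef E E inc K \<noteq> 0"
    using assms(2) unfolding good_def by blast
  have Ksum: "sum K E = card E" by (rule coef_degree[OF fin fin Kne])
  have finL: "finite (L e)" if "e \<in> E" for e using L[OF that] by (metis card.infinite zero_neq_numeral)
  have "\<exists>w. \<forall>j\<le>K e. (\<Sum>t\<in>L e. w t * t ^ j) = (if j = K e then 1 else 0)" if e: "e \<in> E" for e
  proof -
    have "K e < card (L e)" using K4[OF e] L[OF e] by simp
    then obtain w where "\<And>j. j \<le> K e \<Longrightarrow> (\<Sum>t\<in>L e. w t * t ^ j) = (if j = K e then 1 else 0)"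
      using power_sum_weights'[of "L e" "K e"] finL[OF e] by metis
    then show ?thesis by blast
  qed
  then obtain w where w: "\<And>e j. e \<in> E \<Longrightarrow> j \<le> K e \<Longrightarrow> (\<Sum>t\<in>L e. w e t * t ^ j) = (if j = K e then 1 else 0)"
    by metis
  define Y where "Y = PiE E L"
  have finY: "finite Y" unfolding Y_def using fin finL by (simp add: finite_PiE)
  \<comment> \<open>The tensor product of the one-variable functionals given by the weights
    \<open>w e\<close>.\<close>
  define \<Phi> where "\<Phi> f = (\<Sum>y\<in>Y. (\<Prod>e\<in>E. w e (y e)) * f y)" for f :: "('a set \<Rightarrow> real) \<Rightarrow> real"
  have \<Phi>_mon: "\<Phi> (\<lambda>y. \<Prod>e\<in>E. y e ^ K' e) = (\<Prod>e\<in>E. \<Sum>t\<in>L e. w e t * t ^ K' e)" for K'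
    unfolding \<Phi>_def Y_def using fin finL by (simp add: prod_sum_PiE prod.distrib)
  have \<Phi>_zero: "\<Phi> (\<lambda>y. \<Prod>e\<in>E. y e ^ K' e) = 0" if e: "e \<in> E" "K' e < K e" for K' e
    unfolding \<Phi>_mon using e fin w[of e "K' e"] by (auto simp: prod.remove)
  have \<Phi>_K: "\<Phi> (\<lambda>y. \<Prod>e\<in>E. y e ^ K e) = 1" unfolding \<Phi>_mon using w by simp
  have \<Phi>_sum: "\<Phi> (\<lambda>y. \<Sum>i\<in>A. f i y) = (\<Sum>i\<in>A. \<Phi> (f i))" for A :: "'x set" and f
    unfolding \<Phi>_def by (simp add: sum_distrib_left sum.swap[of _ A])
  have \<Phi>_scale: "\<Phi> (\<lambda>y. c * f y) = c * \<Phi> f" for c f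
    unfolding \<Phi>_def by (simp add: sum_distrib_left mult.left_commute)
  define X where "X e y = (\<Sum>e'\<in>E. of_int (inc e e') * y e')" for e and y :: "'a set \<Rightarrow> real"
  have \<Phi>_prod: "\<Phi> (\<lambda>y. \<Prod>e\<in>D. X e y)
      = (\<Sum>K'\<in>PiE E (\<lambda>_. {..card D}). of_int (coef D E inc K') * \<Phi> (\<lambda>y. \<Prod>e\<in>E. y e ^ K' e))"
    if "D \<subseteq> E" for D
    using that fin finite_subset[OF that fin]
    unfolding X_def by (simp add: prod_linear_expand \<Phi>_sum \<Phi>_scale)
  \<comment> \<open>With fewer than \<open>card E\<close> factors the degree is below that of
    \<open>K\<close>, so every monomial has some exponent below \<open>K\<close>.\<close>
  have lower: "\<Phi> (\<lambda>y. \<Prod>e\<in>D. X e y) = 0" if D: "D \<subseteq> E" "D \<noteq> E" for D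
    unfolding \<Phi>_prod[OF D(1)]
  proof (rule sum.neutral, rule ballI)
    fix K' assume "K' \<in> PiE E (\<lambda>_. {..card D})"
    show "of_int (coef D E inc K') * \<Phi> (\<lambda>y. \<Prod>e\<in>E. y e ^ K' e) = 0"
    proof (cases "coef D E inc K' = 0")
      case False
      have "finite D" using D fin finite_subset by auto
      then have "sum K' E < sum K E"
        using coef_degree[OF _ fin False] Ksum psubset_card_mono[OF fin, of D] D by auto
      then have "\<exists>e\<in>E. K' e < K e" by (meson not_le sum_mono)
      then show ?thesis using \<Phi>_zero by auto
    qed simp
  qed
  have top: "\<Phi> (\<lambda>y. \<Prod>e\<in>E. X e y) = of_int (coef E E inc K)"
  proof -
    have "\<Phi> (\<lambda>y. \<Prod>e\<in>E. X e y)
        = (\<Sum>K'\<in>PiE E (\<lambda>_. {..card E}). if K' = restrict K E then of_int (coef E E inc K) else 0)"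
      unfolding \<Phi>_prod[OF subset_refl]
    proof (rule sum.cong[OF refl])
      fix K' assume K': "K' \<in> PiE E (\<lambda>_. {..card E})"
      show "of_int (coef E E inc K') * \<Phi> (\<lambda>y. \<Prod>e\<in>E. y e ^ K' e)
        = (if K' = restrict K E then of_int (coef E E inc K) else 0)"
      proof (cases "K' = restrict K E")
        case True
        then have a: "\<And>e. e \<in> E \<Longrightarrow> K' e = K e" by simp
        then have "coef E E inc K' = coef E E inc K" unfolding coef_def by (intro sum.cong) auto
        moreover have "\<Phi> (\<lambda>y. \<Prod>e\<in>E. y e ^ K' e) = 1" using \<Phi>_K a by simp
        ultimately show ?thesis using True by simp
      next
        case ne: False
        show ?thesis
        proof (cases "coef E E inc K' = 0")
          case False
          have "\<exists>e\<in>E. K' e \<noteq> K e" using ne K' by (metis PiE_restrict restrict_ext)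
          then have "\<exists>e\<in>E. K' e < K e"
            using sum_less_exists[of E K' K] fin Ksum coef_degree[OF fin fin False] by (auto dest: not_sym)
          then show ?thesis using \<Phi>_zero ne by auto
        qed (simp add: ne)
      qed
    qed
    also have "\<dots> = of_int (coef E E inc K)"
      using fin Ksum by (subst sum.delta) (auto simp: finite_PiE simp flip: Ksum intro!: member_le_sum)
    finally show ?thesis .
  qed
  \<comment> \<open>\<open>D\<close> is the set of factors that contribute their linear form; the
    others contribute \<open>b\<close>.\<close>
  have "\<Phi> (\<lambda>y. \<Prod>e\<in>E. X e y + b e) = (\<Sum>D\<in>Pow E. (\<Prod>e\<in>E-D. b e) * \<Phi> (\<lambda>y. \<Prod>e\<in>D. X e y))"
    using fin by (simp add: prod_add \<Phi>_sum mult.commute[of "prod _ _" "prod b _"] \<Phi>_scale)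
  also have "\<dots> = (\<Sum>D\<in>Pow E. if D = E then of_int (coef E E inc K) else 0)"
    by (rule sum.cong) (auto simp: lower top)
  also have "\<dots> \<noteq> 0" using fin Kne by (simp add: sum.delta)
  finally obtain y where "y \<in> Y" "(\<Prod>e\<in>E. X e y + b e) \<noteq> 0"
    unfolding \<Phi>_def by (metis (no_types, lifting) mult_zero_right sum.neutral)
  then show ?thesis using fin by (intro that[of y]) (auto simp: Y_def X_def vertex_sum_linear PiE_def Pi_def)
qed

section \<open>Powers of the vertex forms of a digraph\<close>

definition lform :: "('i \<Rightarrow> 's) \<Rightarrow> ('i \<Rightarrow> 's) \<Rightarrow> 'i set \<Rightarrow> 's \<Rightarrow> 'i sq" where
  "lform src tgt F s = (\<Sum>f | f \<in> F \<and> src f = s. eps f) - (\<Sum>f | f \<in> F \<and> tgt f = s. eps f)"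

text \<open>\<open>B\<close> picks the tail of each arc in it and the head of each other arc. The
  result is the in-degree sequence of the orientation in which every arc points to its picked
  end.\<close>

definition head_count :: "('i \<Rightarrow> 's) \<Rightarrow> ('i \<Rightarrow> 's) \<Rightarrow> 'i set \<Rightarrow> 'i set \<Rightarrow> 's \<Rightarrow> nat" where
  "head_count src tgt F B s = card {f\<in>B. src f = s} + card {f\<in>F-B. tgt f = s}"

text \<open>The coefficient of the monomial with exponents \<open>v\<close> in the product of
  \<open>y (src f) - y (tgt f)\<close> over all arcs \<open>f\<close>, with one variable
  \<open>y s\<close> per vertex.\<close>

definition signed_count :: "('i \<Rightarrow> 's) \<Rightarrow> ('i \<Rightarrow> 's) \<Rightarrow> 'i set \<Rightarrow> ('s \<Rightarrow> nat) \<Rightarrow> int" where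
  "signed_count src tgt F v = (\<Sum>B | B \<subseteq> F \<and> head_count src tgt F B = v. (-1) ^ card (F - B))"

lemma cnt_insert_in:
  assumes "finite F" "f \<notin> F" "B \<subseteq> F"
  shows "head_count src tgt (insert f F) (insert f B) = (head_count src tgt F B)(src f := Suc (head_count src tgt F B (src f)))"
proof
  fix s
  have fB: "finite B" "f \<notin> B" using assms finite_subset by auto
  have 1: "{g \<in> insert f B. src g = s} = (if src f = s then insert f {g\<in>B. src g = s} else {g\<in>B. src g = s})" by auto
  have 2: "{g \<in> insert f F - insert f B. tgt g = s} = {g \<in> F - B. tgt g = s}" using assms by auto
  show "head_count src tgt (insert f F) (insert f B) s = ((head_count src tgt F B)(src f := Suc (head_count src tgt F B (src f)))) s"
    unfolding head_count_def 1 2 using fB by auto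
qed

lemma cnt_insert_out:
  assumes "finite F" "f \<notin> F" "B \<subseteq> F"
  shows "head_count src tgt (insert f F) B = (head_count src tgt F B)(tgt f := Suc (head_count src tgt F B (tgt f)))"
proof
  fix s
  have fB: "f \<notin> B" using assms by auto
  have 1: "{g \<in> insert f F - B. tgt g = s} = (if tgt f = s then insert f {g\<in>F - B. tgt g = s} else {g\<in>F-B. tgt g = s})"
    using fB by auto
  show "head_count src tgt (insert f F) B s = ((head_count src tgt F B)(tgt f := Suc (head_count src tgt F B (tgt f)))) s"
    unfolding head_count_def 1 using assms fB by auto
qed

lemma fun_upd_Suc_eq_iff:
  fixes g v :: "'s \<Rightarrow> nat"
  shows "g(x := Suc (g x)) = v \<longleftrightarrow> v x \<noteq> 0 \<and> g = v(x := v x - 1)"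
proof
  assume "g(x := Suc (g x)) = v"
  then have "v = g(x := Suc (g x))" by (rule sym)
  then show "v x \<noteq> 0 \<and> g = v(x := v x - 1)" by (simp add: fun_eq_iff)
next
  assume a: "v x \<noteq> 0 \<and> g = v(x := v x - 1)"
  have "(v(x := v x - 1))(x := Suc ((v(x := v x - 1)) x)) = v"
    using a by (simp only: fun_upd_upd fun_upd_same Suc_pred' fun_upd_triv) simp
  then show "g(x := Suc (g x)) = v" using a by (simp only:)
qed

text \<open>Multiplication by one more factor \<open>y (src f) - y (tgt f)\<close>: the variable
  taken from it lowers an exponent of \<open>v\<close>, which is impossible at exponent 0.\<close>

lemma signed_insert:
  assumes "finite F" "f \<notin> F"
  shows "signed_count src tgt (insert f F) v =
     (if v (src f) = 0 then 0 else signed_count src tgt F (v(src f := v (src f) - 1)))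
   - (if v (tgt f) = 0 then 0 else signed_count src tgt F (v(tgt f := v (tgt f) - 1)))"
proof -
  let ?F = "insert f F" and ?c = "head_count src tgt"
  let ?L = "{B. B \<subseteq> ?F \<and> ?c ?F B = v}" and ?I = "{B. B \<subseteq> F \<and> ?c ?F (insert f B) = v}"
    and ?O = "{B. B \<subseteq> F \<and> ?c ?F B = v}"
  have LIO: "?L = insert f ` ?I \<union> ?O"
  proof (intro equalityI subsetI)
    fix B assume B: "B \<in> ?L"
    show "B \<in> insert f ` ?I \<union> ?O"
    proof (cases "f \<in> B")
      case True
      then have "B = insert f (B - {f})" "B - {f} \<in> ?I" using B by (auto simp: insert_absorb)
      then show ?thesis by blast
    next
      case False
      then have "B \<subseteq> F" using B by blast
      then show ?thesis using B by blast
    qed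
  qed blast
  have fin: "finite ?I" "finite ?O" using assms(1) by (auto intro: finite_subset[of _ "Pow F"])
  have "signed_count src tgt ?F v = (\<Sum>B\<in>insert f ` ?I. (-1) ^ card (?F - B)) + (\<Sum>B\<in>?O. (-1) ^ card (?F - B))"
    unfolding signed_count_def LIO
  proof (rule sum.union_disjoint)
    have "f \<in> X" if "X \<in> insert f ` ?I" for X using that by (elim imageE) simp
    moreover have "f \<notin> X" if "X \<in> ?O" for X using that assms(2) by (elim CollectE conjE) (rule contra_subsetD)
    ultimately show "insert f ` ?I \<inter> ?O = {}" by (meson disjoint_iff)
  qed (use fin in simp_all)
  also have "(\<Sum>B\<in>insert f ` ?I. (-1) ^ card (?F - B)) = (\<Sum>B\<in>?I. (-1) ^ card (?F - insert f B) :: int)"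

  proof (rule sum.reindex_cong[OF _ refl refl])
    show "inj_on (insert f) ?I"
    proof (rule inj_onI)
      fix x y assume "x \<in> ?I" "y \<in> ?I" and eq: "insert f x = insert f y"
      then have "f \<notin> x" "f \<notin> y" using assms(2) by (auto simp only: mem_Collect_eq)
      then show "x = y" using eq by (simp add: insert_ident)
    qed
  qed
  also have "\<dots> = (\<Sum>B | B \<subseteq> F \<and> v (src f) \<noteq> 0 \<and> ?c F B = v(src f := v (src f) - 1). (-1) ^ card (F - B))"
  proof (rule sum.cong)
    show "?I = {B. B \<subseteq> F \<and> v (src f) \<noteq> 0 \<and> ?c F B = v(src f := v (src f) - 1)}"
      by (rule Collect_cong, rule conj_cong[OF refl]) (simp only: cnt_insert_in[OF assms] fun_upd_Suc_eq_iff)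
    fix B
    have "?F - insert f B = F - B" using assms(2) by auto
    then show "(-1) ^ card (?F - insert f B) = ((-1 :: int) ^ card (F - B))" by simp
  qed
  also have "\<dots> = (if v (src f) = 0 then 0 else signed_count src tgt F (v(src f := v (src f) - 1)))"
    unfolding signed_count_def by simp
  also have "(\<Sum>B\<in>?O. (-1) ^ card (?F - B)) = (\<Sum>B | B \<subseteq> F \<and> v (tgt f) \<noteq> 0 \<and> ?c F B = v(tgt f := v (tgt f) - 1). - ((-1) ^ card (F - B)) :: int)"
  proof (rule sum.cong)
    show "?O = {B. B \<subseteq> F \<and> v (tgt f) \<noteq> 0 \<and> ?c F B = v(tgt f := v (tgt f) - 1)}"
      by (rule Collect_cong, rule conj_cong[OF refl]) (simp only: cnt_insert_out[OF assms] fun_upd_Suc_eq_iff)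
    fix B assume "B \<in> {B. B \<subseteq> F \<and> v (tgt f) \<noteq> 0 \<and> ?c F B = v(tgt f := v (tgt f) - 1)}"
    then have "?F - B = insert f (F - B)" using assms by blast
    then show "(-1) ^ card (?F - B) = - ((-1 :: int) ^ card (F - B))" using assms by simp
  qed
  also have "\<dots> = - (if v (tgt f) = 0 then 0 else signed_count src tgt F (v(tgt f := v (tgt f) - 1)))"
    unfolding signed_count_def by (simp add: sum_negf)
  finally show ?thesis by simp
qed

lemma prod_fun_upd:
  assumes "finite S" "p \<in> S"
  shows "(\<Prod>s\<in>S. g ((v(p := k)) s)) = g k * (\<Prod>s\<in>S-{p}. g (v s))"
  using assms by (simp add: prod.remove)

lemma expand_sq_factors:
  fixes a :: "'r::comm_ring_1"
  shows "(a + x * c * e) * (b + y * d * (- e)) * r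
    = a * b * r + x * e * (c * b * r) - y * e * (a * d * r) - x * y * c * d * r * (e * e)"
  by (simp add: algebra_simps)

text \<open>A duality: up to factorials, the coefficient of the product of all arc variables in the
  powers of the vertex forms is the coefficient of \<open>v\<close> in the product of the arc
  differences. The variable of a new arc occurs in two forms only, with opposite signs, and squares
  to zero, which reproduces \<open>signed_insert\<close>. If the total exponent exceeds the number
  of arcs, some variable repeats in every term.\<close>

lemma lform_prod:
  fixes src tgt :: "'i \<Rightarrow> 's"
  assumes "finite F" "finite S"
    and "\<And>f. f \<in> F \<Longrightarrow> src f \<in> S \<and> tgt f \<in> S \<and> src f \<noteq> tgt f"
    and "\<And>s. s \<notin> S \<Longrightarrow> v s = 0" "card F \<le> sum v S"
  shows "(\<Prod>s\<in>S. lform src tgt F s ^ v s) =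
    (if sum v S = card F then of_int (int (\<Prod>s\<in>S. fact (v s)) * signed_count src tgt F v) * mon F else 0)"
  using assms(1,3-)
proof (induction F arbitrary: v rule: finite_induct)
  case empty
  show ?case
  proof (cases "\<forall>s\<in>S. v s = 0")
    case True
    have "v s = 0" for s by (cases "s \<in> S") (use True empty.prems(2) in auto)
    then have v0: "v = (\<lambda>_. 0)" by (rule ext)
    have "{B. B \<subseteq> {} \<and> head_count src tgt {} B = v} = {{}}"
      unfolding v0 by (auto simp: head_count_def)
    then have 1: "signed_count src tgt {} v = 1" unfolding signed_count_def by (simp only: sum.insert) simp
    show ?thesis unfolding v0 using 1[unfolded v0] by simp
  next
    case False
    then obtain s where s: "s \<in> S" "v s \<noteq> 0" by blast
    have "lform src tgt {} s ^ v s = 0" using s(2) by (simp add: lform_def power_0_left)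
    then have z: "(\<Prod>s\<in>S. lform src tgt {} s ^ v s) = 0"
      by (intro prod_zero[OF assms(2)] bexI[OF _ s(1)])
    have "sum v S \<noteq> 0" using s assms(2) by auto
    then have ne: "sum v S \<noteq> card ({} :: 'i set)" by simp
    show ?thesis unfolding if_not_P[OF ne] by (rule z)
  qed
next
  case (insert f F)
  define p q where "p = src f" and "q = tgt f"
  have pq: "p \<in> S" "q \<in> S" "p \<noteq> q" using insert.prems(1)[of f] by (auto simp: p_def q_def)
  let ?l = "lform src tgt F" and ?e = "eps f"
  define P where "P v = (\<Prod>s\<in>S. ?l s ^ v s)" for v :: "'s \<Rightarrow> nat"
  have lp: "lform src tgt (insert f F) p = ?l p + ?e"
  proof -
    have "{g \<in> insert f F. src g = p} = insert f {g\<in>F. src g = p}" "{g \<in> insert f F. tgt g = p} = {g\<in>F. tgt g = p}"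
      using pq p_def q_def by auto
    then show ?thesis unfolding lform_def using insert.hyps by (simp add: algebra_simps)
  qed
  have lq: "lform src tgt (insert f F) q = ?l q + - ?e"
  proof -
    have "{g \<in> insert f F. src g = q} = {g\<in>F. src g = q}" "{g \<in> insert f F. tgt g = q} = insert f {g\<in>F. tgt g = q}"
      using pq p_def q_def by auto
    then show ?thesis unfolding lform_def using insert.hyps by (simp add: algebra_simps)
  qed
  have lr: "lform src tgt (insert f F) s = ?l s" if "s \<noteq> p" "s \<noteq> q" for s
  proof -
    have "{g \<in> insert f F. src g = s} = {g\<in>F. src g = s}" "{g \<in> insert f F. tgt g = s} = {g\<in>F. tgt g = s}"
      using that p_def q_def by auto
    then show ?thesis unfolding lform_def by simp
  qed
  let ?R = "\<Prod>s\<in>S-{p}-{q}. ?l s ^ v s"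
  have split: "(\<Prod>s\<in>S. g s) = g p * g q * (\<Prod>s\<in>S-{p}-{q}. g s)" for g :: "'s \<Rightarrow> 'r::comm_monoid_mult"
  proof -
    have "(\<Prod>s\<in>S-{p}. g s) = g q * (\<Prod>s\<in>S-{p}-{q}. g s)"
      by (rule prod.remove) (use assms(2) pq in auto)
    then show ?thesis by (simp only: prod.remove[OF assms(2) pq(1), of g] mult.assoc)
  qed
  have Pv: "P v = ?l p ^ v p * ?l q ^ v q * ?R" unfolding P_def by (rule split)
  have R: "(\<Prod>s\<in>S-{p}-{q}. ?l s ^ (v(r := k)) s) = ?R" if "r \<in> {p, q}" for r k
    using that by (intro prod.cong) auto
  have Pp: "P (v(p := v p - 1)) = ?l p ^ (v p - 1) * ?l q ^ v q * ?R"
    unfolding P_def split using pq R[of p] by (simp only: fun_upd_apply) simp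
  have Pq: "P (v(q := v q - 1)) = ?l p ^ v p * ?l q ^ (v q - 1) * ?R"
    unfolding P_def split using pq R[of q] by (simp only: fun_upd_apply) simp
  have sq: "?e * ?e = 0" "(- ?e) * (- ?e) = 0" by simp_all
  have "(\<Prod>s\<in>S. lform src tgt (insert f F) s ^ v s) = (?l p + ?e) ^ v p * (?l q + - ?e) ^ v q * ?R"
    unfolding split lp lq using lr by simp
  also have "\<dots> = (?l p ^ v p + of_nat (v p) * ?l p ^ (v p - 1) * ?e) * (?l q ^ v q + of_nat (v q) * ?l q ^ (v q - 1) * (- ?e)) * ?R"
    by (simp only: square_zero_power[OF sq(1)] square_zero_power[OF sq(2)])
  also have "\<dots> = P v + of_nat (v p) * ?e * P (v(p := v p - 1)) - of_nat (v q) * ?e * P (v(q := v q - 1))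
      - of_nat (v p) * of_nat (v q) * ?l p ^ (v p - 1) * ?l q ^ (v q - 1) * ?R * (?e * ?e)"
    unfolding Pv Pp Pq by (rule expand_sq_factors)
  \<comment> \<open>Without the new arc, the total exponent exceeds the number of arcs.\<close>
  also have "P v = 0" unfolding P_def using insert.IH[of v] insert.prems insert.hyps by simp
  finally have main: "(\<Prod>s\<in>S. lform src tgt (insert f F) s ^ v s) =
     of_nat (v p) * ?e * P (v(p := v p - 1)) - of_nat (v q) * ?e * P (v(q := v q - 1))" by (simp only: sq(1) mult_zero_right diff_zero add_0_left)
  have sumupd: "sum (v(r := v r - 1)) S = sum v S - 1" if "r \<in> S" "v r \<noteq> 0" for r
    using that assms(2) by (simp add: sum.remove)
  have factupd: "v r * (\<Prod>s\<in>S. fact ((v(r := v r - 1)) s)) = (\<Prod>s\<in>S. fact (v s) :: nat)" if "r \<in> S" "v r \<noteq> 0" for r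
  proof -
    have "(\<Prod>s\<in>S. fact ((v(r := v r - 1)) s)) = fact (v r - 1) * (\<Prod>s\<in>S-{r}. fact (v s) :: nat)"
      using assms(2) that(1) by (rule prod_fun_upd)
    moreover have "(\<Prod>s\<in>S. fact (v s) :: nat) = fact (v r) * (\<Prod>s\<in>S-{r}. fact (v s))"
      using assms(2) that(1) by (rule prod.remove)
    moreover have "fact (v r) = v r * fact (v r - 1)" using that(2) by (simp add: fact_reduce)
    ultimately show ?thesis by (simp only: mult.assoc)
  qed
  have trm: "of_nat (v r) * ?e * P (v(r := v r - 1)) = (if sum v S = card (insert f F) then
      of_int (int (\<Prod>s\<in>S. fact (v s)) * (if v r = 0 then 0 else signed_count src tgt F (v(r := v r - 1)))) * mon (insert f F) else 0)"
    if "r \<in> S" for r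
  proof (cases "v r = 0")
    case False
    let ?v = "v(r := v r - 1)"
    have IH: "P ?v = (if sum ?v S = card F then of_int (int (\<Prod>s\<in>S. fact (?v s)) * signed_count src tgt F ?v) * mon F else 0)"
      unfolding P_def
    proof (rule insert.IH)
      show "card F \<le> sum ?v S" using insert.prems(3) insert.hyps sumupd[OF that False] by simp
      show "?v s = 0" if "s \<notin> S" for s using insert.prems(2)[OF that] \<open>r \<in> S\<close> that by auto
    qed (use insert.prems(1) in blast)
    have iff: "sum ?v S = card F \<longleftrightarrow> sum v S = card (insert f F)"
      using insert.prems(3) insert.hyps sumupd[OF that False] by auto
    show ?thesis
    proof (cases "sum v S = card (insert f F)")
      case True
      have "of_nat (v r) * ?e * (of_int (int (\<Prod>s\<in>S. fact (?v s)) * signed_count src tgt F ?v) * mon F)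
        = of_int (int (v r * (\<Prod>s\<in>S. fact (?v s))) * signed_count src tgt F ?v) * (?e * mon F)"
        by (simp only: of_int_mult of_int_of_nat_eq of_nat_mult ac_simps)
      also have "?e * mon F = mon (insert f F)" using insert.hyps eps_mult_mon[of F f] by simp
      finally show ?thesis using True False
        by (simp only: IH iff factupd[OF that False] if_True if_False simp_thms)
    next
      case F: False
      then show ?thesis by (simp only: IH iff if_False mult_zero_right)
    qed
  qed simp
  show ?case
  proof (cases "sum v S = card (insert f F)")
    case True
    then show ?thesis
      by (simp only: main trm[OF pq(1)] trm[OF pq(2)] simp_thms if_True signed_insert[OF insert.hyps(1,2)] p_def[symmetric] q_def[symmetric]
          right_diff_distrib left_diff_distrib of_int_diff)
  next
    case False
    then show ?thesis by (simp only: main trm[OF pq(1)] trm[OF pq(2)] if_False diff_self)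
  qed
qed

lemma cnt_weight:
  fixes x :: "'s \<Rightarrow> nat"
  assumes "finite F" "finite S" "B \<subseteq> F" "\<And>f. f \<in> F \<Longrightarrow> src f \<in> S \<and> tgt f \<in> S"
  shows "(\<Sum>s\<in>S. x s * head_count src tgt F B s) = (\<Sum>f\<in>F. if f \<in> B then x (src f) else x (tgt f))"
proof -
  have group: "(\<Sum>s\<in>S. x s * card {f\<in>D. g f = s}) = (\<Sum>f\<in>D. x (g f))" if "D \<subseteq> F" "\<And>f. f \<in> F \<Longrightarrow> g f \<in> S" for D g
  proof -
    have "(\<Sum>s\<in>S. x s * card {f\<in>D. g f = s}) = (\<Sum>s\<in>S. \<Sum>f | f \<in> D \<and> g f = s. x (g f))"
      by (rule sum.cong) simp_all
    also have "\<dots> = (\<Sum>f\<in>D. x (g f))"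
      using that finite_subset[OF that(1) assms(1)] assms(2) by (intro sum.group) auto
    finally show ?thesis .
  qed
  have "(\<Sum>s\<in>S. x s * head_count src tgt F B s) = (\<Sum>f\<in>B. x (src f)) + (\<Sum>f\<in>F-B. x (tgt f))"
    unfolding head_count_def distrib_left sum.distrib using assms(3,4) group[of B src] group[of "F - B" tgt] by simp
  also have "\<dots> = (\<Sum>f\<in>F. if f \<in> B then x (src f) else x (tgt f))"
    using assms(1,3) by (simp add: sum.If_cases Int_absorb1 Diff_eq)
  finally show ?thesis .
qed

text \<open>Number the vertices injectively and let \<open>B0\<close> direct every arc to its end
  with the larger number. This is the only choice maximizing the sum of the numbers of the picked
  ends, and that sum depends on the in-degrees alone.\<close>

lemma cnt_extremal:
  assumes "finite F" "finite S" "\<And>f. f \<in> F \<Longrightarrow> src f \<in> S \<and> tgt f \<in> S \<and> src f \<noteq> tgt f"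
  shows "\<exists>B0\<subseteq>F. \<forall>B\<subseteq>F. head_count src tgt F B = head_count src tgt F B0 \<longrightarrow> B = B0"
proof -
  obtain x :: "'b \<Rightarrow> nat" where x: "inj_on x S" using finite_imp_inj_to_nat_seg[OF assms(2)] by blast
  define B0 where "B0 = {f\<in>F. x (src f) > x (tgt f)}"
  have "B = B0" if B: "B \<subseteq> F" and eq: "head_count src tgt F B = head_count src tgt F B0" for B
  proof (rule ccontr)
    assume "B \<noteq> B0"
    have B0F: "B0 \<subseteq> F" by (auto simp: B0_def)
    obtain f where f: "f \<in> F" "(f \<in> B) \<noteq> (f \<in> B0)" using \<open>B \<noteq> B0\<close> B B0F by blast
    have ne: "x (src g) \<noteq> x (tgt g)" if "g \<in> F" for g using x assms(3)[OF that] by (meson inj_on_def)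
    let ?h = "\<lambda>B f. if f \<in> B then x (src f) else x (tgt f)"
    have "(\<Sum>f\<in>F. ?h B f) < (\<Sum>f\<in>F. ?h B0 f)"
    proof (rule sum_strict_mono_ex1[OF assms(1)])
      show "\<forall>f\<in>F. ?h B f \<le> ?h B0 f" by (simp add: B0_def)
      show "\<exists>f\<in>F. ?h B f < ?h B0 f"
      proof (rule bexI[OF _ f(1)])
        show "?h B f < ?h B0 f" using f ne[OF f(1)] by (cases "f \<in> B") (simp_all add: B0_def)
      qed
    qed
    moreover have "(\<Sum>f\<in>F. ?h B f) = (\<Sum>f\<in>F. ?h B0 f)"
      using cnt_weight[OF assms(1,2) B, of src tgt x] cnt_weight[OF assms(1,2) B0F, of src tgt x] assms(3)
      by (simp only: eq)
    ultimately show False by simp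
  qed
  moreover have "B0 \<subseteq> F" by (auto simp: B0_def)
  ultimately show ?thesis by blast
qed

text \<open>Grouping by \<open>head_count src tgt F X\<close> turns the sum into a sum of squares, and the class of the set from \<open>cnt_extremal\<close> contributes 1.\<close>
lemma signed_square_sum:
  assumes "finite F" "finite S" "\<And>f. f \<in> F \<Longrightarrow> src f \<in> S \<and> tgt f \<in> S \<and> src f \<noteq> tgt f"
  shows "(\<Sum>X\<in>Pow F. (-1) ^ card (F - X) * signed_count src tgt F (head_count src tgt F X)) > 0"
proof -
  let ?c = "head_count src tgt F"
  have fin: "finite (Pow F)" using assms(1) by simp
  have "(\<Sum>X\<in>Pow F. (-1) ^ card (F - X) * signed_count src tgt F (?c X))
     = (\<Sum>v\<in>?c ` Pow F. \<Sum>X | X \<in> Pow F \<and> ?c X = v. (-1) ^ card (F - X) * signed_count src tgt F (?c X))"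
    by (rule sum.image_gen[OF fin])
  also have "\<dots> = (\<Sum>v\<in>?c ` Pow F. signed_count src tgt F v * signed_count src tgt F v)"
  proof (rule sum.cong[OF refl])
    fix v
    have "(\<Sum>X | X \<in> Pow F \<and> ?c X = v. (-1) ^ card (F - X) * signed_count src tgt F (?c X))
       = (\<Sum>X | X \<subseteq> F \<and> ?c X = v. (-1) ^ card (F - X) * signed_count src tgt F v)"
      by (rule sum.cong) simp_all
    also have "\<dots> = (\<Sum>X | X \<subseteq> F \<and> ?c X = v. (-1) ^ card (F - X)) * signed_count src tgt F v"
      by (rule sum_distrib_right[symmetric])
    also have "\<dots> = signed_count src tgt F v * signed_count src tgt F v" unfolding signed_count_def ..
    finally show "(\<Sum>X | X \<in> Pow F \<and> ?c X = v. (-1) ^ card (F - X) * signed_count src tgt F (?c X))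
      = signed_count src tgt F v * signed_count src tgt F v"
      .
  qed
  also have "\<dots> > 0"
  proof -
    obtain B0 where B0: "B0 \<subseteq> F" "\<And>B. B \<subseteq> F \<Longrightarrow> ?c B = ?c B0 \<Longrightarrow> B = B0"
    proof -
      have "\<exists>B0\<subseteq>F. \<forall>B\<subseteq>F. ?c B = ?c B0 \<longrightarrow> B = B0"
        using assms(3) by (rule cnt_extremal[OF assms(1,2)])
      then show ?thesis using that by metis
    qed
    have "{B. B \<subseteq> F \<and> ?c B = ?c B0} = {B0}" using B0 by blast
    then have "signed_count src tgt F (?c B0) = (-1) ^ card (F - B0)" unfolding signed_count_def by (simp only:) simp
    then have "signed_count src tgt F (?c B0) \<noteq> 0" by simp
    moreover have "0 < x * x" if "x \<noteq> 0" for x :: int using that by (auto simp: zero_less_mult_iff)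
    ultimately have pos: "0 < signed_count src tgt F (?c B0) * signed_count src tgt F (?c B0)" by blast
    show ?thesis
    proof (rule sum_pos2[of _ "?c B0"])
      show "finite (?c ` Pow F)" using fin by (rule finite_imageI)
      show "?c B0 \<in> ?c ` Pow F" using B0(1) by blast
    qed (use pos in simp_all)
  qed
  finally show ?thesis .
qed

lemma cnt_double:
  assumes "finite F" "X \<subseteq> F" "Y \<subseteq> F"
  shows "head_count (src \<circ> fst) (tgt \<circ> fst) (F \<times> {0, 1::nat}) (X \<times> {0} \<union> (F - Y) \<times> {1}) s
     = head_count src tgt F X s + head_count src tgt F (F - Y) s"
proof -
  have [simp]: "finite X" "finite Y" using assms finite_subset by auto
  have 1: "{g \<in> X \<times> {0} \<union> (F - Y) \<times> {1::nat}. (src \<circ> fst) g = s} = {f\<in>X. src f = s} \<times> {0} \<union> {f\<in>F-Y. src f = s} \<times> {1}"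
    by auto
  have 2: "{g \<in> F \<times> {0, 1::nat} - (X \<times> {0} \<union> (F - Y) \<times> {1}). (tgt \<circ> fst) g = s}
     = {f\<in>F-X. tgt f = s} \<times> {0} \<union> {f\<in>Y. tgt f = s} \<times> {1}"
    using assms by auto
  have 3: "F - (F - Y) = Y" using assms by auto
  have c: "card (P \<times> {0::nat} \<union> Q \<times> {1}) = card P + card Q" if "finite P" "finite Q" for P Q :: "'a set"
    using that by (subst card_Un_disjoint) (auto simp: card_cartesian_product)
  show ?thesis unfolding head_count_def 1 2 3 by (subst c, simp, simp add: assms, subst c, simp add: assms, simp, simp)
qed

text \<open>Every arc is doubled and the prescribed in-degree is the full degree in
  \<open>F\<close>. Reversing all choices on the second copy turns the condition into equality of
  the in-degree sequences of \<open>X\<close> and \<open>Y\<close>. The sign becomes the product of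
  the signs of \<open>X\<close> and \<open>Y\<close> times the constant
  \<open>(-1) ^ card F\<close>, so that \<open>signed_square_sum\<close> applies.\<close>

lemma signed_double:
  assumes "finite F" "finite S" "\<And>f. f \<in> F \<Longrightarrow> src f \<in> S \<and> tgt f \<in> S \<and> src f \<noteq> tgt f"
  shows "signed_count (src \<circ> fst) (tgt \<circ> fst) (F \<times> {0, 1::nat}) (\<lambda>s. card {f\<in>F. src f = s} + card {f\<in>F. tgt f = s}) \<noteq> 0"
proof -
  let ?c = "head_count src tgt F" and ?G = "F \<times> {0, 1::nat}"
  define d where "d s = card {f\<in>F. src f = s} + card {f\<in>F. tgt f = s}" for s
  define P where "P = {(X, Y). X \<subseteq> F \<and> Y \<subseteq> F \<and> ?c Y = ?c X}"
  define h where "h = (\<lambda>(X, Y). X \<times> {0} \<union> (F - Y) \<times> {1::nat})"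
  have d: "d s = ?c Y s + ?c (F - Y) s" if "Y \<subseteq> F" for Y s
  proof -
    have "card {f\<in>F. g f = s} = card {f\<in>Y. g f = s} + card {f\<in>F-Y. g f = s}" for g :: "'a \<Rightarrow> 'b"
    proof -
      have "{f\<in>F. g f = s} = {f\<in>Y. g f = s} \<union> {f\<in>F-Y. g f = s}" using that by blast
      then show ?thesis using that assms(1) finite_subset[OF that] by (simp only:) (subst card_Un_disjoint, auto)
    qed
    moreover have "F - (F - Y) = Y" using that by auto
    ultimately show ?thesis unfolding d_def head_count_def by simp
  qed
  have img: "{B. B \<subseteq> ?G \<and> head_count (src \<circ> fst) (tgt \<circ> fst) ?G B = d} = h ` P"
  proof (intro equalityI subsetI)
    fix B assume "B \<in> {B. B \<subseteq> ?G \<and> head_count (src \<circ> fst) (tgt \<circ> fst) ?G B = d}"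
    then have B: "B \<subseteq> ?G" and cB: "head_count (src \<circ> fst) (tgt \<circ> fst) ?G B = d" by blast+
    define X Y where "X = {f\<in>F. (f, 0) \<in> B}" and "Y = {f\<in>F. (f, 1) \<notin> B}"
    have XY: "X \<subseteq> F" "Y \<subseteq> F" by (auto simp: X_def Y_def)
    have Bh: "B = h (X, Y)" using B by (auto simp: h_def X_def Y_def)
    have "?c Y = ?c X"
    proof
      fix s
      have "head_count (src \<circ> fst) (tgt \<circ> fst) ?G (X \<times> {0} \<union> (F - Y) \<times> {1}) s = d s"
        using cB by (simp only: Bh h_def prod.case)
      then show "?c Y s = ?c X s" using cnt_double[OF assms(1) XY, of src tgt s] d[OF XY(2), of s] by linarith
    qed
    then show "B \<in> h ` P" using Bh XY by (intro image_eqI[of _ _ "(X, Y)"]) (simp_all add: P_def)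
  next
    fix B assume "B \<in> h ` P"
    then obtain X Y where XY: "X \<subseteq> F" "Y \<subseteq> F" "?c Y = ?c X" "B = h (X, Y)" unfolding P_def by blast
    have "head_count (src \<circ> fst) (tgt \<circ> fst) ?G B = d"
    proof
      fix s
      show "head_count (src \<circ> fst) (tgt \<circ> fst) ?G B s = d s"
        using cnt_double[OF assms(1) XY(1,2), of src tgt s] d[OF XY(2), of s] XY(3) by (simp only: XY(4) h_def prod.case)
    qed
    moreover have "B \<subseteq> ?G" using XY(1,2) unfolding XY(4) h_def by auto
    ultimately show "B \<in> {B. B \<subseteq> ?G \<and> head_count (src \<circ> fst) (tgt \<circ> fst) ?G B = d}" by blast
  qed
  have inj: "inj_on h P"
  proof (rule inj_onI)
    fix p q assume "p \<in> P" "q \<in> P" and eq: "h p = h q"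
    obtain X Y X' Y' where pq: "p = (X, Y)" "q = (X', Y')" by (metis surj_pair)
    have sub: "X \<subseteq> F" "Y \<subseteq> F" "X' \<subseteq> F" "Y' \<subseteq> F" using \<open>p \<in> P\<close> \<open>q \<in> P\<close> by (simp_all add: P_def pq)
    have "f \<in> X \<longleftrightarrow> f \<in> X'" for f
    proof -
      have "f \<in> X \<longleftrightarrow> (f, 0) \<in> h p" "f \<in> X' \<longleftrightarrow> (f, 0) \<in> h q" by (simp_all add: pq h_def)
      then show ?thesis using eq by simp
    qed
    moreover have "f \<in> F - Y \<longleftrightarrow> f \<in> F - Y'" for f
    proof -
      have "f \<in> F - Y \<longleftrightarrow> (f, 1) \<in> h p" "f \<in> F - Y' \<longleftrightarrow> (f, 1) \<in> h q" by (simp_all add: pq h_def)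
      then show ?thesis using eq by simp
    qed
    ultimately have "X = X'" "Y = Y'" using sub by blast+
    then show "p = q" by (simp add: pq)
  qed
  have cardh: "card (?G - h (X, Y)) = card (F - X) + card Y" if "X \<subseteq> F" "Y \<subseteq> F" for X Y
  proof -
    have "?G - h (X, Y) = (F - X) \<times> {0} \<union> Y \<times> {1}" using that by (auto simp: h_def)
    then show ?thesis using that assms(1) finite_subset[OF that(2) assms(1)]
      by (simp only:) (subst card_Un_disjoint, auto simp: card_cartesian_product)
  qed
  have sgn: "(-1) ^ card Y = (-1) ^ card F * (-1 :: int) ^ card (F - Y)" if "Y \<subseteq> F" for Y
  proof -
    have "card F = card Y + card (F - Y)"
      using that assms(1) by (metis card_Un_disjoint Diff_disjoint Diff_partition finite_Diff finite_subset)
    then show ?thesis by (simp add: power_add mult.assoc flip: power_mult_distrib)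
  qed
  define T where "T = (\<Sum>X\<in>Pow F. (-1) ^ card (F - X) * signed_count src tgt F (?c X))"
  have T: "T > 0" unfolding T_def using assms(3) by (rule signed_square_sum[OF assms(1,2)])
  have "signed_count (src \<circ> fst) (tgt \<circ> fst) ?G d = (\<Sum>p\<in>P. (-1) ^ card (?G - h p))"
    unfolding signed_count_def img using inj by (simp add: sum.reindex)
  also have "\<dots> = (\<Sum>(X, Y)\<in>P. (-1) ^ card F * ((-1) ^ card (F - X) * (-1) ^ card (F - Y)))"
  proof (rule sum.cong[OF refl])
    fix p assume "p \<in> P"
    obtain X Y where p: "p = (X, Y)" by (metis surj_pair)
    then have XY: "X \<subseteq> F" "Y \<subseteq> F" using \<open>p \<in> P\<close> by (simp_all add: P_def)
    then show "(-1) ^ card (?G - h p) = (case p of (X, Y) \<Rightarrow> (-1) ^ card F * ((-1) ^ card (F - X) * (-1 :: int) ^ card (F - Y)))"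
      by (simp only: p prod.case cardh[OF XY] power_add sgn[OF XY(2)] ac_simps)
  qed
  also have "P = Sigma (Pow F) (\<lambda>X. {Y. Y \<subseteq> F \<and> ?c Y = ?c X})" by (auto simp: P_def)
  also have "(\<Sum>(X, Y)\<in>\<dots>. (-1) ^ card F * ((-1) ^ card (F - X) * (-1) ^ card (F - Y)))
     = (\<Sum>X\<in>Pow F. \<Sum>Y | Y \<subseteq> F \<and> ?c Y = ?c X. (-1) ^ card F * ((-1) ^ card (F - X) * (-1 :: int) ^ card (F - Y)))"
    using assms(1) by (intro sum.Sigma[symmetric]) (auto intro: finite_subset[of _ "Pow F"])
  also have "\<dots> = (-1) ^ card F * T"
    unfolding T_def signed_count_def sum_distrib_left ..
  also have "\<dots> \<noteq> 0" using T by simp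
  finally show ?thesis unfolding d_def .
qed

text \<open>With two variables per arc the coefficient counts pairs of orientations with equal in-degrees, with signs that make it a sum of squares.\<close>
lemma double_form_prod:
  fixes src tgt :: "'f \<Rightarrow> 's"
  defines "\<eta> \<equiv> \<lambda>f. eps (f, 0::nat) + eps (f, 1)"
  assumes "finite F" "finite S" "\<And>f. f \<in> F \<Longrightarrow> src f \<in> S \<and> tgt f \<in> S \<and> src f \<noteq> tgt f"
  obtains c where "c \<noteq> 0"
    "(\<Prod>s\<in>S. ((\<Sum>f | f \<in> F \<and> src f = s. \<eta> f) - (\<Sum>f | f \<in> F \<and> tgt f = s. \<eta> f))
       ^ (card {f\<in>F. src f = s} + card {f\<in>F. tgt f = s})) = of_int c * mon (F \<times> {0, 1})"
proof -
  let ?G = "F \<times> {0, 1::nat}"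
  define d where "d = (\<lambda>s. card {f\<in>F. src f = s} + card {f\<in>F. tgt f = s})"
  have half: "(\<Sum>g | g \<in> ?G \<and> (k \<circ> fst) g = s. eps g) = (\<Sum>f | f \<in> F \<and> k f = s. \<eta> f)" for k :: "'f \<Rightarrow> 's" and s
  proof -
    have "{g. g \<in> ?G \<and> (k \<circ> fst) g = s} = {f\<in>F. k f = s} \<times> {0, 1}" by auto
    then have "(\<Sum>g | g \<in> ?G \<and> (k \<circ> fst) g = s. eps g) = (\<Sum>f | f \<in> F \<and> k f = s. \<Sum>i\<in>{0, 1}. eps (f, i))"
      by (simp only: sum.cartesian_product) (simp add: case_prod_unfold)
    then show ?thesis by (simp add: \<eta>_def)
  qed
  have L: "lform (src \<circ> fst) (tgt \<circ> fst) ?G s = (\<Sum>f | f \<in> F \<and> src f = s. \<eta> f) - (\<Sum>f | f \<in> F \<and> tgt f = s. \<eta> f)" for s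
    unfolding lform_def half ..
  have "sum d S = card F + card F"
  proof -
    have "(\<Sum>s\<in>S. card {f\<in>F. k f = s}) = card F" if "\<And>f. f \<in> F \<Longrightarrow> k f \<in> S" for k :: "'f \<Rightarrow> 's"
    proof -
      have "k ` F \<subseteq> S" using that by blast
      from sum.group[OF assms(2,3) this, of "\<lambda>_. 1::nat"] show ?thesis by (simp only: card_eq_sum)
    qed
    then show ?thesis unfolding d_def using assms(4) by (simp add: sum.distrib)
  qed
  then have sd: "sum d S = card ?G" by (simp add: card_cartesian_product)
  have "(\<Prod>s\<in>S. lform (src \<circ> fst) (tgt \<circ> fst) ?G s ^ d s)
    = (if sum d S = card ?G then of_int (int (\<Prod>s\<in>S. fact (d s)) * signed_count (src \<circ> fst) (tgt \<circ> fst) ?G d) * mon ?G else 0)"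
  proof (rule lform_prod)
    show "finite ?G" using assms(2) by simp
    show "(src \<circ> fst) f \<in> S \<and> (tgt \<circ> fst) f \<in> S \<and> (src \<circ> fst) f \<noteq> (tgt \<circ> fst) f" if "f \<in> ?G" for f
      using assms(4)[of "fst f"] that by (simp add: mem_Times_iff)
    show "d s = 0" if "s \<notin> S" for s
    proof -
      have "{f\<in>F. src f = s} = {}" "{f\<in>F. tgt f = s} = {}" using assms(4) that by blast+
      then show ?thesis unfolding d_def by (simp only:) simp
    qed
    show "card ?G \<le> sum d S" by (simp only: sd order_refl)
  qed (rule assms(3))
  then have eq: "(\<Prod>s\<in>S. lform (src \<circ> fst) (tgt \<circ> fst) ?G s ^ d s)
    = of_int (int (\<Prod>s\<in>S. fact (d s)) * signed_count (src \<circ> fst) (tgt \<circ> fst) ?G d) * mon ?G"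
    by (simp only: sd if_True simp_thms)
  have ne: "int (\<Prod>s\<in>S. fact (d s)) * signed_count (src \<circ> fst) (tgt \<circ> fst) ?G d \<noteq> 0"
  proof -
    have "signed_count (src \<circ> fst) (tgt \<circ> fst) ?G d \<noteq> 0"
      unfolding d_def using assms(4) by (rule signed_double[OF assms(2,3)])
    moreover have "(\<Prod>s\<in>S. fact (d s)) \<noteq> (0::nat)" using assms(3) by simp
    ultimately show ?thesis by (simp only: mult_eq_0_iff of_nat_eq_0_iff simp_thms)
  qed
  show ?thesis
    by (rule that[OF ne]) (use eq in \<open>simp only: L d_def\<close>)
qed

section \<open>Extending a good edge set by a cell\<close>

text \<open>Since the orientation of an edge is an arbitrary choice, its factor is identified only
  up to sign, which is enough for nonvanishing.\<close>

definition upto_sign :: "'r::comm_ring_1 \<Rightarrow> 'r \<Rightarrow> bool" (infix "\<simeq>" 50) where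
  "x \<simeq> y \<longleftrightarrow> x = y \<or> x = - y"

lemma upto_sign_refl [simp]: "x \<simeq> x" and upto_sign_minus: "- x \<simeq> x"
  by (simp_all add: upto_sign_def)

lemma upto_sign_mult: "a \<simeq> b \<Longrightarrow> c \<simeq> d \<Longrightarrow> a * c \<simeq> b * d"
  unfolding upto_sign_def by (elim disjE) simp_all

lemma upto_sign_prod: "(\<And>i. i \<in> A \<Longrightarrow> f i \<simeq> g i) \<Longrightarrow> prod f A \<simeq> prod g A"
  by (induction A rule: infinite_finite_induct) (simp_all add: upto_sign_mult)

lemma upto_sign_mon:
  assumes "x \<simeq> of_int c * mon U" "c \<noteq> 0"
  obtains n where "n \<noteq> 0" "x = of_int n * mon U"
proof -
  have "x = of_int c * mon U \<or> x = of_int (- c) * mon U" using assms(1) unfolding upto_sign_def by simp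
  then show ?thesis
  proof
    assume "x = of_int c * mon U" then show ?thesis by (rule that[OF assms(2)])
  next
    assume x: "x = of_int (- c) * mon U" show ?thesis by (rule that[OF _ x]) (use assms(2) in simp)
  qed
qed

text \<open>Congruence modulo the annihilator of \<open>M\<close> is compatible with products
  because the annihilator is an ideal.\<close>

lemma mult_prod_cong:
  fixes M :: "'r::comm_ring_1"
  assumes "\<And>i. i \<in> A \<Longrightarrow> M * f i = M * g i"
  shows "M * prod f A = M * prod g A"
  using assms
proof (induction A rule: infinite_finite_induct)
  case (insert i A)
  have "M * prod f (insert i A) = (M * f i) * prod f A" using insert.hyps by (simp add: mult.assoc)
  also have "\<dots> = (M * prod f A) * g i" using insert.prems[of i] by (simp add: ac_simps)
  also have "\<dots> = (M * prod g A) * g i" using insert.IH insert.prems by (simp only: insertI2)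
  also have "\<dots> = M * prod g (insert i A)" using insert.hyps by (simp add: ac_simps)
  finally show ?case .
qed simp_all

lemma vertex_sum_if: "finite E \<Longrightarrow> vertex_sum E z v = (\<Sum>e\<in>E. if v \<in> e then z e else 0)"
  unfolding vertex_sum_def by (rule sum.inter_filter)

text \<open>The factors of \<open>Q\<close> kill the token values, and the value of the edge product of \<open>EG\<close> kills \<open>z\<close> on \<open>EG\<close>; so the remaining factors only see the part \<open>h\<close> of the vertex sums. The edges in \<open>X\<close> get the value 0.\<close>
lemma good_frame:
  fixes z :: "'a set \<Rightarrow> ('a set \<times> nat) sq"
  assumes fin: "finite EG" "finite X" "finite EC"
    and disj: "EG \<inter> X = {}" "EG \<inter> EC = {}" "X \<inter> EC = {}"
    and two: "\<And>e. e \<in> EG \<union> X \<union> EC \<Longrightarrow> card e = 2"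
    and good: "good EG"
    and D: "D \<subseteq> EC"
    and sep: "\<And>x g. x \<in> X \<union> D \<Longrightarrow> g \<in> EG \<Longrightarrow> x \<inter> g = {}"
    and z5: "\<And>e. e \<in> EC \<Longrightarrow> z e ^ 5 = 0"
    and Q: "Q = (\<Prod>e\<in>X \<union> D. vertex_sum EC z (end1 e) - vertex_sum EC z (end2 e))"
    and h: "\<And>u. Q * vertex_sum EC z u = Q * h u" and h0: "\<And>g u. g \<in> EG \<Longrightarrow> u \<in> g \<Longrightarrow> h u = 0"
    and final: "Q * (\<Prod>e\<in>EC - D. h (end1 e) - h (end2 e)) * R = of_int n * mon U"
    and n: "n \<noteq> 0" "finite U" "U \<subseteq> EC \<times> UNIV"
  shows "good (EG \<union> X \<union> EC)"
proof -
  let ?E = "EG \<union> X \<union> EC"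
  obtain zG :: "'a set \<Rightarrow> ('a set \<times> nat) sq" and c W where
    zG: "edge_product EG zG = of_int c * mon W" "c \<noteq> 0" "finite W" "W \<subseteq> EG \<times> UNIV"
    "\<And>e. e \<in> EG \<Longrightarrow> zG e ^ 5 = 0" "\<And>e. e \<in> EG \<Longrightarrow> edge_product EG zG * zG e = 0"
    using good_monomial[OF fin(1) good] by metis
  define w where "w e = (if e \<in> EG then zG e else if e \<in> EC then z e else 0)" for e
  let ?G = "vertex_sum EG zG" and ?C = "vertex_sum EC z"
  have fE: "finite ?E" using fin by simp
  have w: "vertex_sum ?E w u = ?G u + ?C u" for u
  proof -
    let ?f = "\<lambda>w e. if u \<in> e then w e else 0"
    have "(\<Sum>e\<in>?E. ?f w e) = (\<Sum>e\<in>EG \<union> X. ?f w e) + (\<Sum>e\<in>EC. ?f w e)"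
      by (rule sum.union_disjoint) (use fin disj in blast)+
    also have "(\<Sum>e\<in>EG \<union> X. ?f w e) = (\<Sum>e\<in>EG. ?f w e) + (\<Sum>e\<in>X. ?f w e)"
      by (rule sum.union_disjoint) (use fin disj in blast)+
    also have "(\<Sum>e\<in>EG. ?f w e) = (\<Sum>e\<in>EG. ?f zG e)" by (rule sum.cong) (simp_all add: w_def)
    also have "(\<Sum>e\<in>X. ?f w e) = 0"
    proof (rule sum.neutral, rule ballI)
      fix e assume "e \<in> X"
      then have "e \<notin> EG" "e \<notin> EC" using disj by blast+
      then show "?f w e = 0" by (simp add: w_def)
    qed
    also have "(\<Sum>e\<in>EC. ?f w e) = (\<Sum>e\<in>EC. ?f z e)"
    proof (rule sum.cong[OF refl])
      fix e assume "e \<in> EC"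
      then have "e \<notin> EG" using disj by blast
      then show "?f w e = ?f z e" using \<open>e \<in> EC\<close> by (simp add: w_def)
    qed
    finally show ?thesis by (simp add: vertex_sum_if[OF fE] vertex_sum_if[OF fin(1)] vertex_sum_if[OF fin(3)])
  qed
  have ends: "end1 e \<in> e" "end2 e \<in> e" if "e \<in> ?E" for e using end1_end2_mem(1,2)[OF two[OF that]] .
  have G0: "?G u = 0" if "x \<in> X \<union> D" "u \<in> x" for x u
  proof -
    have "{e. e \<in> EG \<and> u \<in> e} = {}" using sep[OF that(1)] that(2) by blast
    then show ?thesis unfolding vertex_sum_def by (simp only: sum.empty)
  qed
  have PG: "edge_product EG zG * ?G u = 0" for u
    unfolding vertex_sum_def sum_distrib_left by (rule sum.neutral) (simp add: zG(6))
  let ?d = "\<lambda>e. vertex_sum ?E w (end1 e) - vertex_sum ?E w (end2 e)"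
  have "edge_product ?E w = prod ?d (EG \<union> X) * prod ?d EC"
    unfolding edge_product_def by (rule prod.union_disjoint) (use fin disj in blast)+
  also have "prod ?d (EG \<union> X) = prod ?d EG * prod ?d X"
    by (rule prod.union_disjoint) (use fin disj in blast)+
  also have "prod ?d EC = prod ?d (EC - D) * prod ?d D"
    using D fin(3) by (rule prod.subset_diff)
  finally have "edge_product ?E w = prod ?d EG * (prod ?d X * prod ?d D) * prod ?d (EC - D)" by (simp only: ac_simps)
  also have "prod ?d X * prod ?d D = prod ?d (X \<union> D)"
    by (rule prod.union_disjoint[symmetric]) (use fin disj D finite_subset[OF D] in blast)+
  also have "prod ?d (X \<union> D) = Q" unfolding Q
  proof (rule prod.cong[OF refl])
    fix e assume e: "e \<in> X \<union> D"
    then have "e \<in> ?E" using D by blast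
    then show "?d e = ?C (end1 e) - ?C (end2 e)" using ends[of e] G0[OF e] by (simp add: w)
  qed
  also have "prod ?d EG * Q = Q * edge_product EG zG"
  proof -
    have "Q * prod ?d EG = Q * edge_product EG zG" unfolding edge_product_def
    proof (rule mult_prod_cong)
      fix e assume e: "e \<in> EG"
      then have "Q * ?C (end1 e) = 0" "Q * ?C (end2 e) = 0" using ends[of e] h0[OF e] by (simp_all add: h)
      then show "Q * ?d e = Q * (?G (end1 e) - ?G (end2 e))" by (simp add: w algebra_simps)
    qed
    then show ?thesis by (simp add: mult.commute)
  qed
  also have "Q * edge_product EG zG * prod ?d (EC - D) = Q * edge_product EG zG * (\<Prod>e\<in>EC - D. h (end1 e) - h (end2 e))"
  proof (rule mult_prod_cong)
    fix e
    have "Q * edge_product EG zG * vertex_sum ?E w u = Q * edge_product EG zG * h u" for u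
    proof -
      have "Q * edge_product EG zG * vertex_sum ?E w u = Q * (edge_product EG zG * ?G u) + edge_product EG zG * (Q * ?C u)"
        by (simp add: w algebra_simps)
      then show ?thesis by (simp add: PG h ac_simps)
    qed
    then show "Q * edge_product EG zG * ?d e = Q * edge_product EG zG * (h (end1 e) - h (end2 e))" by (simp only: right_diff_distrib)
  qed
  finally have edge_product: "edge_product ?E w = Q * edge_product EG zG * (\<Prod>e\<in>EC - D. h (end1 e) - h (end2 e))" .
  \<comment> \<open>\<open>R\<close> only serves this test: it completes the cell part to a single
    monomial, whose variables belong to other edges than those of \<open>W\<close>.\<close>
  have "edge_product ?E w * R = edge_product EG zG * (Q * (\<Prod>e\<in>EC - D. h (end1 e) - h (end2 e)) * R)"
    unfolding edge_product by (simp only: ac_simps)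
  also have "\<dots> = of_int (c * n) * (mon W * mon U)" unfolding final zG(1) by (simp only: of_int_mult ac_simps)
  also have "mon W * mon U = mon (W \<union> U)"
  proof -
    have "W \<inter> U = {}" using zG(4) n(3) disj(2) by blast
    then show ?thesis using zG(3) n(2) by (simp add: mon_mult)
  qed
  finally have "edge_product ?E w * R \<noteq> 0" using of_int_mon_neq_0[of "c * n" "W \<union> U"] zG(2,3) n(1,2) by simp
  then have "edge_product ?E w \<noteq> 0" by auto
  then show ?thesis
  proof (rule good_if_edge_product[OF fE])
    fix e
    show "w e ^ 5 = 0" using zG(5)[of e] z5[of e] by (simp add: w_def)
  qed
qed

section \<open>Edge sets split by a cell, and tokens for the isolated edges\<close>

text \<open>Niceness read off the edges alone, so that the induction can run over edge sets.\<close>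

definition nice_edges :: "'a set set \<Rightarrow> bool" where
  "nice_edges E \<longleftrightarrow> (\<forall>e\<in>E. \<exists>e'\<in>E. e' \<noteq> e \<and> e \<inter> e' \<noteq> {})"

definition isol :: "'a set set \<Rightarrow> 'a set set" where
  "isol E = {e\<in>E. \<forall>e'\<in>E. e' \<noteq> e \<longrightarrow> e \<inter> e' = {}}"

definition off :: "'a set set \<Rightarrow> 'a set \<Rightarrow> 'a set set" where
  "off E C = {e\<in>E. e \<inter> C = {}}"

lemma nice_edges_minus_iso: "nice_edges (E - isol E)"
  unfolding nice_edges_def isol_def by blast

lemma end1_end2_iff: "card e = 2 \<Longrightarrow> x \<in> e \<longleftrightarrow> x = end1 e \<or> x = end2 e"
  using arg_cong[OF end1_end2[of e], of "\<lambda>A. x \<in> A"] by (simp only: insert_iff empty_iff simp_thms)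

text \<open>\<open>good_frame\<close> for the partition of \<open>E\<close> induced by
  \<open>C\<close>. The edges in \<open>D\<close> lie inside \<open>C\<close>, hence meet no edge of
  the good remainder; their factors join those of the isolated edges in \<open>Q\<close>.\<close>

lemma frame_cell:
  fixes E :: "'a set set" and C :: "'a set" and z :: "'a set \<Rightarrow> ('a set \<times> nat) sq"
  defines "X \<equiv> isol (off E C)" and "EC \<equiv> E - off E C"
  assumes finE: "finite E" and two: "\<And>e. e \<in> E \<Longrightarrow> card e = 2"
    and good: "good (off E C - X)"
    and D: "D \<subseteq> E" "\<And>e. e \<in> D \<Longrightarrow> e \<subseteq> C"
    and z5: "\<And>e. e \<in> EC \<Longrightarrow> z e ^ 5 = 0"
    and Q: "Q = (\<Prod>e\<in>X \<union> D. vertex_sum EC z (end1 e) - vertex_sum EC z (end2 e))"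
    and h: "\<And>u. Q * vertex_sum EC z u = Q * h u" and h0: "\<And>u. u \<notin> C \<Longrightarrow> h u = 0"
    and final: "Q * (\<Prod>e\<in>EC - D. h (end1 e) - h (end2 e)) * R \<simeq> of_int n * mon U"
    and n: "n \<noteq> 0" "finite U" "U \<subseteq> EC \<times> UNIV"
  shows "good E"
proof -
  have X_off: "X \<subseteq> off E C" by (auto simp: X_def isol_def)
  obtain m where m: "m \<noteq> 0" "Q * (\<Prod>e\<in>EC - D. h (end1 e) - h (end2 e)) * R = of_int m * mon U"
    using final n(1) by (rule upto_sign_mon)
  have E: "E = (off E C - X) \<union> X \<union> EC" using X_off by (auto simp: off_def EC_def)
  have D_off: "d \<inter> g = {}" if "d \<in> D" "g \<in> off E C" for d g
    using D(2)[OF that(1)] that(2) unfolding off_def by blast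
  have D_ne: "d \<noteq> {}" if "d \<in> D" for d using two[of d] D(1) that by auto
  have "good ((off E C - X) \<union> X \<union> EC)"
  proof (rule good_frame[of _ _ _ D z Q h R m U])
    show "finite (off E C - X)" "finite X" "finite EC" using finE finite_subset[OF X_off] by (simp_all add: off_def EC_def)
    show "card e = 2" if "e \<in> (off E C - X) \<union> X \<union> EC" for e using that E two by metis
    show "x \<inter> g = {}" if "x \<in> X \<union> D" "g \<in> off E C - X" for x g
      using that(1)
    proof
      assume "x \<in> X" then show ?thesis using that(2) unfolding X_def isol_def by blast
    next
      assume "x \<in> D" then show ?thesis using D_off that(2) by blast
    qed
    show "X \<inter> EC = {}" "(off E C - X) \<inter> EC = {}" using X_off unfolding EC_def by blast+
    show "D \<subseteq> EC"
    proof
      fix d assume d: "d \<in> D"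
      have "d \<notin> off E C" using D_off[OF d] D_ne[OF d] by blast
      then show "d \<in> EC" using d D(1) unfolding EC_def by blast
    qed
    show "h u = 0" if "g \<in> off E C - X" "u \<in> g" for g u
      using that by (intro h0) (auto simp: off_def)
  qed (use m n good Q z5 h in \<open>blast+\<close>)
  then show ?thesis using E by (simp only:)
qed

text \<open>A token touches the union of \<open>X\<close> in exactly one vertex. The members of
  \<open>X\<close> being disjoint, a vertex of \<open>x\<close> can meet no token but that of
  \<open>x\<close>.\<close>

lemma token_unique:
  assumes "\<forall>x\<in>X. \<forall>y\<in>X. x \<inter> y \<noteq> {} \<longrightarrow> x = y"
    and "\<forall>x\<in>X. \<exists>u\<in>x. \<exists>c. c \<notin> \<Union>X \<and> tk x = {u, c}"
  shows "x \<in> X \<Longrightarrow> u \<in> x \<Longrightarrow> e \<in> tk ` X \<Longrightarrow> u \<in> e \<Longrightarrow> e = tk x"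
    and "inj_on tk X"
proof -
  have tkE: "\<exists>u c. u \<in> x \<and> c \<notin> \<Union>X \<and> (\<forall>v. v \<in> tk x \<longleftrightarrow> v = u \<or> v = c)" if x: "x \<in> X" for x
  proof -
    obtain u c where "u \<in> x" "c \<notin> \<Union>X" "tk x = {u, c}" using assms(2) x by blast
    then show ?thesis by (intro exI[of _ u] exI[of _ c]) simp
  qed
  have tk_mem: "u \<in> x" if "x \<in> X" "u \<in> tk x" "u \<in> \<Union>X" for u x using tkE[OF that(1)] that(2,3) by metis
  show uniq: "e = tk x" if x: "x \<in> X" "u \<in> x" "e \<in> tk ` X" "u \<in> e" for x u e
  proof -
    obtain y where y: "y \<in> X" "e = tk y" using x(3) by blast
    have "u \<in> y" by (rule tk_mem[OF y(1)]) (use x y(2) in \<open>simp, blast\<close>)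
    then have "y = x" using assms(1) y(1) x(1,2) by blast
    then show ?thesis by (simp only: y(2))
  qed
  show "inj_on tk X"
  proof (rule inj_onI)
    fix x y assume xy: "x \<in> X" "y \<in> X" "tk x = tk y"
    obtain u where u: "u \<in> x" "u \<in> tk x" using tkE[OF xy(1)] by metis
    have "u \<in> y" by (rule tk_mem[OF xy(2)]) (use u xy in \<open>simp, blast\<close>)
    then show "x = y" using assms(1) xy(1,2) u(1) by blast
  qed
qed

text \<open>Exactly one end of \<open>x\<close> lies on the token of \<open>x\<close>, so the factor
  of \<open>x\<close> is the token value up to sign.\<close>

lemma token_product:
  fixes y :: "'a \<Rightarrow> 'r::comm_ring_1"
  assumes disj: "\<forall>x\<in>X. \<forall>y\<in>X. x \<inter> y \<noteq> {} \<longrightarrow> x = y"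
    and tk: "\<forall>x\<in>X. \<exists>u\<in>x. \<exists>c. c \<notin> \<Union>X \<and> tk x = {u, c}"
    and two: "\<And>x. x \<in> X \<Longrightarrow> card x = 2"
    and y: "\<And>x u. x \<in> X \<Longrightarrow> u \<in> x \<Longrightarrow> y u = (if u \<in> tk x then t (tk x) else 0)"
  shows "(\<Prod>x\<in>X. y (end1 x) - y (end2 x)) \<simeq> (\<Prod>e\<in>tk ` X. t e)"
proof -
  have "(\<Prod>x\<in>X. y (end1 x) - y (end2 x)) \<simeq> (\<Prod>x\<in>X. t (tk x))"
  proof (rule upto_sign_prod)
    fix x assume x: "x \<in> X"
    note e = end1_end2_iff[OF two[OF x]] end1_end2_mem[OF two[OF x]]
    obtain u c where uc: "u \<in> x" "c \<notin> \<Union>X" "tk x = {u, c}" using tk x by blast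
    have u: "u = end1 x \<or> u = end2 x" using uc(1) by (simp only: e(1))
    have v: "v \<in> tk x \<longleftrightarrow> v = u" if "v \<in> x" for v
    proof -
      have "v \<noteq> c" using that uc(2) x by blast
      then show ?thesis by (simp add: uc(3))
    qed
    show "y (end1 x) - y (end2 x) \<simeq> t (tk x)"
      unfolding y[OF x e(2)] y[OF x e(3)] v[OF e(2)] v[OF e(3)] using u e(4) by (auto simp: upto_sign_minus)
  qed
  also have "(\<Prod>x\<in>X. t (tk x)) = (\<Prod>e\<in>tk ` X. t e)"
    using token_unique(2)[OF disj tk] by (simp add: prod.reindex)
  finally show ?thesis .
qed

lemma iso_disjoint: "\<forall>x\<in>isol E. \<forall>y\<in>isol E. x \<inter> y \<noteq> {} \<longrightarrow> x = y"
  unfolding isol_def by blast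

lemma iso_off_C: "x \<in> isol (off E C) \<Longrightarrow> u \<in> x \<Longrightarrow> u \<notin> C"
  unfolding isol_def off_def by blast

text \<open>In each term of degree 5 one of the two exponents is at least 3.\<close>

lemma cube_sum_power5:
  fixes a b :: "'r::comm_ring_1"
  assumes "a ^ 3 = 0" "b ^ 3 = 0"
  shows "(a + b) ^ 5 = 0"
proof -
  have z: "x ^ k = 0" if "x ^ 3 = 0" "k \<ge> 3" for x :: 'r and k
  proof -
    have "x ^ k = x ^ 3 * x ^ (k - 3)" using that(2) by (simp flip: power_add)
    then show ?thesis using that(1) by simp
  qed
  have "of_nat (5 choose k) * a ^ k * b ^ (5 - k) = 0" if "k \<le> 5" for k
    using z[OF assms(1), of k] z[OF assms(2), of "5 - k"] by (cases "k \<ge> 3") auto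
  then show ?thesis unfolding binomial_ring by (intro sum.neutral) auto
qed

lemma eta_cube: "(eps (e, 0::nat) + eps (e, 1)) ^ 3 = 0"
proof -
  have "(\<Sum>i\<in>{(e, 0::nat), (e, 1)}. eps i) ^ 3 = 0"
    by (rule sum_eps_power(2)) simp_all
  then show ?thesis by simp
qed

lemma pair_split:
  assumes "e = {p, q}" "\<not> e \<subseteq> C" "e \<inter> C \<noteq> {}"
  shows "e = {if p \<in> C then p else q, if p \<in> C then q else p}"
    "(if p \<in> C then p else q) \<in> C" "(if p \<in> C then q else p) \<notin> C"
  using assms by auto

text \<open>The edges in \<open>F\<close> are the arcs of a digraph on \<open>C\<close>: the value \<open>\<eta> f\<close> is added on \<open>f\<close> and subtracted on \<open>\<rho> f\<close>, so it cancels at their common endpoint outside \<open>C\<close>.\<close>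
lemma indep_cell:
  fixes E :: "'a set set" and C :: "'a set"
  defines "X \<equiv> isol (off E C)"
  assumes finE: "finite E" and two: "\<And>e. e \<in> E \<Longrightarrow> card e = 2"
    and independent: "\<And>e. e \<in> E \<Longrightarrow> \<not> e \<subseteq> C"
    and good: "good (off E C - X)"
    and tk: "\<And>x. x \<in> X \<Longrightarrow> tk x \<in> E \<and> (\<exists>u\<in>x. \<exists>c\<in>C. tk x = {u, c})"
    and F: "F \<subseteq> E - off E C" "F \<inter> tk ` X = {}"
    and \<rho>: "inj_on \<rho> F" "\<And>f. f \<in> F \<Longrightarrow> \<rho> f \<in> E - off E C \<and> \<rho> f \<noteq> f \<and> \<rho> f - C = f - C"
    and deg: "\<And>s. s \<in> C \<Longrightarrow> card {e\<in>E. s \<in> e} \<le> card {f\<in>F. s \<in> f} + card {f\<in>F. s \<in> \<rho> f}"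
  shows "good E"
proof -
  let ?EC = "E - off E C"
  define \<eta> where "\<eta> f = eps (f, 0::nat) + eps (f, 1)" for f :: "'a set"
  \<comment> \<open>The index 2 keeps the token variables apart from the arc variables.\<close>
  define \<tau> where "\<tau> f = eps (f, 2::nat)" for f :: "'a set"
  \<comment> \<open>Arcs and tokens are disjoint and \<open>\<rho>\<close> is injective, so an edge
    value has at most two nonzero summands, each with vanishing cube.\<close>
  define z where "z e = ((if e \<in> F then \<eta> e else 0) + (if e \<in> tk ` X then \<tau> e else 0)) + - (\<Sum>f | f \<in> F \<and> \<rho> f = e. \<eta> f)" for e
  define src where "src e = (if end1 e \<in> C then end1 e else end2 e)" for e
  define ctr where "ctr e = (if end1 e \<in> C then end2 e else end1 e)" for e
  have ec: "e = {src e, ctr e}" "src e \<in> C" "ctr e \<notin> C" if "e \<in> ?EC" for e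
  proof -
    have e: "\<not> e \<subseteq> C" "e \<inter> C \<noteq> {}" "card e = 2" using that independent[of e] two[of e] unfolding off_def by blast+
    show "e = {src e, ctr e}" "src e \<in> C" "ctr e \<notin> C"
      using pair_split[OF end1_end2[OF e(3)] e(1,2)] unfolding src_def ctr_def .
  qed
  have ecm: "x \<in> e \<longleftrightarrow> x = src e \<or> x = ctr e" if "e \<in> ?EC" for e x
    using arg_cong[OF ec(1)[OF that], of "\<lambda>A. x \<in> A"] by (simp only: insert_iff empty_iff simp_thms)
  have mem_C: "s \<in> e \<longleftrightarrow> src e = s" if "e \<in> ?EC" "s \<in> C" for e s using ecm[OF that(1)] ec(2,3)[OF that(1)] that(2) by metis
  have finF: "finite F" by (rule finite_subset[OF F(1)]) (simp add: finE)
  have X_off: "X \<subseteq> off E C" by (auto simp: X_def isol_def)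
  have X_disj: "\<forall>x\<in>X. \<forall>y\<in>X. x \<inter> y \<noteq> {} \<longrightarrow> x = y" unfolding X_def by (rule iso_disjoint)
  have X_C: "u \<notin> C" if "x \<in> X" "u \<in> x" for x u using X_off that by (auto simp: off_def)
  have finX: "finite X" by (rule finite_subset[OF X_off]) (simp add: finE off_def)
  have tk_EC: "tk x \<in> ?EC" if x: "x \<in> X" for x
  proof -
    obtain u c where uc: "u \<in> x" "c \<in> C" "tk x = {u, c}" using tk[OF x] by blast
    then have "c \<in> tk x \<inter> C" by simp
    then show ?thesis using tk[OF x] unfolding off_def by blast
  qed
  have tk': "\<forall>x\<in>X. \<exists>u\<in>x. \<exists>c. c \<notin> \<Union>X \<and> tk x = {u, c}"
  proof
    fix x assume x: "x \<in> X"
    obtain u c where uc: "u \<in> x" "c \<in> C" "tk x = {u, c}" using tk[OF x] by blast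
    have "c \<notin> \<Union>X" using X_C uc(2) by blast
    then show "\<exists>u\<in>x. \<exists>c. c \<notin> \<Union>X \<and> tk x = {u, c}" using uc(1,3) by blast
  qed
  note uniq = token_unique[OF X_disj tk']
  define h where "h u = (\<Sum>f | f \<in> F \<and> u \<in> f. \<eta> f) - (\<Sum>f | f \<in> F \<and> u \<in> \<rho> f. \<eta> f)" for u
  define T where "T u = (\<Sum>e | e \<in> tk ` X \<and> u \<in> e. \<tau> e)" for u
  have csz: "vertex_sum ?EC z u = h u + T u" for u
  proof -
    let ?D = "{e. e \<in> ?EC \<and> u \<in> e}"
    have fD: "finite ?D" using finE by simp
    have "vertex_sum ?EC z u = (\<Sum>e\<in>?D. if e \<in> F then \<eta> e else 0) + (\<Sum>e\<in>?D. if e \<in> tk ` X then \<tau> e else 0)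
       - (\<Sum>e\<in>?D. \<Sum>f | f \<in> F \<and> \<rho> f = e. \<eta> f)"
      unfolding vertex_sum_def z_def by (simp only: sum.distrib sum_subtractf add_uminus_conv_diff)
    also have "(\<Sum>e\<in>?D. if e \<in> F then \<eta> e else 0) = (\<Sum>f | f \<in> F \<and> u \<in> f. \<eta> f)"
    proof -
      have "{e \<in> ?D. e \<in> F} = {f. f \<in> F \<and> u \<in> f}" using F(1) by blast
      then show ?thesis using sum.inter_filter[OF fD, of \<eta> "\<lambda>e. e \<in> F"] by (simp only:)
    qed
    also have "(\<Sum>e\<in>?D. if e \<in> tk ` X then \<tau> e else 0) = T u"
    proof -
      have "{e \<in> ?D. e \<in> tk ` X} = {e. e \<in> tk ` X \<and> u \<in> e}" using tk_EC by blast
      then show ?thesis unfolding T_def using sum.inter_filter[OF fD, of \<tau> "\<lambda>e. e \<in> tk ` X"] by (simp only:)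
    qed
    also have "(\<Sum>e\<in>?D. \<Sum>f | f \<in> F \<and> \<rho> f = e. \<eta> f) = (\<Sum>f | f \<in> F \<and> u \<in> \<rho> f. \<eta> f)"
    proof -
      have "(\<Sum>e\<in>?D. \<Sum>f | f \<in> F \<and> \<rho> f = e. \<eta> f) = (\<Sum>e\<in>?D. \<Sum>f | f \<in> {f. f \<in> F \<and> u \<in> \<rho> f} \<and> \<rho> f = e. \<eta> f)"
        by (rule sum.cong[OF refl], rule sum.cong) auto
      also have "\<dots> = (\<Sum>f | f \<in> F \<and> u \<in> \<rho> f. \<eta> f)"
      proof (rule sum.group)
        show "\<rho> ` {f. f \<in> F \<and> u \<in> \<rho> f} \<subseteq> ?D" using \<rho>(2) by blast
      qed (use finF finE in simp_all)
      finally show ?thesis .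
    qed
    finally show ?thesis unfolding h_def by simp
  qed
  have h0: "h u = 0" if "u \<notin> C" for u
  proof -
    have "u \<in> \<rho> f \<longleftrightarrow> u \<in> f" if "f \<in> F" for f using \<rho>(2)[OF that] \<open>u \<notin> C\<close> by blast
    then have "{f. f \<in> F \<and> u \<in> \<rho> f} = {f. f \<in> F \<and> u \<in> f}" by blast
    then show ?thesis unfolding h_def by (simp only: diff_self)
  qed
  define Q where "Q = (\<Prod>e\<in>X \<union> {}. vertex_sum ?EC z (end1 e) - vertex_sum ?EC z (end2 e))"
  define W where "W = (\<lambda>e. (e, 2::nat)) ` tk ` X"
  have finW: "finite W" using finX unfolding W_def by simp
  have "Q \<simeq> (\<Prod>e\<in>tk ` X. \<tau> e)"
    unfolding Q_def Un_empty_right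
  proof (rule token_product[OF X_disj tk'])
    show "card x = 2" if "x \<in> X" for x using two X_off that unfolding off_def by blast
    fix x u assume x: "x \<in> X" "u \<in> x"
    have "{e. e \<in> tk ` X \<and> u \<in> e} = (if u \<in> tk x then {tk x} else {})"
      using uniq(1)[OF x] x(1) by (auto split: if_splits)
    then have "T u = (if u \<in> tk x then \<tau> (tk x) else 0)" unfolding T_def by (simp split: if_splits)
    then show "vertex_sum ?EC z u = (if u \<in> tk x then \<tau> (tk x) else 0)"
      using h0[OF X_C[OF x]] by (simp add: csz)
  qed
  also have "(\<Prod>e\<in>tk ` X. \<tau> e) = mon W"
  proof -
    have "(\<Prod>e\<in>tk ` X. \<tau> e) = (\<Prod>i\<in>W. eps i)" unfolding W_def \<tau>_def by (simp add: prod.reindex inj_on_def)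
    then show ?thesis using finW by (simp add: prod_eps)
  qed
  finally have QW: "Q \<simeq> mon W" .
  have QT: "Q * T u = 0" for u
  proof -
    have "mon W * T u = 0" unfolding T_def sum_distrib_left
    proof (rule sum.neutral, rule ballI)
      fix e assume "e \<in> {e. e \<in> tk ` X \<and> u \<in> e}"
      then have "(e, 2) \<in> W" unfolding W_def by blast
      then show "mon W * \<tau> e = 0" unfolding \<tau>_def using finW by (simp add: mon_mult)
    qed
    then show ?thesis using QW unfolding upto_sign_def by auto
  qed
  \<comment> \<open>\<open>C\<close> may be infinite; \<open>S\<close> is the finite set of its
    vertices that lie on an edge.\<close>
  define S where "S = src ` ?EC"
  define d where "d = (\<lambda>s. card {f\<in>F. src f = s} + card {f\<in>F. src (\<rho> f) = s})"
  have finS: "finite S" unfolding S_def using finE by simp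
  have SC: "S \<subseteq> C" unfolding S_def using ec(2) by blast
  have hs: "h s = (\<Sum>f | f \<in> F \<and> src f = s. \<eta> f) - (\<Sum>f | f \<in> F \<and> src (\<rho> f) = s. \<eta> f)"
    and ds: "d s = card {f\<in>F. s \<in> f} + card {f\<in>F. s \<in> \<rho> f}" if "s \<in> C" for s
  proof -
    have "{f. f \<in> F \<and> s \<in> f} = {f. f \<in> F \<and> src f = s}" using mem_C[OF _ that] F(1) by blast
    moreover have "{f. f \<in> F \<and> s \<in> \<rho> f} = {f. f \<in> F \<and> src (\<rho> f) = s}" using mem_C[OF _ that] \<rho>(2) by blast
    ultimately show "h s = (\<Sum>f | f \<in> F \<and> src f = s. \<eta> f) - (\<Sum>f | f \<in> F \<and> src (\<rho> f) = s. \<eta> f)"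
      and "d s = card {f\<in>F. s \<in> f} + card {f\<in>F. s \<in> \<rho> f}" unfolding h_def d_def by (simp_all only:)
  qed
  have src_ne: "src f \<in> S \<and> src (\<rho> f) \<in> S \<and> src f \<noteq> src (\<rho> f)" if "f \<in> F" for f
  proof -
    have fEC: "f \<in> ?EC" "\<rho> f \<in> ?EC" "\<rho> f \<noteq> f" "\<rho> f - C = f - C" using F(1) \<rho>(2)[OF that] that by blast+
    have "ctr f \<in> f - C" using ecm[OF fEC(1)] ec(3)[OF fEC(1)] by blast
    then have "ctr f \<in> \<rho> f - C" by (simp only: fEC(4))
    then have ctr: "ctr f = ctr (\<rho> f)" using ecm[OF fEC(2)] ec(2)[OF fEC(2)] by (metis DiffD1 DiffD2)
    have "src f \<noteq> src (\<rho> f)"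
    proof
      assume eq: "src f = src (\<rho> f)"
      have "\<rho> f = f" by (rule set_eqI) (simp only: ecm[OF fEC(1)] ecm[OF fEC(2)] eq ctr)
      then show False using fEC(3) by contradiction
    qed
    then show ?thesis using fEC unfolding S_def by blast
  qed
  obtain c where c: "c \<noteq> 0" "(\<Prod>s\<in>S. ((\<Sum>f | f \<in> F \<and> src f = s. \<eta> f) - (\<Sum>f | f \<in> F \<and> src (\<rho> f) = s. \<eta> f)) ^ d s) = of_int c * mon (F \<times> {0, 1})"
    using double_form_prod[OF finF finS, of src "src \<circ> \<rho>"] src_ne unfolding d_def \<eta>_def o_def by blast
  have hprod: "(\<Prod>s\<in>S. h s ^ d s) = of_int c * mon (F \<times> {0, 1})"
    unfolding c(2)[symmetric] by (rule prod.cong[OF refl]) (use SC hs in \<open>simp only: subsetD\<close>)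
  define k where "k s = card {e. e \<in> ?EC \<and> src e = s}" for s
  \<comment> \<open>\<open>h\<close> vanishes at the end outside \<open>C\<close>, so only the end
    in \<open>C\<close> contributes.\<close>
  have "(\<Prod>e\<in>?EC - {}. h (end1 e) - h (end2 e)) \<simeq> (\<Prod>e\<in>?EC. h (src e))"
    unfolding Diff_empty
  proof (rule upto_sign_prod)
    fix e assume "e \<in> ?EC"
    then have "h (ctr e) = 0" using ec(3) h0 by blast
    then show "h (end1 e) - h (end2 e) \<simeq> h (src e)" unfolding src_def ctr_def
      by (cases "end1 e \<in> C") (simp_all add: upto_sign_minus)
  qed
  also have "(\<Prod>e\<in>?EC. h (src e)) = (\<Prod>s\<in>S. \<Prod>e | e \<in> ?EC \<and> src e = s. h (src e))"
    by (rule prod.group[symmetric]) (use finE finS in \<open>simp_all add: S_def\<close>)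
  also have "\<dots> = (\<Prod>s\<in>S. h s ^ k s)" unfolding k_def by (rule prod.cong[OF refl]) simp
  finally have hEC: "(\<Prod>e\<in>?EC - {}. h (end1 e) - h (end2 e)) \<simeq> (\<Prod>s\<in>S. h s ^ k s)" .
  \<comment> \<open>Pads the number \<open>k s\<close> of cell edges at \<open>s\<close> to the
    digraph degree \<open>d s\<close>, the exponent required by \<open>double_form_prod\<close>; the
    hypothesis \<open>deg\<close> gives \<open>k s \<le> d s\<close>.\<close>
  define R where "R = (\<Prod>s\<in>S. h s ^ (d s - k s))"
  have kd: "k s \<le> d s" if "s \<in> S" for s
  proof -
    have sC: "s \<in> C" using that SC by blast
    have "k s \<le> card {e\<in>E. s \<in> e}" unfolding k_def
      by (rule card_mono) (use finE mem_C[OF _ sC] in auto)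
    then show ?thesis using deg[OF sC] ds[OF sC] by simp
  qed
  have "(\<Prod>s\<in>S. h s ^ k s) * R = (\<Prod>s\<in>S. h s ^ d s)"
    unfolding R_def prod.distrib[symmetric] power_add[symmetric] by (rule prod.cong[OF refl]) (simp add: kd)
  moreover have "mon W * mon (F \<times> {0, 1}) = mon (W \<union> F \<times> {0, 1})"
  proof -
    have "W \<inter> F \<times> {0, 1} = {}" by (auto simp: W_def)
    then show ?thesis using finW finF by (simp add: mon_mult)
  qed
  moreover have "Q * (\<Prod>e\<in>?EC - {}. h (end1 e) - h (end2 e)) * R \<simeq> mon W * (\<Prod>s\<in>S. h s ^ k s) * R"
    by (intro upto_sign_mult QW hEC upto_sign_refl)
  ultimately have fin: "Q * (\<Prod>e\<in>?EC - {}. h (end1 e) - h (end2 e)) * R \<simeq> of_int c * mon (W \<union> F \<times> {0, 1})"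
    by (simp only: mult.assoc hprod mult.left_commute[of "mon W" "of_int c"])
  show ?thesis
  proof (rule frame_cell[OF finE two, of C "{}" z Q h R c "W \<union> F \<times> {0, 1}"])
    show "good (off E C - isol (off E C))" using good unfolding X_def .
    show "z e ^ 5 = 0" if "e \<in> ?EC" for e
    proof -
      have "((if e \<in> F then \<eta> e else 0) + (if e \<in> tk ` X then \<tau> e else 0)) ^ 3 = 0"
      proof (cases "e \<in> F")
        case True
        then have "e \<notin> tk ` X" using F(2) by blast
        then show ?thesis using True eta_cube[of e] by (simp add: \<eta>_def)
      next
        case False
        have "\<tau> e ^ 3 = 0" unfolding \<tau>_def by (simp add: power3_eq_cube)
        then show ?thesis using False by (simp add: power3_eq_cube)
      qed
      moreover have "(- (\<Sum>f | f \<in> F \<and> \<rho> f = e. \<eta> f)) ^ 3 = 0"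
      proof (cases "{f. f \<in> F \<and> \<rho> f = e} = {}")
        case True
        then show ?thesis by (simp only: sum.empty) simp
      next
        case False
        then obtain f where "f \<in> F" "\<rho> f = e" by blast
        then have "{f. f \<in> F \<and> \<rho> f = e} = {f}" using \<rho>(1) unfolding inj_on_def by blast
        then show ?thesis using eta_cube[of f, folded \<eta>_def] by (simp add: power_minus_odd)
      qed
      ultimately show ?thesis unfolding z_def by (rule cube_sum_power5)
    qed
    show "Q * vertex_sum ?EC z u = Q * h u" for u unfolding csz by (simp add: distrib_left QT)
    show "Q = (\<Prod>e\<in>isol (off E C) \<union> {}. vertex_sum ?EC z (end1 e) - vertex_sum ?EC z (end2 e))" unfolding Q_def X_def ..
    show "finite (W \<union> F \<times> {0, 1})" using finW finF by simp
    show "W \<union> F \<times> {0, 1} \<subseteq> ?EC \<times> UNIV" using tk_EC F(1) unfolding W_def by auto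
  qed (use fin c(1) h0 in \<open>simp_all\<close>)
qed

section \<open>Cells consisting of an edge\<close>

lemma two_element_eq: "card e = 2 \<Longrightarrow> u \<in> e \<Longrightarrow> c \<in> e \<Longrightarrow> u \<noteq> c \<Longrightarrow> e = {u, c}"
  using end1_end2_iff[of e] end1_end2_mem(3)[of e] by (intro set_eqI) (metis insert_iff singletonD singletonI)

text \<open>By niceness of \<open>E\<close> some other edge meets \<open>x\<close>; as
  \<open>x\<close> is isolated among the edges avoiding \<open>C\<close>, that edge runs from
  \<open>x\<close> to \<open>C\<close>.\<close>

lemma token_exists:
  assumes two: "\<And>e. e \<in> E \<Longrightarrow> card e = 2" and "nice_edges E" "x \<in> isol (off E C)"
  shows "\<exists>u\<in>x. \<exists>c\<in>C. {u, c} \<in> E"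
proof -
  have x: "x \<in> E" "x \<inter> C = {}" using assms(3) by (auto simp: isol_def off_def)
  obtain e where e: "e \<in> E" "e \<noteq> x" "x \<inter> e \<noteq> {}" using assms(2) x(1) unfolding nice_edges_def by blast
  have "e \<notin> off E C" using assms(3) e(2,3) unfolding isol_def by blast
  then obtain c where c: "c \<in> C" "c \<in> e" using e(1) unfolding off_def by blast
  obtain u where u: "u \<in> x" "u \<in> e" using e(3) by blast
  have "u \<noteq> c" using u(1) c(1) x(2) by blast
  then have "e = {u, c}" using two_element_eq[OF two[OF e(1)] u(2) c(2)] by blast
  then show ?thesis using u(1) c(1) e(1) by blast
qed

text \<open>The edge \<open>{a, b}\<close> carries \<open>\<theta>\<close>, a sum of one variable
  for each of the at most four other cell edges. Each of these has exactly one end in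
  \<open>{a, b}\<close>, so its factor becomes \<open>\<theta>\<close> up to sign once
  \<open>Q\<close> has killed the values \<open>t\<close>. In the factor of \<open>{a, b}\<close>
  itself \<open>\<theta>\<close> cancels; this factor must live on the values \<open>t\<close> and
  is therefore put into \<open>Q\<close>.\<close>

lemma edge_cell_aux:
  fixes E :: "'a set set" and a b :: 'a
  defines "C \<equiv> {a, b}" and "EC \<equiv> E - off E {a, b}"
  defines "X \<equiv> isol (off E {a, b})"
  assumes finE: "finite E" and two: "\<And>e. e \<in> E \<Longrightarrow> card e = 2" and ab: "{a, b} \<in> E" "a \<noteq> b"
    and good: "good (off E {a, b} - X)"
    and card: "card (EC - {{a, b}}) \<le> 4"
    and Y: "Y \<subseteq> EC - {{a, b}}"
    and t: "\<And>e. e \<in> Y \<Longrightarrow> t e ^ 5 = 0"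
    and z: "z = (\<lambda>e. (if e = {a, b} then (\<Sum>j<card (EC - {{a, b}}). eps ({a, b}, j)) else 0) + (if e \<in> Y then t e else 0))"
    and Q: "Q = (\<Prod>e\<in>X \<union> {{a, b}}. vertex_sum EC z (end1 e) - vertex_sum EC z (end2 e))"
    and QW: "Q \<simeq> of_int n * mon W" "n \<noteq> 0" "finite W" "W \<subseteq> Y \<times> UNIV"
    and Qt: "\<And>e. e \<in> Y \<Longrightarrow> mon W * t e = 0"
  shows "good E"
proof -
  define \<kappa> where "\<kappa> = card (EC - {{a, b}})"
  define A where "A = {{a, b}} \<times> {..<\<kappa>}"
  define \<theta> where "\<theta> = (\<Sum>i\<in>A. eps i)"
  have \<theta>: "(\<Sum>j<card (EC - {{a, b}}). eps ({a, b}, j)) = \<theta>"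
    unfolding \<theta>_def A_def \<kappa>_def by (rule sum.reindex_bij_witness[of _ snd "\<lambda>j. ({a, b}, j)"]) auto
  have cardA: "card A = \<kappa>" "finite A" by (simp_all add: A_def card_cartesian_product)
  have \<theta>\<kappa>: "\<theta> ^ \<kappa> = of_nat (fact \<kappa>) * mon A" unfolding \<theta>_def using sum_eps_power(1)[of A] cardA by simp
  have \<theta>5: "\<theta> ^ 5 = 0" unfolding \<theta>_def by (rule sum_eps_power(2)) (use cardA card in \<open>simp_all add: \<kappa>_def\<close>)
  define h where "h u = (if u \<in> C then \<theta> else 0)" for u
  have Qt': "Q * t e = 0" if "e \<in> Y" for e
    using QW(1) Qt[OF that] unfolding upto_sign_def by (auto simp: mult.assoc)
  have Qcs: "Q * vertex_sum EC z u = Q * h u" for u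
  proof -
    have "Q * vertex_sum EC z u = (\<Sum>e | e \<in> EC \<and> u \<in> e. if e = {a, b} then Q * \<theta> else 0)"
      unfolding vertex_sum_def sum_distrib_left
    proof (rule sum.cong[OF refl])
      fix e
      show "Q * z e = (if e = {a, b} then Q * \<theta> else 0)"
        unfolding z \<theta> by (simp add: distrib_left Qt')
    qed
    also have "\<dots> = (if {a, b} \<in> {e. e \<in> EC \<and> u \<in> e} then Q * \<theta> else 0)"
      by (rule sum.delta) (simp add: finE EC_def)
    also have "{a, b} \<in> {e. e \<in> EC \<and> u \<in> e} \<longleftrightarrow> u \<in> C" using ab(1) by (auto simp: EC_def off_def C_def)
    finally show ?thesis by (simp add: h_def)
  qed
  have "(\<Prod>e\<in>EC - {{a, b}}. h (end1 e) - h (end2 e)) \<simeq> (\<Prod>e\<in>EC - {{a, b}}. \<theta>)"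
  proof (rule upto_sign_prod)
    fix e assume e: "e \<in> EC - {{a, b}}"
    then have eE: "card e = 2" using two by (simp add: EC_def)
    note m = end1_end2_iff[OF eE] end1_end2_mem[OF eE]
    have "\<not> (a \<in> e \<and> b \<in> e)" using two_element_eq[OF eE _ _ ab(2)] e by blast
    moreover have "a \<in> e \<or> b \<in> e" using e by (auto simp: EC_def off_def)
    ultimately have "end1 e \<in> C \<longleftrightarrow> end2 e \<notin> C" unfolding C_def m(1)[of a] m(1)[of b] using m(4) ab(2) by blast
    then show "h (end1 e) - h (end2 e) \<simeq> \<theta>" unfolding h_def by (auto simp: upto_sign_minus)
  qed
  also have "(\<Prod>e\<in>EC - {{a, b}}. \<theta>) = of_nat (fact \<kappa>) * mon A" by (simp add: \<theta>\<kappa> flip: \<kappa>_def)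
  finally have "Q * (\<Prod>e\<in>EC - {{a, b}}. h (end1 e) - h (end2 e)) * 1 \<simeq> (of_int n * mon W) * (of_nat (fact \<kappa>) * mon A) * 1"
    by (intro upto_sign_mult QW(1) upto_sign_refl)
  also have "(of_int n * mon W) * (of_nat (fact \<kappa>) * mon A) * 1 = of_int (n * int (fact \<kappa>)) * (mon W * mon A)"
    by (simp only: of_int_mult of_int_of_nat_eq ac_simps mult_1_left)
  also have "mon W * mon A = mon (W \<union> A)"
  proof -
    have "W \<inter> A = {}" using QW(4) Y unfolding A_def by blast
    then show ?thesis using QW(3) cardA(2) by (simp add: mon_mult)
  qed
  finally have fin: "Q * (\<Prod>e\<in>EC - {{a, b}}. h (end1 e) - h (end2 e)) * 1 \<simeq> of_int (n * int (fact \<kappa>)) * mon (W \<union> A)" .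
  have abEC: "{a, b} \<in> EC" using ab(1) by (simp add: EC_def off_def)
  show ?thesis
  proof (rule frame_cell[OF finE two, of C "{{a, b}}" z Q h 1 "n * int (fact \<kappa>)" "W \<union> A"])
    show "good (off E C - isol (off E C))" using good unfolding C_def X_def .
    show "{{a, b}} \<subseteq> E" using ab(1) by simp
    show "e \<subseteq> C" if "e \<in> {{a, b}}" for e using that by (simp add: C_def)
    show "z e ^ 5 = 0" if "e \<in> E - off E C" for e
    proof (cases "e = {a, b}")
      case True
      then have "e \<notin> Y" using Y by blast
      then show ?thesis unfolding z \<theta> using True by (simp add: \<theta>5)
    next
      case False
      then show ?thesis unfolding z using t by (simp add: zero_power)
    qed
    show "Q = (\<Prod>e\<in>isol (off E C) \<union> {{a, b}}. vertex_sum (E - off E C) z (end1 e) - vertex_sum (E - off E C) z (end2 e))"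
      using Q unfolding C_def X_def EC_def .
    show "Q * vertex_sum (E - off E C) z u = Q * h u" for u using Qcs unfolding C_def EC_def .
    show "h u = 0" if "u \<notin> C" for u using that by (simp add: h_def)
    show "Q * (\<Prod>e\<in>E - off E C - {{a, b}}. h (end1 e) - h (end2 e)) * 1 \<simeq> of_int (n * int (fact \<kappa>)) * mon (W \<union> A)"
      using fin unfolding C_def EC_def .
    show "n * int (fact \<kappa>) \<noteq> 0" using QW(2) by simp
    show "finite (W \<union> A)" using QW(3) cardA(2) by simp
    have "W \<union> A \<subseteq> EC \<times> UNIV" using QW(4) Y abEC unfolding A_def by blast
    then show "W \<union> A \<subseteq> (E - off E C) \<times> UNIV" unfolding EC_def C_def .
  qed
qed

text \<open>Degree sum 6 leaves four edges besides \<open>{a, b}\<close>. It remains to keep the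
  factor of \<open>{a, b}\<close>, a signed sum of the values on the other cell edges, from
  vanishing together with the token product.\<close>

lemma edge_cell:
  fixes E :: "'a set set"
  assumes finE: "finite E" and two: "\<And>e. e \<in> E \<Longrightarrow> card e = 2" and nice: "nice_edges E"
    and ab: "{a, b} \<in> E" "a \<noteq> b"
    and good: "good (off E {a, b} - isol (off E {a, b}))"
    and deg: "card {e\<in>E. a \<in> e} + card {e\<in>E. b \<in> e} \<le> 6"
  shows "good E"
proof -
  define C where "C = {a, b}"
  define EC where "EC = E - off E {a, b}"
  define X where "X = isol (off E {a, b})"
  let ?e1 = "{a, b}"
  have EC_un: "EC = {e\<in>E. a \<in> e} \<union> {e\<in>E. b \<in> e}" by (auto simp: EC_def off_def)
  have finEC: "finite EC" using finE by (simp add: EC_def)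
  have int: "{e\<in>E. a \<in> e} \<inter> {e\<in>E. b \<in> e} = {?e1}"
  proof (rule set_eqI)
    fix e
    show "e \<in> {e\<in>E. a \<in> e} \<inter> {e\<in>E. b \<in> e} \<longleftrightarrow> e \<in> {?e1}"
      using two_element_eq[OF two, of e a b] ab by auto
  qed
  have e1EC: "?e1 \<in> EC" using ab(1) by (simp add: EC_def off_def)
  have card: "card (EC - {?e1}) \<le> 4"
  proof -
    have "card EC + card {?e1} = card {e\<in>E. a \<in> e} + card {e\<in>E. b \<in> e}"
      unfolding EC_un int[symmetric] using finE by (intro card_Un_Int[symmetric]) simp_all
    then show ?thesis using deg finEC e1EC by (simp add: card_Diff_singleton)
  qed
  let ?\<theta> = "\<Sum>j<card (EC - {?e1}). eps (?e1, j)"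
  define Z where "Z Y t e = (if e = ?e1 then ?\<theta> else 0) + (if e \<in> Y then t e else 0)" for Y and t :: "'a set \<Rightarrow> ('a set \<times> nat) sq" and e
  have csZ: "vertex_sum EC (Z Y t) u = (if u \<in> C then ?\<theta> else 0) + (\<Sum>e | e \<in> Y \<and> u \<in> e. t e)" if Y: "Y \<subseteq> EC - {?e1}" for Y t u
  proof -
    let ?D = "{e. e \<in> EC \<and> u \<in> e}"
    have fD: "finite ?D" using finEC by simp
    have "vertex_sum EC (Z Y t) u = (\<Sum>e\<in>?D. if e = ?e1 then ?\<theta> else 0) + (\<Sum>e\<in>?D. if e \<in> Y then t e else 0)"
      unfolding vertex_sum_def Z_def by (rule sum.distrib)
    also have "(\<Sum>e\<in>?D. if e = ?e1 then ?\<theta> else 0) = (if ?e1 \<in> ?D then ?\<theta> else 0)"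
      using fD by (rule sum.delta)
    also have "?e1 \<in> ?D \<longleftrightarrow> u \<in> C" using e1EC by (simp add: C_def)
    also have "(\<Sum>e\<in>?D. if e \<in> Y then t e else 0) = (\<Sum>e | e \<in> Y \<and> u \<in> e. t e)"
    proof -
      have "{e \<in> ?D. e \<in> Y} = {e. e \<in> Y \<and> u \<in> e}" using Y by blast
      then show ?thesis using sum.inter_filter[OF fD, of t "\<lambda>e. e \<in> Y"] by (simp only:)
    qed
    finally show ?thesis .
  qed
  have cs1: "vertex_sum EC (Z Y t) (end1 ?e1) - vertex_sum EC (Z Y t) (end2 ?e1) \<simeq> (\<Sum>e\<in>Y. if a \<in> e then t e else - t e)"
    if Y: "Y \<subseteq> EC - {?e1}" for Y t
  proof -
    have finY: "finite Y" using finite_subset[OF Y] finEC by simp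
    have "(\<Sum>e | e \<in> Y \<and> a \<in> e. t e) - (\<Sum>e | e \<in> Y \<and> b \<in> e. t e) = (\<Sum>e\<in>Y. if a \<in> e then t e else - t e)"
      unfolding sum.inter_filter[OF finY] sum_subtractf[symmetric]
    proof (rule sum.cong[OF refl])
      fix e assume "e \<in> Y"
      then have "e \<in> EC" "e \<noteq> ?e1" using Y by blast+
      then have "a \<in> e \<longleftrightarrow> b \<notin> e" using int unfolding EC_un by blast
      then show "(if a \<in> e then t e else 0) - (if b \<in> e then t e else 0) = (if a \<in> e then t e else - t e)" by simp
    qed
    moreover have "{end1 ?e1, end2 ?e1} = {a, b}" using end1_end2[OF two[OF ab(1)]] by simp
    then have "(end1 ?e1 = a \<and> end2 ?e1 = b) \<or> (end1 ?e1 = b \<and> end2 ?e1 = a)" by (simp only: doubleton_eq_iff)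
    moreover have "vertex_sum EC (Z Y t) a - vertex_sum EC (Z Y t) b = (\<Sum>e | e \<in> Y \<and> a \<in> e. t e) - (\<Sum>e | e \<in> Y \<and> b \<in> e. t e)"
      unfolding csZ[OF Y] by (simp add: C_def)
    ultimately show ?thesis unfolding upto_sign_def by (elim disjE conjE) (simp_all, metis minus_diff_eq)
  qed
  have X_C: "u \<notin> C" if "x \<in> X" "u \<in> x" for x u using iso_off_C[of x E ?e1 u] that unfolding X_def C_def .
  have X_E: "X \<subseteq> E" by (auto simp: X_def isol_def off_def)
  have finX: "finite X" using finite_subset[OF X_E finE] .
  have e1X: "?e1 \<notin> X" using X_C[of ?e1 a] by (auto simp: C_def)
  show ?thesis
  proof (cases "X = {}")
    case True
    \<comment> \<open>Without isolated edges there is no token; niceness provides an edge adjacent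
      to \<open>{a, b}\<close> to carry a variable.\<close>
    obtain e0 where e0: "e0 \<in> E" "e0 \<noteq> ?e1" "?e1 \<inter> e0 \<noteq> {}" using nice ab(1) unfolding nice_edges_def by blast
    have Y: "{e0} \<subseteq> EC - {?e1}" using e0 by (auto simp: EC_def off_def)
    define t where "t e = eps (e, 0::nat)" for e :: "'a set"
    define Q where "Q = (\<Prod>e\<in>X \<union> {?e1}. vertex_sum EC (Z {e0} t) (end1 e) - vertex_sum EC (Z {e0} t) (end2 e))"
    have "Q = vertex_sum EC (Z {e0} t) (end1 ?e1) - vertex_sum EC (Z {e0} t) (end2 ?e1)" unfolding Q_def True by simp
    then have "Q \<simeq> (if a \<in> e0 then t e0 else - t e0)" using cs1[OF Y, of t] by simp
    then have Q: "Q \<simeq> of_int 1 * mon {(e0, 0)}" unfolding t_def upto_sign_def by (simp split: if_splits) metis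
    show ?thesis
    proof (rule edge_cell_aux[OF finE two ab, of "{e0}" t "Z {e0} t" Q 1 "{(e0, 0)}"])
      show "Z {e0} t = (\<lambda>e. (if e = {a, b} then (\<Sum>j<card (E - off E {a, b} - {{a, b}}). eps ({a, b}, j)) else 0) + (if e \<in> {e0} then t e else 0))"
        unfolding Z_def EC_def ..
      show "t e ^ 5 = 0" if "e \<in> {e0}" for e by (simp add: t_def eval_nat_numeral)
      show "mon {(e0, 0)} * t e = 0" if "e \<in> {e0}" for e using that by (simp add: t_def)
    qed (use good card Y Q in \<open>simp_all add: Q_def X_def EC_def\<close>)
  next
    case False
    have "\<forall>x\<in>X. \<exists>u\<in>x. \<exists>c\<in>?e1. {u, c} \<in> E" using token_exists[OF two nice, of _ ?e1] unfolding X_def by blast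
    then have "\<forall>x\<in>X. \<exists>e. e \<in> E \<and> (\<exists>u\<in>x. \<exists>c\<in>?e1. e = {u, c})" by blast
    then obtain tk where tk: "\<And>x. x \<in> X \<Longrightarrow> tk x \<in> E \<and> (\<exists>u\<in>x. \<exists>c\<in>?e1. tk x = {u, c})" by metis
    have tk': "\<forall>x\<in>X. \<exists>u\<in>x. \<exists>c. c \<notin> \<Union>X \<and> tk x = {u, c}"
    proof
      fix x assume x: "x \<in> X"
      obtain u c where uc: "u \<in> x" "c \<in> C" "tk x = {u, c}" using tk[OF x] unfolding C_def by blast
      have "c \<notin> \<Union>X" using X_C uc(2) by blast
      then show "\<exists>u\<in>x. \<exists>c. c \<notin> \<Union>X \<and> tk x = {u, c}" using uc(1,3) by blast
    qed
    have disj: "\<forall>x\<in>X. \<forall>y\<in>X. x \<inter> y \<noteq> {} \<longrightarrow> x = y" unfolding X_def by (rule iso_disjoint)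
    note uniq = token_unique[OF disj tk']
    obtain x0 where x0: "x0 \<in> X" using False by blast
    define Y where "Y = tk ` X"
    have finY: "finite Y" using finX by (simp add: Y_def)
    have Y: "Y \<subseteq> EC - {?e1}"
    proof
      fix e assume "e \<in> Y"
      then obtain x where x: "x \<in> X" "e = tk x" unfolding Y_def by blast
      obtain u c where uc: "u \<in> x" "c \<in> ?e1" "tk x = {u, c}" using tk[OF x(1)] by blast
      have "u \<notin> ?e1" using X_C[OF x(1) uc(1)] unfolding C_def .
      then show "e \<in> EC - {?e1}" using uc(2,3) tk[OF x(1)] x(2) unfolding EC_def off_def by blast
    qed
    define e0 where "e0 = tk x0"
    have e0: "e0 \<in> Y" using x0 by (simp add: e0_def Y_def)
    \<comment> \<open>The token \<open>e0\<close> gets two variables because it is needed twice: for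
      its isolated edge and for the factor of \<open>{a, b}\<close>.\<close>
    define t where "t e = eps (e, 0::nat) + (if e = e0 then eps (e, 1) else 0)" for e :: "'a set"
    define W where "W = Y \<times> {0} \<union> {(e0, 1::nat)}"
    define Q where "Q = (\<Prod>e\<in>X \<union> {?e1}. vertex_sum EC (Z Y t) (end1 e) - vertex_sum EC (Z Y t) (end2 e))"
    let ?c = "vertex_sum EC (Z Y t)"
    have "Q = (\<Prod>x\<in>X. ?c (end1 x) - ?c (end2 x)) * (?c (end1 ?e1) - ?c (end2 ?e1))"
      unfolding Q_def using finX e1X by (simp add: mult.commute)
    moreover have "(\<Prod>x\<in>X. ?c (end1 x) - ?c (end2 x)) \<simeq> (\<Prod>e\<in>tk ` X. t e)"
    proof (rule token_product[OF disj tk'])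
      show "card x = 2" if "x \<in> X" for x using two X_E that by blast
      fix x u assume x: "x \<in> X" "u \<in> x"
      have "{e. e \<in> Y \<and> u \<in> e} = (if u \<in> tk x then {tk x} else {})"
        using uniq(1)[OF x] x(1) unfolding Y_def by (auto split: if_splits)
      then show "?c u = (if u \<in> tk x then t (tk x) else 0)"
        unfolding csZ[OF Y] using X_C[OF x] by (simp split: if_splits)
    qed
    ultimately have Q1: "Q \<simeq> (\<Prod>e\<in>Y. t e) * (\<Sum>e\<in>Y. if a \<in> e then t e else - t e)"
      unfolding Y_def[symmetric] using cs1[OF Y, of t] by (simp only:) (rule upto_sign_mult)
    have ne0: "t e = eps (e, 0)" if "e \<noteq> e0" for e using that by (simp add: t_def)
    have zero: "(\<Prod>e\<in>Y. t e) * t e = 0" if "e \<in> Y" "e \<noteq> e0" for e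
    proof -
      have "(\<Prod>e\<in>Y. t e) * t e = (\<Prod>e\<in>Y-{e}. t e) * (t e * t e)" using finY that(1) by (simp add: prod.remove ac_simps)
      then show ?thesis by (simp add: ne0[OF that(2)])
    qed
    have main: "(\<Prod>e\<in>Y. t e) * t e0 = of_int 2 * mon W"
    proof -
      have "(\<Prod>e\<in>Y. t e) * t e0 = (\<Prod>e\<in>Y-{e0}. t e) * (t e0 * t e0)" using finY e0 by (simp add: prod.remove ac_simps)
      also have "t e0 * t e0 = 2 * mon {(e0, 0), (e0, 1)}"
        by (simp add: t_def algebra_simps mon_mult insert_commute)
      also have "(\<Prod>e\<in>Y-{e0}. t e) = mon ((Y - {e0}) \<times> {0})"
      proof -
        have "(\<Prod>e\<in>Y-{e0}. t e) = (\<Prod>i\<in>(Y - {e0}) \<times> {0}. eps i)"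
          by (rule prod.reindex_bij_witness[of _ fst "\<lambda>e. (e, 0)"]) (auto simp: ne0)
        then show ?thesis using finY by (simp add: prod_eps)
      qed
      also have "mon ((Y - {e0}) \<times> {0}) * (2 * mon {(e0, 0), (e0, 1)}) = 2 * (mon ((Y - {e0}) \<times> {0}) * mon {(e0, 0), (e0, 1)})"
        by (simp only: ac_simps)
      also have "mon ((Y - {e0}) \<times> {0}) * mon {(e0, 0), (e0, 1)} = mon W"
      proof -
        have "(Y - {e0}) \<times> {0} \<inter> {(e0, 0), (e0, 1)} = {}" by auto
        moreover have "(Y - {e0}) \<times> {0} \<union> {(e0, 0), (e0, 1)} = W" using e0 by (auto simp: W_def)
        ultimately show ?thesis using finY by (simp add: mon_mult)
      qed
      finally show ?thesis by simp
    qed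
    \<comment> \<open>The other tokens square to zero, so of the factor of \<open>{a, b}\<close>
      only the summand of \<open>e0\<close> survives.\<close>
    have "(\<Prod>e\<in>Y. t e) * (\<Sum>e\<in>Y. if a \<in> e then t e else - t e)
      = (\<Sum>e\<in>Y. if e = e0 then (if a \<in> e0 then of_int 2 * mon W else - (of_int 2 * mon W)) else 0)"
      unfolding sum_distrib_left by (rule sum.cong[OF refl]) (auto simp: zero main)
    also have "\<dots> = (if a \<in> e0 then of_int 2 * mon W else - (of_int 2 * mon W))"
      using finY e0 by (simp add: sum.delta)
    finally have Q: "Q \<simeq> of_int 2 * mon W" using Q1 unfolding upto_sign_def by (simp split: if_splits) metis
    have finW: "finite W" using finY by (simp add: W_def)
    show ?thesis
    proof (rule edge_cell_aux[OF finE two ab, of Y t "Z Y t" Q 2 W])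
      show "Z Y t = (\<lambda>e. (if e = {a, b} then (\<Sum>j<card (E - off E {a, b} - {{a, b}}). eps ({a, b}, j)) else 0) + (if e \<in> Y then t e else 0))"
        unfolding Z_def EC_def ..
      show "t e ^ 5 = 0" if "e \<in> Y" for e
      proof (cases "e = e0")
        case True
        have "(eps (e0, 0::nat) + eps (e0, 1)) ^ 5 = (eps (e0, 0) + eps (e0, 1)) ^ 3 * (eps (e0, 0) + eps (e0, 1)) ^ 2"
          by (simp flip: power_add)
        then show ?thesis using True by (simp only: t_def if_True eta_cube mult_zero_left refl)
      next
        case False
        then show ?thesis by (simp add: ne0 eval_nat_numeral)
      qed
      show "mon W * t e = 0" if "e \<in> Y" for e
        using that finW by (simp add: t_def distrib_left mon_mult W_def)
      show "W \<subseteq> Y \<times> UNIV" using e0 by (auto simp: W_def)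
    qed (use good card Y Q finW in \<open>simp_all add: Q_def X_def EC_def\<close>)
  qed
qed

section \<open>Cells consisting of two vertices with common neighbours\<close>

lemma power_eq_0_mono:
  fixes x :: "'r::comm_ring_1"
  assumes "x ^ k = 0" "k \<le> n"
  shows "x ^ n = 0"
proof -
  have "x ^ n = x ^ k * x ^ (n - k)" using assms(2) by (simp flip: power_add)
  then show ?thesis using assms(1) by simp
qed

text \<open>Every other term of the binomial expansion of \<open>(\<theta>\<^sup>2 - H\<^sup>2) ^ (2 * p - 1)\<close> has a vanishing power of \<open>\<theta>\<close> or of \<open>H\<close>.\<close>
lemma pair_power_expand:
  fixes \<theta> H :: "'r::comm_ring_1"
  assumes "\<theta> ^ 5 = 0" "H ^ (4 * p - 4) = 0" "p \<ge> 2"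
  shows "H * ((\<theta> + H) * (\<theta> - H)) ^ (2 * p - 1)
    = of_nat ((2 * p - 1) choose 2) * (- 1) ^ (2 * p - 3) * (\<theta> ^ 4 * H ^ (4 * p - 5))"
proof -
  let ?n = "2 * p - 1"
  have zero: "H * (of_nat (?n choose k) * (\<theta>\<^sup>2) ^ k * (- (H\<^sup>2)) ^ (?n - k)) = 0" if "k \<noteq> 2" "k \<le> ?n" for k
  proof (cases "k \<ge> 3")
    case True
    have "(\<theta>\<^sup>2) ^ k = \<theta> ^ (2 * k)" by (simp only: power_mult)
    also have "\<dots> = 0" by (rule power_eq_0_mono[OF assms(1)]) (use True in simp)
    finally show ?thesis by simp
  next
    case False
    have "H * (- (H\<^sup>2)) ^ (?n - k) = (- 1) ^ (?n - k) * H ^ Suc (2 * (?n - k))"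
      by (simp add: power_minus[of "H\<^sup>2"] power_mult[symmetric] mult.left_commute)
    also have "H ^ Suc (2 * (?n - k)) = 0"
      by (rule power_eq_0_mono[OF assms(2)]) (use False that assms(3) in linarith)
    finally have H0: "H * (- (H\<^sup>2)) ^ (?n - k) = 0" by simp
    have "H * (of_nat (?n choose k) * (\<theta>\<^sup>2) ^ k * (- (H\<^sup>2)) ^ (?n - k))
      = of_nat (?n choose k) * (\<theta>\<^sup>2) ^ k * (H * (- (H\<^sup>2)) ^ (?n - k))" by (simp only: ac_simps)
    then show ?thesis by (simp only: H0 mult_zero_right)
  qed
  have "H * ((\<theta> + H) * (\<theta> - H)) ^ ?n = H * (\<theta>\<^sup>2 + - (H\<^sup>2)) ^ ?n"
    by (simp add: algebra_simps power2_eq_square)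
  also have "\<dots> = (\<Sum>k\<le>?n. H * (of_nat (?n choose k) * (\<theta>\<^sup>2) ^ k * (- (H\<^sup>2)) ^ (?n - k)))"
    by (simp only: binomial_ring sum_distrib_left)
  also have "\<dots> = (\<Sum>k\<le>?n. if k = 2 then H * (of_nat (?n choose 2) * (\<theta>\<^sup>2) ^ 2 * (- (H\<^sup>2)) ^ (?n - 2)) else 0)"
  proof (rule sum.cong[OF refl])
    fix k assume "k \<in> {..?n}"
    then have k: "k \<le> ?n" by simp
    show "H * (of_nat (?n choose k) * (\<theta>\<^sup>2) ^ k * (- (H\<^sup>2)) ^ (?n - k))
      = (if k = 2 then H * (of_nat (?n choose 2) * (\<theta>\<^sup>2) ^ 2 * (- (H\<^sup>2)) ^ (?n - 2)) else 0)"
    proof (cases "k = 2")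
      case True
      then show ?thesis by (simp only: if_True simp_thms)
    next
      case False
      then show ?thesis by (simp only: if_False zero[OF False k] simp_thms)
    qed
  qed
  also have "\<dots> = H * (of_nat (?n choose 2) * (\<theta>\<^sup>2) ^ 2 * (- (H\<^sup>2)) ^ (?n - 2))"
    using assms(3) by (subst sum.delta) auto
  also have "\<dots> = of_nat (?n choose 2) * (- 1) ^ (?n - 2) * ((\<theta>\<^sup>2) ^ 2 * (H * (H\<^sup>2) ^ (?n - 2)))"
    by (simp add: power_minus[of "H\<^sup>2"] ac_simps)
  also have "(\<theta>\<^sup>2) ^ 2 = \<theta> ^ 4" by (simp flip: power_mult)
  also have "?n - 2 = 2 * p - 3" by simp
  also have "H * (H\<^sup>2) ^ (2 * p - 3) = H ^ (4 * p - 5)"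
  proof -
    have "4 * p - 5 = Suc (2 * (2 * p - 3))" using assms(3) by linarith
    then show ?thesis by (simp only: power_Suc power_mult)
  qed
  finally show ?thesis .
qed

text \<open>The left side has degree \<open>1 + 2 * (2 * p - 1)\<close>, which matches the
  \<open>4 + (4 * p - 5)\<close> variables; 4 is the highest power of \<open>\<theta>\<close> and
  \<open>4 * p - 5\<close> that of \<open>H\<close>.\<close>

lemma pair_power:
  assumes "finite A" "finite B" "A \<inter> B = {}" "card A = 4" "card B = 4 * p - 5" "p \<ge> 2"
  defines "\<theta> \<equiv> (\<Sum>i\<in>A. eps i)" and "H \<equiv> (\<Sum>i\<in>B. eps i)"
  obtains c where "c \<noteq> 0" "2 * H * ((\<theta> + H) * (\<theta> - H)) ^ (2 * p - 1) = of_int c * mon (A \<union> B)"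
proof -
  define c where "c = 2 * (int ((2 * p - 1) choose 2) * (- 1) ^ (2 * p - 3) * (int (fact 4) * int (fact (4 * p - 5))))"
  have \<theta>4: "\<theta> ^ 4 = of_nat (fact 4) * mon A" unfolding \<theta>_def using sum_eps_power(1)[OF assms(1)] by (simp only: assms(4))
  have \<theta>5: "\<theta> ^ 5 = 0" unfolding \<theta>_def by (rule sum_eps_power(2)[OF assms(1)]) (use assms(4) in simp)
  have HN: "H ^ (4 * p - 5) = of_nat (fact (4 * p - 5)) * mon B" unfolding H_def using sum_eps_power(1)[OF assms(2)] by (simp only: assms(5))
  have H0: "H ^ (4 * p - 4) = 0" unfolding H_def by (rule sum_eps_power(2)[OF assms(2)]) (use assms(5,6) in simp)
  have "2 * H * ((\<theta> + H) * (\<theta> - H)) ^ (2 * p - 1)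
    = 2 * (of_nat ((2 * p - 1) choose 2) * (- 1) ^ (2 * p - 3) * (\<theta> ^ 4 * H ^ (4 * p - 5)))"
    using pair_power_expand[OF \<theta>5 H0 assms(6)] by (simp only: mult.assoc)
  also have "\<dots> = of_int c * (mon A * mon B)"
    unfolding \<theta>4 HN c_def
    by (simp only: of_int_mult of_int_of_nat_eq of_int_power of_int_minus of_int_1 of_int_numeral ac_simps)
  also have "mon A * mon B = mon (A \<union> B)" using assms(1-3) by (simp add: mon_mult)
  finally have eq: "2 * H * ((\<theta> + H) * (\<theta> - H)) ^ (2 * p - 1) = of_int c * mon (A \<union> B)" .
  have "(2 * p - 1) choose 2 \<noteq> 0" using assms(6) by (simp add: binomial_eq_0_iff)
  then have "c \<noteq> 0" by (simp add: c_def)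
  then show ?thesis using eq by (rule that)
qed

text \<open>A value \<open>\<eta> v\<close> is added on \<open>{s, v}\<close> and subtracted on
  \<open>{w, v}\<close>, so it cancels at the common neighbour \<open>v\<close>. The vertex sums
  become \<open>\<theta> + H\<close> at \<open>s\<close>, \<open>\<theta> - H\<close> at
  \<open>w\<close> and 0 elsewhere. The edge \<open>{s, w}\<close> contributes \<open>2 * H\<close>,
  and the remaining cell edges contribute powers of the two sums.\<close>

lemma pair_cell:
  fixes E :: "'a set set" and s w :: 'a
  assumes finE: "finite E" and two: "\<And>e. e \<in> E \<Longrightarrow> card e = 2"
    and sw: "{s, w} \<in> E" "s \<noteq> w"
    and Z: "finite Z" "Z \<noteq> {}" "s \<notin> Z" "w \<notin> Z" "\<And>v. v \<in> Z \<Longrightarrow> {s, v} \<in> E" "\<And>v. v \<in> Z \<Longrightarrow> {w, v} \<in> E"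
    and deg: "card {e\<in>E. s \<in> e} \<le> 2 * Suc (card Z)" "card {e\<in>E. w \<in> e} \<le> 2 * Suc (card Z)"
    and good: "good (off E {s, w})" and isol: "isol (off E {s, w}) = {}"
  shows "good E"
proof -
  define C where "C = {s, w}"
  define EC where "EC = E - off E {s, w}"
  let ?e1 = "{s, w}"
  have finEC: "finite EC" using finE by (simp add: EC_def)
  have EC_un: "EC = {e\<in>E. s \<in> e} \<union> {e\<in>E. w \<in> e}" by (auto simp: EC_def off_def)
  have both: "e = ?e1" if "e \<in> E" "s \<in> e" "w \<in> e" for e using two_element_eq[OF two[OF that(1)] that(2,3) sw(2)] .
  obtain v0 where v0: "v0 \<in> Z" using Z(2) by blast
  \<comment> \<open>Only odd powers of \<open>H\<close> occur in \<open>H\<close> times a power of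
    \<open>\<theta>\<^sup>2 - H\<^sup>2\<close>. So one of the \<open>4 * card Z\<close> possible
    variables is left out, here at \<open>v0\<close>.\<close>
  define m where "m v = (if v = v0 then 3 else 4 :: nat)" for v
  define A where "A = {?e1} \<times> {..<4::nat}"
  define B where "B = (\<Union>v\<in>Z. {{s, v}} \<times> {..<m v})"
  define \<theta> where "\<theta> = (\<Sum>i\<in>A. eps i)"
  define \<eta> where "\<eta> v = (\<Sum>i\<in>{{s, v}} \<times> {..<m v}. eps i)" for v
  define H where "H = (\<Sum>i\<in>B. eps i)"
  have disjB: "\<forall>v\<in>Z. \<forall>v'\<in>Z. v \<noteq> v' \<longrightarrow> ({{s, v}} \<times> {..<m v}) \<inter> ({{s, v'}} \<times> {..<m v'}) = {}"
    using Z(3) by (auto simp: doubleton_eq_iff)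
  have Hsum: "H = (\<Sum>v\<in>Z. \<eta> v)"
    unfolding H_def B_def \<eta>_def by (rule sum.UNION_disjoint[OF Z(1) _ disjB]) simp
  have finA: "finite A" "card A = 4" by (simp_all add: A_def card_cartesian_product)
  have finB: "finite B" using Z(1) by (simp add: B_def)
  have cardB: "card B = 4 * Suc (card Z) - 5"
  proof -
    have "card B = (\<Sum>v\<in>Z. card ({{s, v}} \<times> {..<m v}))"
      unfolding B_def by (rule card_UN_disjoint[OF Z(1) _ disjB]) simp
    also have "\<dots> = (\<Sum>v\<in>Z. m v)" by (simp add: card_cartesian_product)
    also have "\<dots> = m v0 + (\<Sum>v\<in>Z-{v0}. m v)" using Z(1) v0 by (simp add: sum.remove)
    also have "(\<Sum>v\<in>Z-{v0}. m v) = (\<Sum>v\<in>Z-{v0}. 4)" by (rule sum.cong) (auto simp: m_def)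
    also have "\<dots> = 4 * (card Z - 1)" using Z(1) v0 by simp
    also have "m v0 + 4 * (card Z - 1) = 4 * Suc (card Z) - 5"
    proof -
      have "card Z > 0" using v0 Z(1) by (auto simp: card_gt_0_iff)
      then show ?thesis by (simp add: m_def)
    qed
    finally show ?thesis .
  qed
  have AB: "A \<inter> B = {}" using Z(4) sw(2) unfolding A_def B_def by (auto simp: doubleton_eq_iff)
  define z where "z e = (if e = ?e1 then \<theta> else 0) + (\<Sum>v\<in>Z. if e = {s, v} then \<eta> v else 0)
     - (\<Sum>v\<in>Z. if e = {w, v} then \<eta> v else 0)" for e
  define h where "h u = (if u = s then \<theta> + H else if u = w then \<theta> - H else 0)" for u
  have svEC: "{s, v} \<in> EC" "{w, v} \<in> EC" if "v \<in> Z" for v using Z(5,6)[OF that] by (auto simp: EC_un)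
  have e1EC: "?e1 \<in> EC" using sw(1) by (simp add: EC_un)
  have csz: "vertex_sum EC z u = h u" for u
  proof -
    let ?D = "{e. e \<in> EC \<and> u \<in> e}"
    have fD: "finite ?D" using finEC by simp
    have swap: "(\<Sum>e\<in>?D. \<Sum>v\<in>Z. if e = {r, v} then \<eta> v else 0) = (\<Sum>v\<in>Z. if u \<in> {r, v} then \<eta> v else 0)"
      if "\<And>v. v \<in> Z \<Longrightarrow> {r, v} \<in> EC" for r
    proof -
      have "(\<Sum>e\<in>?D. \<Sum>v\<in>Z. if e = {r, v} then \<eta> v else 0) = (\<Sum>v\<in>Z. \<Sum>e\<in>?D. if e = {r, v} then \<eta> v else 0)"
        by (rule sum.swap)
      also have "\<dots> = (\<Sum>v\<in>Z. if u \<in> {r, v} then \<eta> v else 0)"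
      proof (rule sum.cong[OF refl])
        fix v assume v: "v \<in> Z"
        have "(\<Sum>e\<in>?D. if e = {r, v} then \<eta> v else 0) = (if {r, v} \<in> ?D then \<eta> v else 0)"
          by (rule sum.delta[OF fD])
        also have "{r, v} \<in> ?D \<longleftrightarrow> u \<in> {r, v}" using that[OF v] by blast
        finally show "(\<Sum>e\<in>?D. if e = {r, v} then \<eta> v else 0) = (if u \<in> {r, v} then \<eta> v else 0)" .
      qed
      finally show ?thesis .
    qed
    have "vertex_sum EC z u = (\<Sum>e\<in>?D. if e = ?e1 then \<theta> else 0) + (\<Sum>e\<in>?D. \<Sum>v\<in>Z. if e = {s, v} then \<eta> v else 0)
       - (\<Sum>e\<in>?D. \<Sum>v\<in>Z. if e = {w, v} then \<eta> v else 0)"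
      unfolding vertex_sum_def z_def by (simp only: sum.distrib sum_subtractf)
    also have "(\<Sum>e\<in>?D. if e = ?e1 then \<theta> else 0) = (if ?e1 \<in> ?D then \<theta> else 0)"
      using fD by (rule sum.delta)
    also have "?e1 \<in> ?D \<longleftrightarrow> u \<in> C" using e1EC by (simp add: C_def)
    also have "(\<Sum>e\<in>?D. \<Sum>v\<in>Z. if e = {s, v} then \<eta> v else 0) = (\<Sum>v\<in>Z. if u \<in> {s, v} then \<eta> v else 0)"
      by (rule swap) (rule svEC)
    also have "(\<Sum>e\<in>?D. \<Sum>v\<in>Z. if e = {w, v} then \<eta> v else 0) = (\<Sum>v\<in>Z. if u \<in> {w, v} then \<eta> v else 0)"
      by (rule swap) (rule svEC)
    also have "(if u \<in> C then \<theta> else 0) + (\<Sum>v\<in>Z. if u \<in> {s, v} then \<eta> v else 0) - (\<Sum>v\<in>Z. if u \<in> {w, v} then \<eta> v else 0) = h u"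
    proof -
      have all: "(\<Sum>v\<in>Z. if u \<in> {r, v} then \<eta> v else 0) = H" if "u = r" for r using that by (simp add: Hsum)
      have none: "(\<Sum>v\<in>Z. if u \<in> {r, v} then \<eta> v else 0) = 0" if "u \<noteq> r" "u \<notin> Z" for r
        using that by (intro sum.neutral) auto
      consider "u = s" | "u = w" | "u \<notin> C" by (auto simp: C_def)
      then show ?thesis
      proof cases
        case 1
        then show ?thesis using all[of s] none[of w] Z(3) sw(2) by (simp add: h_def C_def)
      next
        case 2
        then show ?thesis using all[of w] none[of s] Z(4) sw(2) by (simp add: h_def C_def)
      next
        case 3
        then have "u \<noteq> s" "u \<noteq> w" by (auto simp: C_def)
        then show ?thesis using 3 by (simp add: h_def)
      qed
    qed
    finally show ?thesis .
  qed
  have h0: "h u = 0" if "u \<notin> C" for u using that by (simp add: h_def C_def)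
  define ds where "ds = card {e\<in>E. s \<in> e} - 1"
  define dw where "dw = card {e\<in>E. w \<in> e} - 1"
  define p where "p = Suc (card Z)"
  have p2: "p \<ge> 2" using Z(1,2) by (simp add: p_def Suc_le_eq card_gt_0_iff)
  let ?g = "\<lambda>e. h (end1 e) - h (end2 e)"
  have one: "?g e \<simeq> h r" if e: "e \<in> E" "r \<in> C" "e \<inter> C = {r}" for e r
  proof -
    note m = end1_end2_iff[OF two[OF e(1)]] end1_end2_mem[OF two[OF e(1)]]
    have r: "v = r \<longleftrightarrow> v \<in> C" if "v \<in> e" for v using e(3) that by blast
    have "r \<in> e" using e(3) by blast
    then have "r = end1 e \<or> r = end2 e" by (simp only: m(1))
    moreover have "end1 e = r \<or> h (end1 e) = 0" "end2 e = r \<or> h (end2 e) = 0" using r m(2,3) h0 by blast+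
    ultimately show ?thesis using m(4) by (auto simp: upto_sign_minus)
  qed
  have part: "(\<Prod>e\<in>{e\<in>E. r \<in> e} - {?e1}. ?g e) \<simeq> h r ^ (card {e\<in>E. r \<in> e} - 1)" if r: "r \<in> C" for r
  proof -
    have "(\<Prod>e\<in>{e\<in>E. r \<in> e} - {?e1}. ?g e) \<simeq> (\<Prod>e\<in>{e\<in>E. r \<in> e} - {?e1}. h r)"
    proof (rule upto_sign_prod)
      fix e assume e: "e \<in> {e\<in>E. r \<in> e} - {?e1}"
      have "e \<inter> C = {r}" using e both[of e] r unfolding C_def by blast
      then show "?g e \<simeq> h r" using one[of e r] e r by blast
    qed
    moreover have "?e1 \<in> {e\<in>E. r \<in> e}" using sw(1) r by (simp add: C_def)
    ultimately show ?thesis using finE by (simp add: card_Diff_singleton)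
  qed
  have split: "EC - {} = insert ?e1 (({e\<in>E. s \<in> e} - {?e1}) \<union> ({e\<in>E. w \<in> e} - {?e1}))"
    using e1EC unfolding EC_un by blast
  have inter: "({e\<in>E. s \<in> e} - {?e1}) \<inter> ({e\<in>E. w \<in> e} - {?e1}) = {}" using both by blast
  have "(\<Prod>e\<in>EC - {}. ?g e) = ?g ?e1 * ((\<Prod>e\<in>{e\<in>E. s \<in> e} - {?e1}. ?g e) * (\<Prod>e\<in>{e\<in>E. w \<in> e} - {?e1}. ?g e))"
    unfolding split using finE by (subst prod.insert) (simp_all add: prod.union_disjoint inter)
  also have "\<dots> \<simeq> (2 * H) * ((\<theta> + H) ^ ds * (\<theta> - H) ^ dw)"
  proof (intro upto_sign_mult)
    have "{end1 ?e1, end2 ?e1} = {s, w}" using end1_end2[OF two[OF sw(1)]] by simp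
    then have "(end1 ?e1 = s \<and> end2 ?e1 = w) \<or> (end1 ?e1 = w \<and> end2 ?e1 = s)" by (simp only: doubleton_eq_iff)
    then show "?g ?e1 \<simeq> 2 * H" using sw(2) unfolding upto_sign_def by (elim disjE conjE) (simp_all add: h_def)
    show "(\<Prod>e\<in>{e\<in>E. s \<in> e} - {?e1}. ?g e) \<simeq> (\<theta> + H) ^ ds" using part[of s] by (simp add: C_def ds_def h_def)
    show "(\<Prod>e\<in>{e\<in>E. w \<in> e} - {?e1}. ?g e) \<simeq> (\<theta> - H) ^ dw" using part[of w] sw(2) by (simp add: C_def dw_def h_def)
  qed
  finally have prodEC: "(\<Prod>e\<in>EC - {}. ?g e) \<simeq> (2 * H) * ((\<theta> + H) ^ ds * (\<theta> - H) ^ dw)" .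
  \<comment> \<open>Raises both exponents to \<open>2 * p - 1\<close>, which the degree bounds
    permit, so that the two sums combine to a power of their product.\<close>
  define R where "R = (\<theta> + H) ^ (2 * p - 1 - ds) * (\<theta> - H) ^ (2 * p - 1 - dw)"
  obtain c where c: "c \<noteq> 0" "2 * H * ((\<theta> + H) * (\<theta> - H)) ^ (2 * p - 1) = of_int c * mon (A \<union> B)"
    using pair_power[OF finA(1) finB AB finA(2), of p] cardB p2 unfolding \<theta>_def H_def p_def by blast
  have "1 * (\<Prod>e\<in>EC - {}. ?g e) * R \<simeq> 1 * ((2 * H) * ((\<theta> + H) ^ ds * (\<theta> - H) ^ dw)) * R"
    by (intro upto_sign_mult prodEC upto_sign_refl)
  also have "1 * ((2 * H) * ((\<theta> + H) ^ ds * (\<theta> - H) ^ dw)) * R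
    = 2 * H * (((\<theta> + H) ^ ds * (\<theta> + H) ^ (2 * p - 1 - ds)) * ((\<theta> - H) ^ dw * (\<theta> - H) ^ (2 * p - 1 - dw)))"
    unfolding R_def by (simp only: ac_simps mult_1_left)
  also have "(\<theta> + H) ^ ds * (\<theta> + H) ^ (2 * p - 1 - ds) = (\<theta> + H) ^ (2 * p - 1)"
    using deg(1) by (simp add: ds_def p_def flip: power_add)
  also have "(\<theta> - H) ^ dw * (\<theta> - H) ^ (2 * p - 1 - dw) = (\<theta> - H) ^ (2 * p - 1)"
    using deg(2) by (simp add: dw_def p_def flip: power_add)
  also have "2 * H * ((\<theta> + H) ^ (2 * p - 1) * (\<theta> - H) ^ (2 * p - 1)) = of_int c * mon (A \<union> B)"
    unfolding power_mult_distrib[symmetric] c(2) ..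
  finally have fin: "1 * (\<Prod>e\<in>EC - {}. ?g e) * R \<simeq> of_int c * mon (A \<union> B)" .
  have \<theta>5: "\<theta> ^ 5 = 0" unfolding \<theta>_def by (rule sum_eps_power(2)[OF finA(1)]) (simp add: finA(2))
  have \<eta>5: "\<eta> v ^ 5 = 0" for v unfolding \<eta>_def by (rule sum_eps_power(2)) (simp_all add: m_def card_cartesian_product)
  \<comment> \<open>\<open>\<theta>\<close> and the values \<open>\<eta> v\<close> sit on different
    edges, so each edge value is up to sign a sum of at most four variables.\<close>
  have z5: "z e ^ 5 = 0" for e
  proof -
    have one: "(\<Sum>v\<in>Z. if e = {r, v} then \<eta> v else 0) = (if e = {r, v'} then \<eta> v' else 0)"
      if "v' \<in> Z" "v' \<in> e" "r \<notin> Z" for r v'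
    proof -
      have "(\<Sum>v\<in>Z. if e = {r, v} then \<eta> v else 0) = (\<Sum>v\<in>Z. if v = v' then (if e = {r, v'} then \<eta> v' else 0) else 0)"
      proof (rule sum.cong[OF refl])
        fix v assume "v \<in> Z"
        have "e \<noteq> {r, v}" if "v \<noteq> v'" using \<open>v' \<in> e\<close> \<open>v' \<in> Z\<close> \<open>r \<notin> Z\<close> that by auto
        then show "(if e = {r, v} then \<eta> v else 0) = (if v = v' then (if e = {r, v'} then \<eta> v' else 0) else 0)" by simp
      qed
      also have "\<dots> = (if e = {r, v'} then \<eta> v' else 0)" using that(1) Z(1) by (simp add: sum.delta)
      finally show ?thesis .
    qed
    have none: "(\<Sum>v\<in>Z. if e = {r, v} then \<eta> v else 0) = 0" if "e \<inter> Z = {}" for r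
      by (rule sum.neutral) (use that in auto)
    show ?thesis
    proof (cases "e \<inter> Z = {}")
      case True
      show ?thesis unfolding z_def none[OF True] using \<theta>5 by simp
    next
      case False
      then obtain v where v: "v \<in> Z" "v \<in> e" by blast
      have "e \<noteq> ?e1" using v Z(3,4) by blast
      moreover have "\<not> (e = {s, v} \<and> e = {w, v})" using sw(2) v(1) Z(3) by (auto simp: doubleton_eq_iff)
      ultimately show ?thesis unfolding z_def one[OF v Z(3)] one[OF v Z(4)] using \<eta>5[of v]
        by (auto simp: power_minus_odd)
    qed
  qed
  show ?thesis
  proof (rule frame_cell[OF finE two, of C "{}" z 1 h R c "A \<union> B"])
    show "good (off E C - isol (off E C))" using good unfolding C_def isol by simp
    show "1 = (\<Prod>e\<in>isol (off E C) \<union> {}. vertex_sum (E - off E C) z (end1 e) - vertex_sum (E - off E C) z (end2 e))"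
      unfolding C_def isol by simp
    show "1 * vertex_sum (E - off E C) z u = 1 * h u" for u
      using csz[of u] unfolding C_def EC_def by simp
    show "1 * (\<Prod>e\<in>E - off E C - {}. h (end1 e) - h (end2 e)) * R \<simeq> of_int c * mon (A \<union> B)"
      using fin unfolding C_def EC_def .
    show "finite (A \<union> B)" using finA(1) finB by simp
    have "A \<union> B \<subseteq> EC \<times> UNIV" using e1EC svEC(1) unfolding A_def B_def by auto
    then show "A \<union> B \<subseteq> (E - off E C) \<times> UNIV" unfolding EC_def C_def .
  qed (use c(1) h0 z5 in \<open>simp_all\<close>)
qed

section \<open>Independent cells\<close>

text \<open>Starting from the transposition of \<open>s\<close> and \<open>t\<close>, further
  elements are inserted into a cycle. The prescribed value at \<open>s\<close> controls both ends of
  the arc that may be dropped.\<close>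

lemma derangement_exists:
  assumes "finite M" "s \<in> M" "t \<in> M" "s \<noteq> t"
  obtains \<pi> where "\<pi> ` M = M" "inj_on \<pi> M" "\<And>x. x \<in> M \<Longrightarrow> \<pi> x \<noteq> x" "\<pi> s = t"
proof -
  have "\<exists>\<pi>. \<pi> ` ({s, t} \<union> R) = {s, t} \<union> R \<and> (\<forall>x\<in>{s, t} \<union> R. \<pi> x \<noteq> x) \<and> \<pi> s = t"
    if "finite R" "R \<inter> {s, t} = {}" for R
    using that
  proof (induction R rule: finite_induct)
    case empty
    show ?case by (rule exI[of _ "\<lambda>x. if x = s then t else s"]) (use assms(4) in auto)
  next
    case (insert x R)
    let ?M = "{s, t} \<union> R"
    obtain \<pi> where \<pi>: "\<pi> ` ?M = ?M" "\<forall>y\<in>?M. \<pi> y \<noteq> y" "\<pi> s = t" using insert.IH insert.prems by auto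
    have x: "x \<notin> ?M" using insert.hyps(2) insert.prems by auto
    have tM: "t \<in> ?M" by simp
    \<comment> \<open>Splices \<open>x\<close> into the cycle right after \<open>t\<close>, which
      leaves the value at \<open>s\<close> unchanged.\<close>
    define \<sigma> where "\<sigma> y = (if y = t then x else if y = x then \<pi> t else \<pi> y)" for y
    have "\<sigma> ` (insert x ?M) = insert x ?M"
    proof -
      have "\<sigma> ` (?M - {t}) = \<pi> ` (?M - {t})" by (rule image_cong[OF refl]) (use x in \<open>auto simp: \<sigma>_def\<close>)
      moreover have "insert x ?M = insert x (insert t (?M - {t}))" using tM by blast
      moreover have "\<sigma> x = \<pi> t" "\<sigma> t = x" using x tM by (auto simp: \<sigma>_def)
      ultimately have "\<sigma> ` (insert x ?M) = insert x (insert (\<pi> t) (\<pi> ` (?M - {t})))"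
        by (simp only: image_insert insert_commute)
      also have "insert (\<pi> t) (\<pi> ` (?M - {t})) = \<pi> ` (insert t (?M - {t}))" by (simp only: image_insert)
      also have "insert t (?M - {t}) = ?M" using tM by blast
      finally show ?thesis by (simp only: \<pi>(1))
    qed
    moreover have "\<sigma> y \<noteq> y" if "y \<in> insert x ?M" for y
    proof -
      have "\<pi> t \<noteq> x" using \<pi>(1) tM x by blast
      moreover have "t \<noteq> x" using x tM by blast
      ultimately show ?thesis using that \<pi>(2) by (auto simp: \<sigma>_def)
    qed
    moreover have "\<sigma> s = t" using x \<pi>(3) assms(4) by (auto simp: \<sigma>_def)
    moreover have "{s, t} \<union> insert x R = insert x ?M" by blast
    ultimately show ?case by (intro exI[of _ \<sigma>]) (simp only:, blast)
  qed
  from this[of "M - {s, t}"] obtain \<pi> where "\<pi> ` ({s, t} \<union> (M - {s, t})) = {s, t} \<union> (M - {s, t})"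
    "\<forall>x\<in>{s, t} \<union> (M - {s, t}). \<pi> x \<noteq> x" "\<pi> s = t" using assms(1) by blast
  moreover have "{s, t} \<union> (M - {s, t}) = M" using assms(2,3) by blast
  ultimately have \<pi>: "\<pi> ` M = M" "\<forall>x\<in>M. \<pi> x \<noteq> x" "\<pi> s = t" by (simp_all only:)
  have "inj_on \<pi> M" by (rule finite_surj_inj[OF assms(1)]) (simp only: \<pi>(1))
  then show ?thesis using that \<pi> by blast
qed

definition nbrs :: "'a set set \<Rightarrow> 'a \<Rightarrow> 'a set" where
  "nbrs E u = {v. {u, v} \<in> E}"

lemma nbrs_sym: "v \<in> nbrs E u \<longleftrightarrow> u \<in> nbrs E v"
  by (simp add: nbrs_def insert_commute)

lemma finite_nbrs:
  assumes "finite E" "\<And>e. e \<in> E \<Longrightarrow> card e = 2"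
  shows "finite (nbrs E u)"
proof -
  have "nbrs E u \<subseteq> \<Union>E" by (auto simp: nbrs_def)
  moreover have "finite (\<Union>E)" using assms by (intro finite_Union) (metis card.infinite zero_neq_numeral)+
  ultimately show ?thesis by (rule finite_subset)
qed

lemma nbrs_irrefl: "(\<And>e. e \<in> E \<Longrightarrow> card e = 2) \<Longrightarrow> u \<notin> nbrs E u"
  unfolding nbrs_def by fastforce

lemma edges_at_eq:
  assumes two: "\<And>e. e \<in> E \<Longrightarrow> card e = 2"
  shows "{e\<in>E. u \<in> e} = (\<lambda>v. {u, v}) ` nbrs E u"
proof (intro equalityI subsetI)
  fix e assume "e \<in> {e\<in>E. u \<in> e}"
  then have e: "e \<in> E" "u \<in> e" by blast+
  note m = end1_end2_iff[OF two[OF e(1)]] end1_end2_mem[OF two[OF e(1)]]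
  obtain v where "v \<in> e" "u \<noteq> v" using m(2-4) by metis
  then have "e = {u, v}" by (intro two_element_eq two e)
  then show "e \<in> (\<lambda>v. {u, v}) ` nbrs E u" using e(1) by (auto simp: nbrs_def)
qed (auto simp: nbrs_def)

lemma card_edges_at:
  assumes "\<And>e. e \<in> E \<Longrightarrow> card e = 2"
  shows "card {e\<in>E. u \<in> e} = card (nbrs E u)"
proof -
  have "inj_on (\<lambda>v. {u, v}) (nbrs E u)" by (auto simp: inj_on_def doubleton_eq_iff)
  then show ?thesis by (simp add: edges_at_eq[OF assms] card_image)
qed

text \<open>At an outside vertex \<open>w\<close> with at least two neighbours in \<open>C\<close> the arcs are given by a derangement of these neighbours; at \<open>a \<in> A\<close> the arc from \<open>sf a\<close> to \<open>tf a\<close> is dropped so that the edge to \<open>sf a\<close> can carry a token.\<close>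
lemma indep_cell_perm:
  fixes E :: "'a set set" and C :: "'a set"
  defines "X \<equiv> isol (off E C)"
  assumes finE: "finite E" and two: "\<And>e. e \<in> E \<Longrightarrow> card e = 2"
    and independent: "\<And>e. e \<in> E \<Longrightarrow> \<not> e \<subseteq> C"
    and good: "good (off E C - X)"
    and sf: "\<And>a. a \<in> A \<Longrightarrow> a \<notin> C \<and> sf a \<in> nbrs E a \<inter> C \<and> tf a \<in> nbrs E a \<inter> C \<and> sf a \<noteq> tf a"
    and tok: "\<And>x. x \<in> X \<Longrightarrow> \<exists>u\<in>x. \<exists>c\<in>C. {u, c} \<in> E \<and> (card (nbrs E u \<inter> C) = 1 \<or> u \<in> A \<and> c = sf u)"
    and deg: "\<And>s. s \<in> C \<Longrightarrow> card (nbrs E s)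
       \<le> card {w\<in>nbrs E s. card (nbrs E w \<inter> C) \<ge> 2 \<and> \<not> (w \<in> A \<and> sf w = s)}
       + card {w\<in>nbrs E s. card (nbrs E w \<inter> C) \<ge> 2 \<and> \<not> (w \<in> A \<and> tf w = s)}"
  shows "good E"
proof -
  let ?N = "nbrs E"
  define M where "M w = ?N w \<inter> C" for w
  have finN: "finite (?N w)" for w using finite_nbrs[OF finE two] .
  have finM: "finite (M w)" for w using finN unfolding M_def by blast
  have "\<exists>\<pi>. card (M w) \<ge> 2 \<longrightarrow> \<pi> ` M w = M w \<and> inj_on \<pi> (M w) \<and> (\<forall>x\<in>M w. \<pi> x \<noteq> x) \<and> (w \<in> A \<longrightarrow> \<pi> (sf w) = tf w)" for w
  proof (cases "card (M w) \<ge> 2")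
    case True
    have "\<exists>s t. s \<in> M w \<and> t \<in> M w \<and> s \<noteq> t \<and> (w \<in> A \<longrightarrow> s = sf w \<and> t = tf w)"
    proof (cases "w \<in> A")
      case True
      then show ?thesis using sf[OF True] unfolding M_def by blast
    next
      case False
      have "\<not> (\<forall>s\<in>M w. \<forall>t\<in>M w. s = t)" using True card_le_Suc0_iff_eq[OF finM, of w] by linarith
      then show ?thesis using False by blast
    qed
    then obtain s t where st: "s \<in> M w" "t \<in> M w" "s \<noteq> t" "w \<in> A \<longrightarrow> s = sf w \<and> t = tf w" by blast
    obtain \<pi> where "\<pi> ` M w = M w" "inj_on \<pi> (M w)" "\<And>x. x \<in> M w \<Longrightarrow> \<pi> x \<noteq> x" "\<pi> s = t"
      using derangement_exists[OF finM st(1-3)] by metis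
    then show ?thesis using st(4) by metis
  qed blast
  then obtain \<pi> where \<pi>: "\<And>w. card (M w) \<ge> 2 \<Longrightarrow> \<pi> w ` M w = M w \<and> inj_on (\<pi> w) (M w) \<and> (\<forall>x\<in>M w. \<pi> w x \<noteq> x) \<and> (w \<in> A \<longrightarrow> \<pi> w (sf w) = tf w)"
    by metis
  \<comment> \<open>The arc of \<open>P w c\<close> runs from \<open>c\<close> to
    \<open>\<pi> w c\<close> and is represented by the edge \<open>{w, c}\<close>; the excluded one
    at \<open>w\<close> in \<open>A\<close> runs from \<open>sf w\<close> to
    \<open>tf w\<close>.\<close>
  define P where "P w c \<longleftrightarrow> w \<notin> C \<and> c \<in> M w \<and> card (M w) \<ge> 2 \<and> \<not> (w \<in> A \<and> c = sf w)" for w c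
  define F where "F = {e. \<exists>w c. e = {w, c} \<and> P w c}"
  \<comment> \<open>\<open>cO\<close> and \<open>wO\<close> recover the inner and the outer end from
    a cell edge, so that \<open>\<rho>\<close> can be defined on edges.\<close>
  define cO where "cO e = (SOME c. c \<in> e \<and> c \<in> C)" for e :: "'a set"
  define wO where "wO e = (SOME c. c \<in> e \<and> c \<notin> C)" for e :: "'a set"
  have cO: "cO {w, c} = c" and wO: "wO {w, c} = w" if "w \<notin> C" "c \<in> C" for w c
  proof -
    show "cO {w, c} = c" unfolding cO_def by (rule some_equality) (use that in auto)
    show "wO {w, c} = w" unfolding wO_def by (rule some_equality) (use that in auto)
  qed
  define \<rho> where "\<rho> e = {wO e, \<pi> (wO e) (cO e)}" for e
  have PC: "w \<notin> C" "c \<in> C" "{w, c} \<in> E" if "P w c" for w c using that unfolding P_def M_def nbrs_def by blast+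
  have \<rho>: "\<rho> {w, c} = {w, \<pi> w c}" if "P w c" for w c
    unfolding \<rho>_def by (simp add: cO[OF PC(1,2)[OF that]] wO[OF PC(1,2)[OF that]])
  have P\<pi>: "\<pi> w c \<in> M w" "\<pi> w c \<noteq> c" if "P w c" for w c
  proof -
    have "card (M w) \<ge> 2" "c \<in> M w" using that unfolding P_def by blast+
    then show "\<pi> w c \<in> M w" "\<pi> w c \<noteq> c" using \<pi>[of w] by blast+
  qed
  have pair_eq: "w = w' \<and> c = c'" if "{w, c} = {w', c'}" "w \<notin> C" "c \<in> C" "w' \<notin> C" "c' \<in> C" for w c w' c'
    using that by (auto simp: doubleton_eq_iff)
  have \<pi>C: "\<pi> w c \<in> C" if "P w c" for w c using P\<pi>(1)[OF that] unfolding M_def by blast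
  have inC: "s \<in> {w, c} \<longleftrightarrow> s = c" if "w \<notin> C" "s \<in> C" for s w c :: 'a using that by auto
  have nbr_notC: "w \<notin> C" if "s \<in> C" "w \<in> ?N s" for s w
    using independent[of "{s, w}"] that unfolding nbrs_def by auto
  have N_M: "s \<in> M w" if "s \<in> C" "w \<in> ?N s" for s w
    using that nbrs_sym[of w E s] unfolding M_def by blast
  have "\<forall>x\<in>X. \<exists>e. e \<in> E \<and> (\<exists>u\<in>x. \<exists>c\<in>C. e = {u, c} \<and> (card (M u) = 1 \<or> u \<in> A \<and> c = sf u))"
  proof
    fix x assume "x \<in> X"
    then obtain u c where "u \<in> x" "c \<in> C" "{u, c} \<in> E" "card (?N u \<inter> C) = 1 \<or> u \<in> A \<and> c = sf u"
      using tok by blast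
    then show "\<exists>e. e \<in> E \<and> (\<exists>u\<in>x. \<exists>c\<in>C. e = {u, c} \<and> (card (M u) = 1 \<or> u \<in> A \<and> c = sf u))"
      unfolding M_def by (intro exI[of _ "{u, c}"] conjI bexI[of _ u] bexI[of _ c] refl)
  qed
  then obtain tk where tk: "\<And>x. x \<in> X \<Longrightarrow> tk x \<in> E \<and> (\<exists>u\<in>x. \<exists>c\<in>C. tk x = {u, c} \<and> (card (M u) = 1 \<or> u \<in> A \<and> c = sf u))"
    by metis
  have finI: "finite {f\<in>F. Q f}" for Q
  proof -
    have FE: "F \<subseteq> E" using PC(3) unfolding F_def by blast
    show ?thesis by (rule finite_subset[OF _ finE]) (use FE in blast)
  qed
  show ?thesis
  proof (rule indep_cell[OF finE two, of C tk F \<rho>])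
    show "\<not> e \<subseteq> C" if "e \<in> E" for e using independent[OF that] .
    show "good (off E C - isol (off E C))" using good unfolding X_def .
    show "tk x \<in> E \<and> (\<exists>u\<in>x. \<exists>c\<in>C. tk x = {u, c})" if "x \<in> isol (off E C)" for x
      using tk[of x] that unfolding X_def by blast
    show "F \<subseteq> E - off E C"
    proof
      fix e assume "e \<in> F"
      then obtain w c where e: "e = {w, c}" "P w c" unfolding F_def by blast
      then show "e \<in> E - off E C" using PC[OF e(2)] unfolding off_def by blast
    qed
    show "F \<inter> tk ` isol (off E C) = {}"
    proof (rule ccontr)
      assume "F \<inter> tk ` isol (off E C) \<noteq> {}"
      then obtain x where x: "x \<in> X" "tk x \<in> F" unfolding X_def by blast
      obtain w c where e: "tk x = {w, c}" "P w c" using x(2) unfolding F_def by blast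
      obtain u d where u: "u \<in> x" "d \<in> C" "tk x = {u, d}" "card (M u) = 1 \<or> u \<in> A \<and> d = sf u" using tk[OF x(1)] by blast
      have "u \<notin> C" using iso_off_C[of x E C u] x(1) u(1) unfolding X_def by blast
      then have "w = u \<and> c = d" using pair_eq[of w c u d] e(1) u(2,3) PC[OF e(2)] by metis
      then show False using e(2) u(4) unfolding P_def by auto
    qed
    show "inj_on \<rho> F"
    proof (rule inj_onI)
      fix e e' assume "e \<in> F" "e' \<in> F" and eq: "\<rho> e = \<rho> e'"
      obtain w c where e: "e = {w, c}" "P w c" using \<open>e \<in> F\<close> unfolding F_def by blast
      obtain w' c' where e': "e' = {w', c'}" "P w' c'" using \<open>e' \<in> F\<close> unfolding F_def by blast
      have "{w, \<pi> w c} = {w', \<pi> w' c'}" using eq unfolding e(1) e'(1) \<rho>[OF e(2)] \<rho>[OF e'(2)] .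
      then have 1: "w = w' \<and> \<pi> w c = \<pi> w' c'" using pair_eq PC(1)[OF e(2)] PC(1)[OF e'(2)] \<pi>C[OF e(2)] \<pi>C[OF e'(2)] by metis
      have "card (M w) \<ge> 2" "c \<in> M w" "c' \<in> M w" using e(2) e'(2) 1 unfolding P_def by auto
      then have "c = c'" using \<pi>[of w] 1 unfolding inj_on_def by metis
      then show "e = e'" using 1 e(1) e'(1) by simp
    qed
    show "\<rho> f \<in> E - off E C \<and> \<rho> f \<noteq> f \<and> \<rho> f - C = f - C" if f: "f \<in> F" for f
    proof -
      obtain w c where e: "f = {w, c}" "P w c" using f unfolding F_def by blast
      have "{w, \<pi> w c} \<in> E" using P\<pi>(1)[OF e(2)] unfolding M_def nbrs_def by blast
      moreover have "{w, \<pi> w c} \<notin> off E C" using \<pi>C[OF e(2)] unfolding off_def by blast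
      moreover have "{w, \<pi> w c} \<noteq> {w, c}" using P\<pi>(2)[OF e(2)] by (simp add: doubleton_eq_iff) blast
      moreover have "{w, \<pi> w c} - C = {w, c} - C" using PC(1,2)[OF e(2)] \<pi>C[OF e(2)] by auto
      ultimately show ?thesis unfolding e(1) \<rho>[OF e(2)] by blast
    qed
    show "card {e\<in>E. s \<in> e} \<le> card {f\<in>F. s \<in> f} + card {f\<in>F. s \<in> \<rho> f}" if s: "s \<in> C" for s
    proof -
      let ?W1 = "{w\<in>?N s. card (?N w \<inter> C) \<ge> 2 \<and> \<not> (w \<in> A \<and> sf w = s)}"
      let ?W2 = "{w\<in>?N s. card (?N w \<inter> C) \<ge> 2 \<and> \<not> (w \<in> A \<and> tf w = s)}"
      have "card ?W1 \<le> card {f\<in>F. s \<in> f}"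
      proof (rule card_inj_on_le[OF _ _ finI])
        show "inj_on (\<lambda>w. {w, s}) ?W1" by (auto simp: inj_on_def doubleton_eq_iff)
        show "(\<lambda>w. {w, s}) ` ?W1 \<subseteq> {f\<in>F. s \<in> f}"
        proof (rule image_subsetI)
          fix w assume w: "w \<in> ?W1"
          have "P w s" unfolding P_def using w nbr_notC[OF s] N_M[OF s] unfolding M_def by blast
          then show "{w, s} \<in> {f\<in>F. s \<in> f}" unfolding F_def by blast
        qed
      qed
      moreover have "card ?W2 \<le> card {f\<in>F. s \<in> \<rho> f}"
      proof -
        \<comment> \<open>\<open>s\<close> has a preimage under the permutation at \<open>w\<close>.
          Its arc was not dropped, since the dropped arc at \<open>w\<close> ends in
          \<open>tf w\<close>, which is not \<open>s\<close>.\<close>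
        have "\<forall>w\<in>?W2. \<exists>c. P w c \<and> \<pi> w c = s"
        proof
          fix w assume w: "w \<in> ?W2"
          have cM: "card (M w) \<ge> 2" "s \<in> M w" "w \<notin> C" using w nbr_notC[OF s] N_M[OF s] unfolding M_def by blast+
          then obtain c where c: "c \<in> M w" "\<pi> w c = s" using \<pi>[OF cM(1)] by (metis imageE)
          have "\<not> (w \<in> A \<and> tf w = s)" using w by blast
          then have "\<not> (w \<in> A \<and> c = sf w)" using \<pi>[OF cM(1)] c(2) by metis
          then show "\<exists>c. P w c \<and> \<pi> w c = s" using c cM unfolding P_def by blast
        qed
        from bchoice[OF this] obtain g where g': "\<forall>w\<in>?W2. P w (g w) \<and> \<pi> w (g w) = s" ..
        have g: "P w (g w) \<and> \<pi> w (g w) = s" if "w \<in> ?W2" for w using g' that by (rule bspec)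
        show ?thesis
        proof (rule card_inj_on_le[OF _ _ finI])
          show "inj_on (\<lambda>w. {w, g w}) ?W2"
          proof (rule inj_onI)
            fix w w' assume w: "w \<in> ?W2" "w' \<in> ?W2" "{w, g w} = {w', g w'}"
            then show "w = w'" using pair_eq[OF w(3)] PC(1,2) g by blast
          qed
          show "(\<lambda>w. {w, g w}) ` ?W2 \<subseteq> {f\<in>F. s \<in> \<rho> f}"
          proof (rule image_subsetI)
            fix w assume w: "w \<in> ?W2"
            have "{w, g w} \<in> F" using g[OF w] unfolding F_def by blast
            moreover have "s \<in> \<rho> {w, g w}" using g[OF w] \<rho>[of w "g w"] by simp
            ultimately show "{w, g w} \<in> {f\<in>F. s \<in> \<rho> f}" by blast
          qed
        qed
      qed
      moreover have "card {e\<in>E. s \<in> e} = card (?N s)" using two by (rule card_edges_at)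
      ultimately show ?thesis using deg[OF s] by linarith
    qed
  qed
qed

section \<open>Choosing the cell\<close>

definition independent :: "'a set set \<Rightarrow> 'a set \<Rightarrow> bool" where
  "independent E S \<longleftrightarrow> (\<forall>u\<in>S. \<forall>v\<in>S. {u, v} \<notin> E)"

lemma indep_not_subset:
  assumes "independent E S" "e \<in> E" "card e = 2"
  shows "\<not> e \<subseteq> S"
proof
  assume "e \<subseteq> S"
  then have "end1 e \<in> S" "end2 e \<in> S" using end1_end2_mem[OF assms(3)] by blast+
  moreover have "{end1 e, end2 e} \<in> E" using end1_end2[OF assms(3)] assms(2) by simp
  ultimately show False using assms(1) unfolding independent_def by blast
qed

text \<open>\<open>S\<close> has maximum size and, among such sets, maximum degree sum. Exchanging
  \<open>s\<close> for a vertex whose only neighbour in \<open>S\<close> is \<open>s\<close> cannot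
  raise the degree sum; exchanging it for two nonadjacent such vertices would raise the
  size.\<close>

lemma maximal_indep:
  fixes E :: "'a set set"
  assumes finE: "finite E" and two: "\<And>e. e \<in> E \<Longrightarrow> card e = 2"
  obtains S where "S \<subseteq> \<Union>E" "independent E S" "\<And>v. v \<in> \<Union>E \<Longrightarrow> v \<notin> S \<Longrightarrow> nbrs E v \<inter> S \<noteq> {}"
    "\<And>s w. nbrs E w \<inter> S = {s} \<Longrightarrow> card (nbrs E w) \<le> card (nbrs E s)"
    "\<And>s w w'. nbrs E w \<inter> S = {s} \<Longrightarrow> nbrs E w' \<inter> S = {s} \<Longrightarrow> w \<noteq> w' \<Longrightarrow> {w, w'} \<in> E"
proof -
  let ?N = "nbrs E"
  define V where "V = \<Union>E"
  have finV: "finite V" unfolding V_def using finE two by (intro finite_Union) (metis card.infinite zero_neq_numeral)+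
  define I where "I = {S. S \<subseteq> V \<and> independent E S}"
  define dg where "dg S = (\<Sum>s\<in>S. card (?N s))" for S
  \<comment> \<open>Lexicographic order in one number: the degree sum of a subset of
    \<open>V\<close> is below \<open>Suc (dg V)\<close>.\<close>
  define f where "f S = card S * Suc (dg V) + dg S" for S
  have finI: "finite I" unfolding I_def using finV by simp
  have "{} \<in> I" by (simp add: I_def independent_def)
  then have "Max (f ` I) \<in> f ` I" using finI by (intro Max_in) auto
  then obtain S where S: "S \<in> I" "f S = Max (f ` I)" by auto
  have max: "f T \<le> f S" if "T \<in> I" for T using that finI by (simp add: S(2))
  have finT: "finite T" if "T \<in> I" for T using that finV finite_subset unfolding I_def by blast
  have max_card: "card T \<le> card S" if T: "T \<in> I" for T
  proof (rule ccontr)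
    assume "\<not> card T \<le> card S"
    then have "Suc (card S) * Suc (dg V) \<le> card T * Suc (dg V)" by (intro mult_le_mono1) simp
    moreover have "dg S \<le> dg V" unfolding dg_def using S(1) finV by (intro sum_mono2) (auto simp: I_def)
    ultimately show False using max[OF T] unfolding f_def by simp
  qed
  have max_dg: "dg T \<le> dg S" if "T \<in> I" "card T = card S" for T
    using max[OF that(1)] that(2) unfolding f_def by simp
  have SV: "S \<subseteq> V" "independent E S" using S(1) unfolding I_def by blast+
  have finS: "finite S" using finT S(1) by blast
  have NV: "v \<in> V" if "v \<in> ?N u" for u v using that unfolding V_def nbrs_def by blast
  have irr: "u \<notin> ?N u" for u using nbrs_irrefl two by metis
  have sym: "{u, v} \<in> E \<longleftrightarrow> {v, u} \<in> E" for u v by (simp add: insert_commute)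
  have notS: "w \<notin> S" if "?N w \<inter> S = {s}" for w s
  proof
    assume "w \<in> S"
    moreover have "s \<in> S" "{w, s} \<in> E" using that unfolding nbrs_def by blast+
    ultimately show False using SV(2) unfolding independent_def by blast
  qed
  have inV: "w \<in> V" if "?N w \<inter> S = {s}" for w s
  proof -
    have "s \<in> ?N w" using that by blast
    then show ?thesis using NV nbrs_sym by metis
  qed
  show ?thesis
  proof (rule that)
    show "S \<subseteq> \<Union>E" using SV(1) unfolding V_def .
    show "independent E S" by (rule SV(2))
    show "?N v \<inter> S \<noteq> {}" if v: "v \<in> \<Union>E" "v \<notin> S" for v
    proof
      assume empty: "?N v \<inter> S = {}"
      have "{v, u} \<notin> E" if "u \<in> insert v S" for u
        using that empty irr[of v] unfolding nbrs_def by blast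
      then have "independent E (insert v S)" using SV(2) sym unfolding independent_def by (metis insert_iff)
      then have "insert v S \<in> I" using SV(1) v(1) unfolding I_def V_def by blast
      from max_card[OF this] show False using v(2) finS by simp
    qed
    show "card (?N w) \<le> card (?N s)" if w: "?N w \<inter> S = {s}" for s w
    proof -
      let ?T = "insert w (S - {s})"
      have sS: "s \<in> S" using w by blast
      have "{w, u} \<notin> E" if "u \<in> ?T" for u using that w irr[of w] unfolding nbrs_def by blast
      moreover have "independent E (S - {s})" using SV(2) unfolding independent_def by blast
      ultimately have "independent E ?T" using sym unfolding independent_def by (metis insert_iff)
      then have T: "?T \<in> I" using SV(1) inV[OF w] unfolding I_def by blast
      have wT: "w \<notin> S - {s}" using notS[OF w] by blast
      have "card ?T = card S" using wT by (simp only: card_insert_disjoint finite_Diff finS card_Suc_Diff1[OF finS sS] simp_thms)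
      from max_dg[OF T this] have "card (?N w) + dg (S - {s}) \<le> card (?N s) + dg (S - {s})"
        unfolding dg_def using wT finS sS by (simp add: sum.remove)
      then show ?thesis by simp
    qed
    show "{w, w'} \<in> E" if w: "?N w \<inter> S = {s}" and w': "?N w' \<inter> S = {s}" and ne: "w \<noteq> w'" for s w w'
    proof (rule ccontr)
      assume no: "{w, w'} \<notin> E"
      let ?T = "insert w (insert w' (S - {s}))"
      have sS: "s \<in> S" using w by blast
      have 1: "{w, u} \<notin> E" if "u \<in> ?T" for u using that w no irr[of w] unfolding nbrs_def by blast
      have 2: "{w', u} \<notin> E" if "u \<in> ?T" for u using that w' no sym[of w w'] irr[of w'] unfolding nbrs_def by blast
      have "independent E (S - {s})" using SV(2) unfolding independent_def by blast
      then have "independent E ?T" using 1 2 sym unfolding independent_def by (metis insert_iff)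
      then have T: "?T \<in> I" using SV(1) inV[OF w] inV[OF w'] unfolding I_def by blast
      have "w \<notin> insert w' (S - {s})" "w' \<notin> S - {s}" using notS[OF w] notS[OF w'] ne by blast+
      then have "card ?T = Suc (card S)"
        by (simp only: card_insert_disjoint finite_insert finite_Diff finS card_Suc_Diff1[OF finS sS] simp_thms)
      then show False using max_card[OF T] by simp
    qed
  qed
qed

text \<open>Any further edge at \<open>u\<close> avoiding \<open>C\<close> would meet
  \<open>x\<close>, against its isolation.\<close>

lemma iso_nbrs:
  assumes two: "\<And>e. e \<in> E \<Longrightarrow> card e = 2" and x: "x \<in> isol (off E C)" "u \<in> x"
  obtains v where "x = {u, v}" "v \<in> x" "u \<noteq> v" "{u, v} \<in> E" "u \<notin> C" "v \<notin> C" "nbrs E u \<subseteq> insert v C"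
proof -
  have xE: "x \<in> E" using x(1) unfolding isol_def off_def by blast
  note m = end1_end2_iff[OF two[OF xE]] end1_end2_mem[OF two[OF xE]]
  obtain v where v: "v \<in> x" "u \<noteq> v" using m(2-4) by metis
  have xv: "x = {u, v}" by (rule two_element_eq[OF two[OF xE] x(2) v])
  have nC: "u \<notin> C" "v \<notin> C" using iso_off_C[OF x(1)] x(2) v(1) by blast+
  have "r \<in> insert v C" if "r \<in> nbrs E u" for r
  proof (rule ccontr)
    assume r: "r \<notin> insert v C"
    have "{u, r} \<in> off E C" using that r nC unfolding off_def nbrs_def by blast
    moreover have "{u, r} \<inter> x \<noteq> {}" using x(2) by blast
    moreover have "\<forall>e\<in>off E C. e \<noteq> x \<longrightarrow> x \<inter> e = {}" using x(1) unfolding isol_def by blast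
    ultimately have "{u, r} = x" by (metis Int_commute)
    then have "r \<in> {u, v}" using xv by blast
    then have "r = u" using r by blast
    then show False using that nbrs_irrefl[of E u] two by metis
  qed
  then have "nbrs E u \<subseteq> insert v C" by blast
  then show ?thesis using that xv v nC xE by metis
qed

text \<open>At least half of the neighbours of \<open>s\<close> are private to \<open>s\<close>, and
  with \<open>s\<close> they form a clique. For a private \<open>w\<close>, the other private ones
  are common neighbours of \<open>s\<close> and \<open>w\<close>, numerous enough for
  \<open>pair_cell\<close>, as the degree of \<open>w\<close> is at most that of \<open>s\<close>.
  An edge isolated by removing \<open>s\<close> and \<open>w\<close> would have ends of degree at
  most 3, against the bound 7.\<close>

lemma case_pair:
  fixes E :: "'a set set"
  assumes finE: "finite E" and two: "\<And>e. e \<in> E \<Longrightarrow> card e = 2"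
    and big: "\<And>u v. {u, v} \<in> E \<Longrightarrow> 7 \<le> card (nbrs E u) + card (nbrs E v)"
    and good_off: "\<And>C. \<exists>e\<in>E. e \<inter> C \<noteq> {} \<Longrightarrow> good (off E C - isol (off E C))"
    and independent: "independent E S"
    and swap: "\<And>s w. nbrs E w \<inter> S = {s} \<Longrightarrow> card (nbrs E w) \<le> card (nbrs E s)"
    and clique: "\<And>s w w'. nbrs E w \<inter> S = {s} \<Longrightarrow> nbrs E w' \<inter> S = {s} \<Longrightarrow> w \<noteq> w' \<Longrightarrow> {w, w'} \<in> E"
    and s: "s \<in> S" "s \<in> \<Union>E" "2 * card {w\<in>nbrs E s. 2 \<le> card (nbrs E w \<inter> S)} \<le> card (nbrs E s)"
  shows "good E"
proof -
  let ?N = "nbrs E"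
  have finN: "finite (?N u)" for u using finite_nbrs finE two by metis
  define P where "P = {w\<in>?N s. ?N w \<inter> S = {s}}"
  have finP: "finite P" unfolding P_def using finN by simp
  have Ns: "?N s = P \<union> {w\<in>?N s. 2 \<le> card (?N w \<inter> S)}"
  proof -
    have "2 \<le> card (?N w \<inter> S)" if w: "w \<in> ?N s" "?N w \<inter> S \<noteq> {s}" for w
    proof -
      have "s \<in> ?N w \<inter> S" using w(1) s(1) by (simp add: nbrs_sym[of s E w])
      then obtain t where "t \<in> ?N w \<inter> S" "t \<noteq> s" using w(2) by blast
      then have "card {s, t} \<le> card (?N w \<inter> S)" using \<open>s \<in> ?N w \<inter> S\<close> finN by (intro card_mono) auto
      then show ?thesis using \<open>t \<noteq> s\<close> by simp
    qed
    then show ?thesis unfolding P_def by blast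
  qed
  have "card (?N s) \<le> card P + card {w\<in>?N s. 2 \<le> card (?N w \<inter> S)}"
    using card_Un_le[of P "{w\<in>?N s. 2 \<le> card (?N w \<inter> S)}"] by (simp only: Ns[symmetric])
  then have ds: "card (?N s) \<le> 2 * card P" using s(3) by linarith
  obtain e where "e \<in> E" "s \<in> e" using s(2) by blast
  then have "{e\<in>E. s \<in> e} \<noteq> {}" by blast
  then have "?N s \<noteq> {}" using edges_at_eq[of E s] two by (metis image_empty)
  then have "card (?N s) > 0" using finN by (simp add: card_gt_0_iff)
  then have "P \<noteq> {}" using ds by auto
  then obtain w where w: "w \<in> P" by blast
  have sw: "{s, w} \<in> E" "?N w \<inter> S = {s}" using w unfolding P_def nbrs_def by blast+
  have dw: "card (?N w) \<le> card (?N s)" using swap[OF sw(2)] .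
  have ne: "s \<noteq> w" using nbrs_irrefl[of E s] two sw(1) unfolding nbrs_def by blast
  define Z where "Z = P - {w}"
  have cZ: "Suc (card Z) = card P" unfolding Z_def using w finP by (rule card_Suc_Diff1[OF _ _, rotated])
  have Z: "{s, v} \<in> E" "{w, v} \<in> E" if "v \<in> Z" for v
  proof -
    have v: "v \<in> ?N s" "?N v \<inter> S = {s}" "w \<noteq> v" using that unfolding Z_def P_def by blast+
    show "{s, v} \<in> E" using v(1) unfolding nbrs_def by blast
    show "{w, v} \<in> E" using clique[OF sw(2) v(2,3)] .
  qed
  have X: "isol (off E {s, w}) = {}"
  proof (rule ccontr)
    assume "isol (off E {s, w}) \<noteq> {}"
    then obtain x where x: "x \<in> isol (off E {s, w})" by blast
    have "x \<in> E" using x unfolding isol_def off_def by blast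
    then have "end1 x \<in> x" using end1_end2_mem two by metis
    obtain v where v: "x = {end1 x, v}" "v \<in> x" "{end1 x, v} \<in> E" "?N (end1 x) \<subseteq> insert v {s, w}"
      using iso_nbrs[OF two x \<open>end1 x \<in> x\<close>] by metis
    obtain u where u: "?N v \<subseteq> insert u {s, w}"
      using iso_nbrs[OF two x v(2)] by metis
    have c3: "card (insert r {s, w}) \<le> 3" for r using card_insert_le_m1[of 3 "{s, w}" r] card_insert_le_m1[of 2 "{w}" s] by simp
    have "card (?N (end1 x)) \<le> 3" using card_mono[OF _ v(4)] c3[of v] by simp
    moreover have "card (?N v) \<le> 3" using card_mono[OF _ u] c3[of u] by simp
    ultimately show False using big[OF v(3)] by linarith
  qed
  \<comment> \<open>A single private neighbour would leave both \<open>s\<close> and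
    \<open>w\<close> with degree at most 2, against the bound 7.\<close>
  have "Z \<noteq> {}"
  proof
    assume "Z = {}"
    then have "card P = 1" using cZ by simp
    then show False using big[OF sw(1)] ds dw by linarith
  qed
  show ?thesis
  proof (rule pair_cell[OF finE two sw(1) ne, of Z])
    show "finite Z" using finP unfolding Z_def by simp
    show "s \<notin> Z" using Z(1)[of s] nbrs_irrefl[of E s] two unfolding nbrs_def by blast
    show "w \<notin> Z" unfolding Z_def by blast
    show "card {e\<in>E. s \<in> e} \<le> 2 * Suc (card Z)" using card_edges_at[of E s] two ds by (simp add: cZ)
    show "card {e\<in>E. w \<in> e} \<le> 2 * Suc (card Z)" using card_edges_at[of E w] two ds dw by (simp add: cZ)
    have "good (off E {s, w} - isol (off E {s, w}))" by (intro good_off bexI[OF _ sw(1)]) simp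
    then show "good (off E {s, w})" unfolding X by simp
    show "isol (off E {s, w}) = {}" by (rule X)
  qed (use Z \<open>Z \<noteq> {}\<close> in blast)+
qed

text \<open>The degree condition that makes an independent set of vertices usable as a cell without tokens.\<close>
definition valid :: "'a set set \<Rightarrow> 'a set \<Rightarrow> bool" where
  "valid E B \<longleftrightarrow> (\<forall>a\<in>B. card (nbrs E a) \<le> 2 * card {s\<in>nbrs E a. \<exists>b\<in>B. b \<noteq> a \<and> s \<in> nbrs E b})"

text \<open>The cell is the largest valid set \<open>A\<close> made of vertices of \<open>A0\<close>
  and of leaves outside \<open>S\<close>. An edge isolated by removing \<open>A\<close> would
  consist of a vertex \<open>p\<close> of \<open>S\<close> adjacent to \<open>A\<close> and a leaf
  \<open>q\<close> at \<open>p\<close>; the leaf could join \<open>A\<close>, so there is none and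
  no token is required.\<close>

lemma case_valid:
  fixes E :: "'a set set"
  assumes finE: "finite E" and two: "\<And>e. e \<in> E \<Longrightarrow> card e = 2" and nice: "nice_edges E"
    and good_off: "\<And>C. \<exists>e\<in>E. e \<inter> C \<noteq> {} \<Longrightarrow> good (off E C - isol (off E C))"
    and indepS: "independent E S"
    and dom: "\<And>v. v \<in> \<Union>E \<Longrightarrow> v \<notin> S \<Longrightarrow> nbrs E v \<inter> S \<noteq> {}"
    and A0: "A0 \<subseteq> \<Union>E" "\<And>a. a \<in> A0 \<Longrightarrow> a \<notin> S"
      "\<And>a p. a \<in> A0 \<Longrightarrow> p \<in> nbrs E a \<Longrightarrow> p \<in> S \<or> 2 \<le> card (nbrs E p \<inter> S)"
      "\<And>a b. a \<in> A0 \<Longrightarrow> b \<in> A0 \<Longrightarrow> b \<notin> nbrs E a"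
    and B: "B \<subseteq> A0" "B \<noteq> {}" "valid E B"
  shows "good E"
proof -
  let ?N = "nbrs E"
  have finN: "finite (?N u)" for u using finite_nbrs finE two by metis
  define Lv where "Lv = {v\<in>\<Union>E. v \<notin> S \<and> card (?N v) = 1}"
  \<comment> \<open>The validity condition at a vertex is monotone in the set, so the union of valid
    sets is valid.\<close>
  define A where "A = \<Union>{B. B \<subseteq> A0 \<union> Lv \<and> valid E B}"
  have Lv: "?N v \<subseteq> S" if v: "v \<in> Lv" for v
  proof -
    have "card (?N v) = 1" using v unfolding Lv_def by blast
    then obtain r where "?N v = {r}" by (rule card_1_singletonE)
    moreover have "?N v \<inter> S \<noteq> {}" using v dom unfolding Lv_def by blast
    ultimately show ?thesis by auto
  qed
  have valid_mono: "card (?N a) \<le> 2 * card {s\<in>?N a. \<exists>b\<in>A'. b \<noteq> a \<and> s \<in> ?N b}"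
    if "valid E B'" "a \<in> B'" "B' \<subseteq> A'" for a A' B'
  proof -
    have "card {s\<in>?N a. \<exists>b\<in>B'. b \<noteq> a \<and> s \<in> ?N b} \<le> card {s\<in>?N a. \<exists>b\<in>A'. b \<noteq> a \<and> s \<in> ?N b}"
      by (rule card_mono) (use finN that(3) in auto)
    moreover have "card (?N a) \<le> 2 * card {s\<in>?N a. \<exists>b\<in>B'. b \<noteq> a \<and> s \<in> ?N b}"
      using that(1,2) unfolding valid_def by blast
    ultimately show ?thesis by linarith
  qed
  have sub_A: "B' \<subseteq> A" if "B' \<subseteq> A0 \<union> Lv" "valid E B'" for B' using that unfolding A_def by blast
  have A_sub: "A \<subseteq> A0 \<union> Lv" unfolding A_def by blast
  have validA: "valid E A" unfolding valid_def
  proof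
    fix a assume "a \<in> A"
    then obtain B' where B': "B' \<subseteq> A0 \<union> Lv" "valid E B'" "a \<in> B'" unfolding A_def by blast
    show "card (?N a) \<le> 2 * card {s\<in>?N a. \<exists>b\<in>A. b \<noteq> a \<and> s \<in> ?N b}"
      by (rule valid_mono[OF B'(2,3) sub_A[OF B'(1,2)]])
  qed
  have AS: "a \<notin> S" if "a \<in> A" for a using that A_sub A0(2) unfolding Lv_def by blast
  have NA: "p \<in> S \<or> 2 \<le> card (?N p \<inter> S)" if "a \<in> A" "p \<in> ?N a" for a p
    using that A_sub A0(3) Lv by blast
  have indepA: "independent E A" unfolding independent_def
  proof (intro ballI notI)
    fix a b assume ab: "a \<in> A" "b \<in> A" "{a, b} \<in> E"
    then have n: "b \<in> ?N a" "a \<in> ?N b" using nbrs_sym[of b E a] unfolding nbrs_def by blast+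
    have "\<not> (a \<in> A0 \<and> b \<in> A0)" using A0(4) n by blast
    then have "a \<in> Lv \<or> b \<in> Lv" using ab A_sub by blast
    then show False using Lv n AS ab by blast
  qed
  have "A \<noteq> {}" using B sub_A[of B] by blast
  then obtain a0 where a0: "a0 \<in> A" by blast
  have "a0 \<in> \<Union>E" using a0 A_sub A0(1) unfolding Lv_def by blast
  then have meets: "\<exists>e\<in>E. e \<inter> A \<noteq> {}" using a0 by blast
  have iso_empty: "x \<notin> isol (off E A)" for x
  proof
    assume x: "x \<in> isol (off E A)"
    have two_S: "r \<in> S" if r: "r \<in> x" "2 \<le> card (?N r \<inter> S)" for r
    proof (rule ccontr)
      assume "r \<notin> S"
      obtain v where v: "?N r \<subseteq> insert v A" using iso_nbrs[OF two x r(1)] by metis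
      have "?N r \<inter> S \<subseteq> {v}" using v AS by blast
      then have "card (?N r \<inter> S) \<le> 1" using card_mono[of "{v}"] by simp
      then show False using r(2) by simp
    qed
    obtain p c where pc: "p \<in> x" "c \<in> A" "{p, c} \<in> E" using token_exists[OF two nice x] by blast
    have pN: "p \<in> ?N c" using pc(3) unfolding nbrs_def by (simp add: insert_commute)
    have pS: "p \<in> S" using NA[OF pc(2) pN] two_S[OF pc(1)] by blast
    obtain q where q: "q \<in> x" "{p, q} \<in> E" "p \<noteq> q" "q \<notin> A" using iso_nbrs[OF two x pc(1)] by metis
    obtain p' where p': "x = {q, p'}" "?N q \<subseteq> insert p' A" using iso_nbrs[OF two x q(1)] by metis
    have "p' = p" using p'(1) pc(1) q(3) by blast
    then have Nq: "?N q \<subseteq> insert p A" using p'(2) by simp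
    have qS: "q \<notin> S" using indepS pS q(2) unfolding independent_def by blast
    have "r = p" if r: "r \<in> ?N q" for r
    proof (rule ccontr)
      assume "r \<noteq> p"
      then have "r \<in> A" using Nq r by blast
      moreover have "q \<in> ?N r" using r nbrs_sym by metis
      ultimately show False using NA two_S[OF q(1)] qS by blast
    qed
    moreover have pNq: "p \<in> ?N q" using q(2) unfolding nbrs_def by (simp add: insert_commute)
    ultimately have "?N q = {p}" by blast
    then have cq: "card (?N q) = 1" by simp
    then have qLv: "q \<in> Lv" using q(2) qS unfolding Lv_def by blast
    \<comment> \<open>The only neighbour \<open>p\<close> of \<open>q\<close> is shared with
      \<open>c\<close> in \<open>A\<close>, which is all that validity asks at
      \<open>q\<close>.\<close>
    have "valid E (insert q A)" unfolding valid_def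
    proof
      fix a assume "a \<in> insert q A"
      then consider "a = q" | "a \<in> A" by blast
      then show "card (?N a) \<le> 2 * card {s\<in>?N a. \<exists>b\<in>insert q A. b \<noteq> a \<and> s \<in> ?N b}"
      proof cases
        case 1
        have "p \<in> {s\<in>?N q. \<exists>b\<in>insert q A. b \<noteq> q \<and> s \<in> ?N b}"
          using pNq pN pc(2) q(4) by (intro CollectI conjI bexI[of _ c]) auto
        then have "card {s\<in>?N q. \<exists>b\<in>insert q A. b \<noteq> q \<and> s \<in> ?N b} > 0" using finN by (auto simp: card_gt_0_iff)
        then show ?thesis unfolding 1 cq by linarith
      next
        case 2
        show ?thesis by (rule valid_mono[OF validA 2]) blast
      qed
    qed
    then have "q \<in> A" using sub_A[of "insert q A"] qLv A_sub by blast
    then show False using q(4) by blast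
  qed
  show ?thesis
  proof (rule indep_cell_perm[OF finE two, where C = A and A = "{}" and sf = id and tf = id])
    show "\<not> e \<subseteq> A" if "e \<in> E" for e using indep_not_subset[OF indepA that two[OF that]] .
    show "good (off E A - isol (off E A))" using good_off meets by blast
    show "\<exists>u\<in>x. \<exists>c\<in>A. {u, c} \<in> E \<and> (card (?N u \<inter> A) = 1 \<or> u \<in> {} \<and> c = id u)" if "x \<in> isol (off E A)" for x
      using iso_empty that by blast
    fix a assume a: "a \<in> A"
    have "card {s\<in>?N a. \<exists>b\<in>A. b \<noteq> a \<and> s \<in> ?N b} \<le> card {w\<in>?N a. 2 \<le> card (?N w \<inter> A)}"
    proof (rule card_mono)
      show "{s\<in>?N a. \<exists>b\<in>A. b \<noteq> a \<and> s \<in> ?N b} \<subseteq> {w\<in>?N a. 2 \<le> card (?N w \<inter> A)}"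
      proof
        fix w assume "w \<in> {s\<in>?N a. \<exists>b\<in>A. b \<noteq> a \<and> s \<in> ?N b}"
        then obtain b where b: "w \<in> ?N a" "b \<in> A" "b \<noteq> a" "w \<in> ?N b" by blast
        have "{a, b} \<subseteq> ?N w \<inter> A" using a b nbrs_sym[of w E] by blast
        then have "card {a, b} \<le> card (?N w \<inter> A)" using finN by (intro card_mono) auto
        then show "w \<in> {w\<in>?N a. 2 \<le> card (?N w \<inter> A)}" using b(1,3) by simp
      qed
    qed (simp add: finN)
    moreover have "card (?N a) \<le> 2 * card {s\<in>?N a. \<exists>b\<in>A. b \<noteq> a \<and> s \<in> ?N b}"
      using validA a unfolding valid_def by blast
    ultimately show "card (?N a) \<le> card {w\<in>?N a. card (?N w \<inter> A) \<ge> 2 \<and> \<not> (w \<in> {} \<and> id w = a)}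
       + card {w\<in>?N a. card (?N w \<inter> A) \<ge> 2 \<and> \<not> (w \<in> {} \<and> id w = a)}" by simp
  qed simp_all
qed

text \<open>A vertex violating validity has two neighbours in \<open>S\<close> not adjacent to the rest of the set; assign these to it and remove it.\<close>
lemma dismantle:
  assumes finN: "\<And>u. finite (nbrs E u)" and "finite A0"
    and A0: "\<And>a. a \<in> A0 \<Longrightarrow> 3 \<le> card (nbrs E a \<inter> S) \<and> card (nbrs E a) = Suc (card (nbrs E a \<inter> S))"
    and invalid: "\<And>B. B \<subseteq> A0 \<Longrightarrow> B \<noteq> {} \<Longrightarrow> \<not> valid E B"
  shows "\<exists>sf tf. (\<forall>a\<in>A0. sf a \<in> nbrs E a \<inter> S \<and> tf a \<in> nbrs E a \<inter> S \<and> sf a \<noteq> tf a) \<and>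
    (\<forall>a\<in>A0. \<forall>b\<in>A0. a \<noteq> b \<longrightarrow> {sf a, tf a} \<inter> {sf b, tf b} = {})"
proof -
  let ?N = "nbrs E"
  let ?P = "\<lambda>B sf tf. (\<forall>a\<in>B. sf a \<in> ?N a \<inter> S \<and> tf a \<in> ?N a \<inter> S \<and> sf a \<noteq> tf a) \<and>
    (\<forall>a\<in>B. \<forall>b\<in>B. a \<noteq> b \<longrightarrow> {sf a, tf a} \<inter> {sf b, tf b} = {})"
  have "\<exists>sf tf. ?P B sf tf" if "finite B" "B \<subseteq> A0" for B
    using that
  proof (induction B rule: finite_psubset_induct)
    case (psubset B)
    show ?case
    proof (cases "B = {}")
      case True
      then show ?thesis by simp
    next
      case False
      then obtain a where a: "a \<in> B" "2 * card {s\<in>?N a. \<exists>b\<in>B. b \<noteq> a \<and> s \<in> ?N b} < card (?N a)"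
        using invalid[OF psubset.prems] unfolding valid_def by (meson not_le)
      let ?D = "{s\<in>?N a. \<exists>b\<in>B. b \<noteq> a \<and> s \<in> ?N b}"
      have k: "3 \<le> card (?N a \<inter> S)" "card (?N a) = Suc (card (?N a \<inter> S))" using A0 a(1) psubset.prems by blast+
      have "card (?N a \<inter> S) - card ?D \<le> card (?N a \<inter> S - ?D)" by (rule diff_card_le_card_Diff) (simp add: finN)
      \<comment> \<open>With \<open>k\<close> neighbours in \<open>S\<close> the violated condition
        says \<open>2 * card ?D \<le> k\<close>, so at least half of the \<open>k\<close> remain;
        \<open>3 \<le> k\<close> makes this at least 2.\<close>
      then have "2 \<le> card (?N a \<inter> S - ?D)" using a(2) k by linarith
      then obtain F where F: "F \<subseteq> ?N a \<inter> S - ?D" "card F = 2" by (rule obtain_subset_with_card_n)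
      define s t where "s = end1 F" and "t = end2 F"
      have st: "s \<in> F" "t \<in> F" "s \<noteq> t" unfolding s_def t_def using end1_end2_mem[OF F(2)] by blast+
      have "B - {a} \<subset> B" "B - {a} \<subseteq> A0" using a(1) psubset.prems by blast+
      then obtain sf tf where f: "?P (B - {a}) sf tf" using psubset.IH by metis
      have far: "s \<notin> ?N b" "t \<notin> ?N b" if "b \<in> B - {a}" for b using that st(1,2) F(1) by blast+
      have nb: "sf b \<in> ?N b" "tf b \<in> ?N b" if "b \<in> B - {a}" for b using that f by blast+
      have cross: "{s, t} \<inter> {sf b, tf b} = {}" if "b \<in> B - {a}" for b using far[OF that] nb[OF that] by auto
      have "?P B (sf(a := s)) (tf(a := t))"
      proof (intro conjI ballI impI)
        fix b assume b: "b \<in> B"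
        show "(sf(a := s)) b \<in> ?N b \<inter> S" "(tf(a := t)) b \<in> ?N b \<inter> S" "(sf(a := s)) b \<noteq> (tf(a := t)) b"
          using b f st F(1) by (cases "b = a", auto)+
      next
        fix b c assume b: "b \<in> B" "c \<in> B" "b \<noteq> c"
        consider "b = a" | "c = a" | "b \<noteq> a" "c \<noteq> a" by blast
        then show "{(sf(a := s)) b, (tf(a := t)) b} \<inter> {(sf(a := s)) c, (tf(a := t)) c} = {}"
        proof cases
          case 1
          then show ?thesis using cross[of c] b by simp
        next
          case 2
          then show ?thesis using cross[of b] b by (simp add: Int_commute)
        next
          case 3
          then show ?thesis using f b by simp
        qed
      qed
      then show ?thesis by blast
    qed
  qed
  then show ?thesis using assms(2) by blast
qed

text \<open>The cell is \<open>S\<close> unless some nonempty subset of \<open>A0\<close> is valid.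
  An isolated edge with an end that has one neighbour in \<open>S\<close> takes the edge to it as
  token, as no arcs lie there. Every other isolated edge sends a representative into
  \<open>A0\<close>, where one arc is dropped. \<open>dismantle\<close> makes the dropped arcs
  disjoint, and the strict inequality \<open>slack\<close> pays for the single arc end that a vertex
  of \<open>S\<close> may lose.\<close>

lemma case_indep:
  fixes E :: "'a set set"
  assumes finE: "finite E" and two: "\<And>e. e \<in> E \<Longrightarrow> card e = 2" and nice: "nice_edges E"
    and big: "\<And>u v. {u, v} \<in> E \<Longrightarrow> 7 \<le> card (nbrs E u) + card (nbrs E v)"
    and good_off: "\<And>C. \<exists>e\<in>E. e \<inter> C \<noteq> {} \<Longrightarrow> good (off E C - isol (off E C))"
    and S: "S \<subseteq> \<Union>E" "S \<noteq> {}" and independent: "independent E S"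
    and dom: "\<And>v. v \<in> \<Union>E \<Longrightarrow> v \<notin> S \<Longrightarrow> nbrs E v \<inter> S \<noteq> {}"
    and slack: "\<And>s. s \<in> S \<Longrightarrow> card (nbrs E s) < 2 * card {w\<in>nbrs E s. 2 \<le> card (nbrs E w \<inter> S)}"
  shows "good E"
proof -
  let ?N = "nbrs E"
  define k where "k u = card (?N u \<inter> S)" for u
  have finN: "finite (?N u)" for u using finite_nbrs finE two by metis
  define X where "X = isol (off E S)"
  have XE: "X \<subseteq> E" unfolding X_def isol_def off_def by blast
  have finX: "finite X" using finite_subset[OF XE finE] .
  have k1: "1 \<le> k u" "u \<notin> S" if "x \<in> X" "u \<in> x" for x u
  proof -
    show "u \<notin> S" using iso_off_C[of x E S u] that unfolding X_def by blast
    moreover have "u \<in> \<Union>E" using that XE by blast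
    ultimately have "?N u \<inter> S \<noteq> {}" by (intro dom)
    then show "1 \<le> k u" unfolding k_def using finN by (simp add: Suc_le_eq card_gt_0_iff)
  qed
  have NX: "?N u = insert v (?N u \<inter> S) \<and> v \<notin> S" if x: "x \<in> X" "x = {u, v}" for x u v
  proof -
    obtain v' where v': "x = {u, v'}" "u \<noteq> v'" "{u, v'} \<in> E" "v' \<notin> S" "?N u \<subseteq> insert v' S"
    proof -
      have "x \<in> isol (off E S)" "u \<in> x" using x unfolding X_def by simp_all
      from iso_nbrs[OF two this] show ?thesis using that by metis
    qed
    have "v' = v" using v'(1,2) x(2) by (auto simp: doubleton_eq_iff)
    moreover have "v' \<in> ?N u" using v'(3) unfolding nbrs_def by blast
    ultimately show ?thesis using v'(4,5) by blast
  qed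
  have kX: "card (?N u) = Suc (k u)" if x: "x \<in> X" "x = {u, v}" for x u v
  proof -
    have "card (insert v (?N u \<inter> S)) = Suc (card (?N u \<inter> S))"
      using NX[OF x] finN by (intro card_insert_disjoint) auto
    then show ?thesis using NX[OF x] unfolding k_def by metis
  qed
  define bad where "bad x \<longleftrightarrow> x \<in> X \<and> (\<forall>u\<in>x. 2 \<le> k u)" for x
  have "\<exists>a. bad x \<longrightarrow> a \<in> x \<and> 3 \<le> k a" for x
  proof (cases "bad x")
    case True
    then have x: "x \<in> X" unfolding bad_def by blast
    have c2: "card x = 2" using x XE two by blast
    have eq: "x = {end1 x, end2 x}" "x = {end2 x, end1 x}" using end1_end2[OF c2] by (simp_all only: insert_commute)
    have "{end1 x, end2 x} \<in> E" using x XE eq(1) by (metis subsetD)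
    \<comment> \<open>An end of an isolated edge has all neighbours but one in \<open>S\<close>, so
      the two ends together have at least 5 neighbours in \<open>S\<close>, counted with
      multiplicity.\<close>
    then have "7 \<le> Suc (k (end1 x)) + Suc (k (end2 x))" using big kX[OF x eq(1)] kX[OF x eq(2)] by metis
    then have "3 \<le> k (end1 x) \<or> 3 \<le> k (end2 x)" by linarith
    then show ?thesis using end1_end2_mem[OF c2] by blast
  qed blast
  then obtain ac where ac: "\<And>x. bad x \<Longrightarrow> ac x \<in> x \<and> 3 \<le> k (ac x)" by metis
  define A0 where "A0 = ac ` {x. bad x}"
  have "{x. bad x} \<subseteq> X" unfolding bad_def by blast
  then have finA0: "finite A0" unfolding A0_def using finX finite_subset by blast
  have A0: "\<exists>x b. bad x \<and> x = {a, b} \<and> a \<in> x \<and> b \<in> x \<and> a \<noteq> b \<and> ac x = a" if a: "a \<in> A0" for a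
  proof -
    obtain x where x: "bad x" "a = ac x" using a unfolding A0_def by blast
    have xX: "x \<in> X" using x(1) unfolding bad_def by blast
    have "a \<in> x" using ac[OF x(1)] x(2) by blast
    obtain b where "x = {a, b}" "b \<in> x" "a \<noteq> b" using iso_nbrs[OF two xX[unfolded X_def] \<open>a \<in> x\<close>] by metis
    then show ?thesis using x \<open>a \<in> x\<close> by (intro exI[of _ x] exI[of _ b] conjI) simp_all
  qed
  have X_disj: "x = y" if "x \<in> X" "y \<in> X" "u \<in> x" "u \<in> y" for x y u
    using iso_disjoint[of "off E S"] that unfolding X_def by blast
  show ?thesis
  proof (cases "\<exists>B. B \<subseteq> A0 \<and> B \<noteq> {} \<and> valid E B")
    case True
    then obtain B where B: "B \<subseteq> A0" "B \<noteq> {}" "valid E B" by blast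
    show ?thesis
    proof (rule case_valid[OF finE two nice good_off independent dom _ _ _ _ B])
      fix a assume a: "a \<in> A0"
      obtain x b where x: "bad x" "x = {a, b}" "a \<in> x" "b \<in> x" "a \<noteq> b" "ac x = a" using A0[OF a] by blast
      have xX: "x \<in> X" using x(1) unfolding bad_def by blast
      show "a \<notin> S" using k1(2)[OF xX x(3)] .
      show "p \<in> S \<or> 2 \<le> card (?N p \<inter> S)" if "p \<in> ?N a" for p
      proof -
        have "p = b \<or> p \<in> S" using that NX[OF xX x(2)] by blast
        moreover have "2 \<le> k b" using x(1,4) unfolding bad_def by blast
        ultimately show ?thesis unfolding k_def by blast
      qed
      show "c \<notin> ?N a" if c: "c \<in> A0" for c
      proof
        assume "c \<in> ?N a"
        obtain y d where y: "bad y" "y = {c, d}" "c \<in> y" "ac y = c" using A0[OF c] by blast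
        have yX: "y \<in> X" using y(1) unfolding bad_def by blast
        have "c \<notin> S" using k1(2)[OF yX y(3)] .
        then have "c = b" using \<open>c \<in> ?N a\<close> NX[OF xX x(2)] by blast
        then have "x = y" using X_disj[OF xX yX x(4)] y(3) by blast
        then show False using x(5,6) y(4) \<open>c = b\<close> by metis
      qed
    next
      show "A0 \<subseteq> \<Union>E"
      proof
        fix a assume "a \<in> A0"
        then obtain x where "bad x" "a \<in> x" using A0 by blast
        then show "a \<in> \<Union>E" using XE unfolding bad_def by blast
      qed
    qed
  next
    case False
    have "\<exists>sf tf. (\<forall>a\<in>A0. sf a \<in> ?N a \<inter> S \<and> tf a \<in> ?N a \<inter> S \<and> sf a \<noteq> tf a) \<and>
      (\<forall>a\<in>A0. \<forall>b\<in>A0. a \<noteq> b \<longrightarrow> {sf a, tf a} \<inter> {sf b, tf b} = {})"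
    proof (rule dismantle[OF finN finA0])
      fix a assume a: "a \<in> A0"
      obtain x b where x: "bad x" "x = {a, b}" "ac x = a" using A0[OF a] by blast
      have "x \<in> X" using x(1) unfolding bad_def by blast
      then show "3 \<le> card (?N a \<inter> S) \<and> card (?N a) = Suc (card (?N a \<inter> S))"
        using ac[OF x(1)] x(3) kX[OF _ x(2)] unfolding k_def by metis
    qed (use False in blast)
    then obtain sf tf where st: "\<And>a. a \<in> A0 \<Longrightarrow> sf a \<in> ?N a \<inter> S \<and> tf a \<in> ?N a \<inter> S \<and> sf a \<noteq> tf a"
      "\<And>a b. a \<in> A0 \<Longrightarrow> b \<in> A0 \<Longrightarrow> a \<noteq> b \<Longrightarrow> {sf a, tf a} \<inter> {sf b, tf b} = {}" by metis
    show ?thesis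
    proof (rule indep_cell_perm[OF finE two, where C = S and A = A0 and sf = sf and tf = tf])
      show "\<not> e \<subseteq> S" if "e \<in> E" for e using indep_not_subset[OF independent that two[OF that]] .
      obtain s e where "s \<in> S" "e \<in> E" "s \<in> e" using S by blast
      then show "good (off E S - isol (off E S))" by (intro good_off) blast
      show "a \<notin> S \<and> sf a \<in> ?N a \<inter> S \<and> tf a \<in> ?N a \<inter> S \<and> sf a \<noteq> tf a" if a: "a \<in> A0" for a
      proof -
        obtain x where x: "bad x" "a \<in> x" using A0[OF a] by blast
        then show ?thesis using st(1)[OF a] k1(2)[of x a] unfolding bad_def by blast
      qed
      show "\<exists>u\<in>x. \<exists>c\<in>S. {u, c} \<in> E \<and> (card (?N u \<inter> S) = 1 \<or> u \<in> A0 \<and> c = sf u)" if x: "x \<in> isol (off E S)" for x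
      proof (cases "bad x")
        case True
        have "ac x \<in> A0" using True unfolding A0_def by blast
        moreover have "ac x \<in> x" using ac[OF True] by blast
        moreover have "sf (ac x) \<in> S" "{ac x, sf (ac x)} \<in> E" using st(1)[OF calculation(1)] unfolding nbrs_def by blast+
        ultimately show ?thesis by blast
      next
        case False
        have xX: "x \<in> X" using x unfolding X_def .
        then obtain u where u: "u \<in> x" "\<not> 2 \<le> k u" using False unfolding bad_def by blast
        then have "k u = 1" using k1(1)[OF xX u(1)] by linarith
        then have ku: "card (?N u \<inter> S) = 1" unfolding k_def .
        then obtain c where "?N u \<inter> S = {c}" by (rule card_1_singletonE)
        then have "c \<in> S" "{u, c} \<in> E" unfolding nbrs_def by blast+
        then show ?thesis using u(1) ku by blast
      qed
      fix s assume s: "s \<in> S"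
      define W where "W = {w\<in>?N s. 2 \<le> card (?N w \<inter> S)}"
      define D1 where "D1 = {w\<in>W. w \<in> A0 \<and> sf w = s}"
      define D2 where "D2 = {w\<in>W. w \<in> A0 \<and> tf w = s}"
      have finW: "finite W" "finite D1" "finite D2" unfolding W_def D1_def D2_def using finN by simp_all
      have "w \<notin> D2" if "w \<in> D1" for w using that st(1)[of w] unfolding D1_def D2_def by auto
      then have "D1 \<inter> D2 = {}" by blast
      then have "card D1 + card D2 = card (D1 \<union> D2)" using finW by (simp add: card_Un_disjoint)
      \<comment> \<open>The pairs \<open>{sf w, tf w}\<close> are disjoint for different
        \<open>w\<close>, so \<open>s\<close> lies in at most one of them.\<close>
      also have "\<dots> \<le> 1"
      proof -
        have "w = w'" if "w \<in> D1 \<union> D2" "w' \<in> D1 \<union> D2" for w w'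
        proof (rule ccontr)
          assume ne: "w \<noteq> w'"
          have "w \<in> A0" "w' \<in> A0" "s \<in> {sf w, tf w}" "s \<in> {sf w', tf w'}"
            using that unfolding D1_def D2_def by auto
          then show False using st(2)[of w w'] ne by blast
        qed
        then show ?thesis using finW card_le_Suc0_iff_eq[of "D1 \<union> D2"] by (metis One_nat_def finite_UnI)
      qed
      finally have D: "card D1 + card D2 \<le> 1" .
      have W1: "{w\<in>?N s. 2 \<le> card (?N w \<inter> S) \<and> \<not> (w \<in> A0 \<and> sf w = s)} = W - D1"
        unfolding W_def D1_def by blast
      have W2: "{w\<in>?N s. 2 \<le> card (?N w \<inter> S) \<and> \<not> (w \<in> A0 \<and> tf w = s)} = W - D2"
        unfolding W_def D2_def by blast
      have "card W - card D1 \<le> card (W - D1)" "card W - card D2 \<le> card (W - D2)"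
        using finW by (auto intro: diff_card_le_card_Diff)
      moreover have "card (?N s) < 2 * card W" using slack[OF s] unfolding W_def .
      ultimately have "card (?N s) \<le> card (W - D1) + card (W - D2)" using D by linarith
      then show "card (?N s) \<le> card {w\<in>?N s. 2 \<le> card (?N w \<inter> S) \<and> \<not> (w \<in> A0 \<and> sf w = s)}
         + card {w\<in>?N s. 2 \<le> card (?N w \<inter> S) \<and> \<not> (w \<in> A0 \<and> tf w = s)}"
        unfolding W1 W2 .
    qed
  qed
qed

section \<open>The induction over edge sets and the theorem\<close>

lemma good_empty: "good {}"
  unfolding good_def coef_def by simp

text \<open>Strong induction on the number of edges: any cell that meets an edge leaves a smaller
  edge set, and discarding the newly isolated edges keeps it nice. Light edges are treated first,
  since the other two kinds of cells rely on degree sums of at least 7.\<close>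

theorem nice_edges_good:
  fixes E :: "'a set set"
  assumes "finite E" "\<And>e. e \<in> E \<Longrightarrow> card e = 2" "nice_edges E"
  shows "good E"
  using assms
proof (induction "card E" arbitrary: E rule: less_induct)
  case less
  let ?N = "nbrs E"
  have good_off: "good (off E C - isol (off E C))" if C: "\<exists>e\<in>E. e \<inter> C \<noteq> {}" for C
  proof (rule less.hyps)
    have "off E C - isol (off E C) \<subset> E" using C unfolding off_def by blast
    then show "card (off E C - isol (off E C)) < card E" by (rule psubset_card_mono[OF less.prems(1)])
    show "finite (off E C - isol (off E C))" using less.prems(1) unfolding off_def by simp
    show "card e = 2" if "e \<in> off E C - isol (off E C)" for e using that less.prems(2) unfolding off_def by blast
    show "nice_edges (off E C - isol (off E C))" by (rule nice_edges_minus_iso)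
  qed
  have cN: "card {e\<in>E. u \<in> e} = card (?N u)" for u using less.prems(2) by (rule card_edges_at)
  show ?case
  proof (cases "E = {}")
    case True
    then show ?thesis using good_empty by simp
  next
    case ne: False
    show ?thesis
    proof (cases "\<exists>a b. {a, b} \<in> E \<and> card (?N a) + card (?N b) \<le> 6")
      case True
      then obtain a b where ab: "{a, b} \<in> E" "card (?N a) + card (?N b) \<le> 6" by blast
      have "a \<noteq> b" using less.prems(2)[OF ab(1)] by auto
      have "good (off E {a, b} - isol (off E {a, b}))" by (intro good_off bexI[OF _ ab(1)]) simp
      moreover have "card {e\<in>E. a \<in> e} + card {e\<in>E. b \<in> e} \<le> 6" using ab(2) unfolding cN .
      ultimately show ?thesis
        using edge_cell[of E a b] less.prems ab(1) \<open>a \<noteq> b\<close> by blast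
    next
      case False
      have big: "7 \<le> card (?N u) + card (?N v)" if "{u, v} \<in> E" for u v
      proof -
        have "\<not> card (?N u) + card (?N v) \<le> 6" using False that by blast
        then show ?thesis by linarith
      qed
      obtain S where S: "S \<subseteq> \<Union>E" "independent E S" "\<And>v. v \<in> \<Union>E \<Longrightarrow> v \<notin> S \<Longrightarrow> ?N v \<inter> S \<noteq> {}"
        "\<And>s w. ?N w \<inter> S = {s} \<Longrightarrow> card (?N w) \<le> card (?N s)"
        "\<And>s w w'. ?N w \<inter> S = {s} \<Longrightarrow> ?N w' \<inter> S = {s} \<Longrightarrow> w \<noteq> w' \<Longrightarrow> {w, w'} \<in> E"
        using maximal_indep[OF less.prems(1,2)] by metis
      show ?thesis
      proof (cases "\<exists>s\<in>S. 2 * card {w\<in>?N s. 2 \<le> card (?N w \<inter> S)} \<le> card (?N s)")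
        case True
        then obtain s where s: "s \<in> S" "2 * card {w\<in>?N s. 2 \<le> card (?N w \<inter> S)} \<le> card (?N s)" by blast
        have "s \<in> \<Union>E" using s(1) S(1) by blast
        show ?thesis
          by (rule case_pair[OF less.prems(1,2) big good_off S(2,4,5) s(1) \<open>s \<in> \<Union>E\<close> s(2)])
      next
        case slack: False
        have "S \<noteq> {}"
        proof
          assume "S = {}"
          then have "\<Union>E = {}" using S(3) by blast
          moreover obtain e where "e \<in> E" using ne by blast
          ultimately have "card e = 0" by auto
          then show False using less.prems(2)[OF \<open>e \<in> E\<close>] by simp
        qed
        show ?thesis
          by (rule case_indep[OF less.prems(1,2,3) big good_off S(1) \<open>S \<noteq> {}\<close> S(2,3)])
             (use slack in \<open>auto simp: not_le\<close>)
      qed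
    qed
  qed
qed

theorem theorem1p1:
  fixes V :: "'a set" and E :: "'a set set"
  assumes "nice V E"
  shows "total_weight_choosable V E 1 5"
proof -
  have finV: "finite V" and EV: "\<And>e. e \<in> E \<Longrightarrow> e \<subseteq> V" and two: "\<And>e. e \<in> E \<Longrightarrow> card e = 2"
    and noiso: "\<And>e. e \<in> E \<Longrightarrow> \<not> isolated_edge E e"
    using assms unfolding nice_def simple_graph_def by blast+
  have "E \<subseteq> Pow V" using EV by blast
  then have finE: "finite E" using finV by (meson finite_Pow_iff finite_subset)
  have "nice_edges E" unfolding nice_edges_def
  proof
    fix e assume e: "e \<in> E"
    obtain i where i: "i \<in> e" "degree E i \<noteq> 1" using noiso[OF e] e unfolding isolated_edge_def by blast
    have "incident_edges E i \<noteq> {e}" using i(2) unfolding degree_def by auto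
    then obtain e' where "e' \<in> E" "i \<in> e'" "e' \<noteq> e" using e i(1) unfolding incident_edges_def by blast
    then show "\<exists>e'\<in>E. e' \<noteq> e \<and> e \<inter> e' \<noteq> {}" using i(1) by blast
  qed
  then have good: "good E" using nice_edges_good[OF finE] two by blast
  show ?thesis unfolding total_weight_choosable_def
  proof (intro allI impI)
    fix LV :: "'a \<Rightarrow> real set" and LE :: "'a set \<Rightarrow> real set"
    assume LV: "\<forall>v\<in>V. finite (LV v) \<and> card (LV v) = 1" and LE: "\<forall>e\<in>E. finite (LE e) \<and> card (LE e) = 5"
    \<comment> \<open>The one-element lists determine the vertex weights, whose differences become
      the constants added to the edge factors.\<close>
    define p where "p v = (SOME x. x \<in> LV v)" for v
    have p: "p v \<in> LV v" if "v \<in> V" for v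
    proof -
      have "LV v \<noteq> {}" using LV that by fastforce
      then show ?thesis unfolding p_def by (simp add: some_in_eq)
    qed
    have LE5: "card (LE e) = 5" if "e \<in> E" for e using LE that by blast
    obtain y where y: "\<And>e. e \<in> E \<Longrightarrow> y e \<in> LE e"
      "\<And>e. e \<in> E \<Longrightarrow> vertex_sum E y (end1 e) - vertex_sum E y (end2 e) + (p (end1 e) - p (end2 e)) \<noteq> 0"
      using good_imp_nonzero[OF finE good, of LE "\<lambda>e. p (end1 e) - p (end2 e)"] LE5 by metis
    have "vertex_sum E y u + p u \<noteq> vertex_sum E y v + p v" if uv: "{u, v} \<in> E" for u v
    proof -
      have "{end1 {u, v}, end2 {u, v}} = {u, v}" using end1_end2[OF two[OF uv]] by simp
      then have "(end1 {u, v} = u \<and> end2 {u, v} = v) \<or> (end1 {u, v} = v \<and> end2 {u, v} = u)"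
        by (simp only: doubleton_eq_iff)
      then show ?thesis using y(2)[OF uv] by auto
    qed
    then show "\<exists>phiV phiE. (\<forall>v\<in>V. phiV v \<in> LV v) \<and> (\<forall>e\<in>E. phiE e \<in> LE e) \<and>
         (\<forall>u v. {u, v} \<in> E \<longrightarrow>
            (\<Sum>e\<in>incident_edges E u. phiE e) + phiV u \<noteq>
            (\<Sum>e\<in>incident_edges E v. phiE e) + phiV v)"
      using p y(1) unfolding vertex_sum_def incident_edges_def by blast
  qed
qed

end
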